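(* A topological sorting of a directed acyclic input graph $G=(V,E)$ with $n$ vertices and $m$ edges can be computed in $O(n+m)$ time with at most any of the following numbers of bits: (a) $\bigl(2n+2L_0^{\mathrm{in}}(G)\bigr)\bigl(1+O\bigl(\frac{\log\log n}{\log n}\bigr)\bigr)$; (b) $\bigl(2n+\frac{4}{3}m\bigr)\bigl(1+O\bigl(\frac{\log\log n}{\log n}\bigr)\bigr)$; (c) $2n\log\bigl(2+\frac{4m}{n}\bigr)\bigl(1+O\bigl(\frac{\log\log n}{\log n}\bigr)\bigr)$.
   Context: $\log$ denotes $\log_2$. $L_0^{\mathrm{in}}(G)=\sum_{v\in V,\ d_v\ge 2}\lceil\log_2 d_v\rceil$, where $d_v$ is the indegree of $v$ in $G$. Topologically sorting $G$ means outputting the vertices of $G$ in an order such that for each $(u,v)\in E$, $u$ is output before $v$. Model of computation: word RAM with word length $\Omega(\log n)$ bits and constant-time standard word operations; the input is read-only, the output is write-only, and space is the number of bits of working memory, not counting input and output. Input representation: the vertex set is $V=\{1,\ldots,n\}$ for a known integer $n\ge 1$. The directed graph is represented with in/out adjacency arrays, i.e., the in- and outdegree of each vertex are available and the inneighbors as well as the outneighbors of each vertex can be accessed by index in constant time, and there are cross links: for each edge $(u,v)$, a function $\mathrm{mate}$ maps in constant time the position of $v$ in the adjacency array of $u$ to that of $u$ in the adjacency array of $v$ and vice versa. *)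

theory Defs
  imports Complex_Main "HOL-Library.Landau_Symbols"
begin

unbundle bit_operations_syntax

section \<open>Input graphs\<close>

text \<open>
  A directed graph on the vertices \<open>1, \<dots>, n\<close> together with its in/out adjacency arrays (positions
  are counted from 0) and cross links. If \<open>v\<close> is at position \<open>i\<close> of the out-array of \<open>u\<close>, then
  \<open>u\<close> is at position \<open>mate_out G u i\<close> of the in-array of \<open>v\<close>; \<open>mate_in\<close> is the reverse link.
\<close>

record input_graph =
  nverts :: nat
  edges :: "(nat \<times> nat) set"
  out_arr :: "nat \<Rightarrow> nat list"
  in_arr :: "nat \<Rightarrow> nat list"
  mate_out :: "nat \<Rightarrow> nat \<Rightarrow> nat"
  mate_in :: "nat \<Rightarrow> nat \<Rightarrow> nat"

abbreviation verts :: "input_graph \<Rightarrow> nat set" where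
  "verts G \<equiv> {1..nverts G}"

abbreviation nedges :: "input_graph \<Rightarrow> nat" where
  "nedges G \<equiv> card (edges G)"

definition indegree :: "input_graph \<Rightarrow> nat \<Rightarrow> nat" where
  "indegree G v = card {u. (u, v) \<in> edges G}"

text \<open>Nothing is said about array positions out of range: a program that accesses one
  gets an arbitrary word.\<close>

definition valid_input :: "input_graph \<Rightarrow> bool" where
  "valid_input G \<longleftrightarrow>
     nverts G \<ge> 1 \<and>
     edges G \<subseteq> verts G \<times> verts G \<and>
     (\<forall>u\<in>verts G. distinct (out_arr G u) \<and> set (out_arr G u) = {v. (u, v) \<in> edges G}) \<and>
     (\<forall>v\<in>verts G. distinct (in_arr G v) \<and> set (in_arr G v) = {u. (u, v) \<in> edges G}) \<and>
     (\<forall>u\<in>verts G. \<forall>i<length (out_arr G u).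
        let v = out_arr G u ! i; j = mate_out G u i
        in j < length (in_arr G v) \<and> in_arr G v ! j = u) \<and>
     (\<forall>v\<in>verts G. \<forall>j<length (in_arr G v).
        let u = in_arr G v ! j; i = mate_in G v j
        in i < length (out_arr G u) \<and> out_arr G u ! i = v)"

definition L0_in :: "input_graph \<Rightarrow> int" where
  "L0_in G = (\<Sum>v\<in>{v\<in>verts G. indegree G v \<ge> 2}. \<lceil>log 2 (real (indegree G v))\<rceil>)"

definition topological_sorting :: "input_graph \<Rightarrow> nat list \<Rightarrow> bool" where
  "topological_sorting G xs \<longleftrightarrow>
     distinct xs \<and> set xs = verts G \<and>
     (\<forall>(u, v)\<in>edges G. \<exists>i j. i < j \<and> j < length xs \<and> xs ! i = u \<and> xs ! j = v)"


section \<open>Word RAM\<close>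

text \<open>
  Words are natural numbers below \<open>2 ^ w\<close>, where the word length \<open>w\<close> is a parameter of the
  semantics. A program is a list of instructions over finitely many registers and a
  word-addressed memory; it is run without knowing \<open>w\<close>. The destination register comes first.
\<close>

datatype binop = Add | Sub | Mul | Div | Mod | And | Or | Xor | Shl | Shr

datatype 'r instr =
    Const 'r nat
  | Complement 'r 'r
  | Binop binop 'r 'r 'r
  | Load 'r 'r                \<comment> \<open>destination, address\<close>
  | Store 'r 'r               \<comment> \<open>address, source\<close>
  | Jump nat
  | JumpEq 'r 'r nat
  | JumpLess 'r 'r nat
  | ReadN 'r
  | ReadOutdeg 'r 'r
  | ReadIndeg 'r 'r
  | ReadOut 'r 'r 'r          \<comment> \<open>destination, vertex, position\<close>
  | ReadIn 'r 'r 'r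
  | ReadMateOut 'r 'r 'r
  | ReadMateIn 'r 'r 'r
  | Output 'r

type_synonym program = "nat instr list"

record config =
  pc :: nat
  regs :: "nat \<Rightarrow> nat"
  mem :: "nat \<Rightarrow> nat"
  printed :: "nat list"

fun binop_val :: "nat \<Rightarrow> binop \<Rightarrow> nat \<Rightarrow> nat \<Rightarrow> nat" where
  "binop_val w Add x y = take_bit w (x + y)"
| "binop_val w Sub x y = take_bit w (x + 2 ^ w - y)"
| "binop_val w Mul x y = take_bit w (x * y)"
| "binop_val w Div x y = x div y"
| "binop_val w Mod x y = x mod y"
| "binop_val w And x y = x AND y"
| "binop_val w Or x y = x OR y"
| "binop_val w Xor x y = x XOR y"
| "binop_val w Shl x y = take_bit w (push_bit y x)"
| "binop_val w Shr x y = drop_bit y x"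

definition set_reg :: "nat \<Rightarrow> nat \<Rightarrow> nat \<Rightarrow> config \<Rightarrow> config" where
  "set_reg w r x c = c\<lparr>pc := Suc (pc c), regs := (regs c)(r := take_bit w x)\<rparr>"

fun exec :: "nat \<Rightarrow> input_graph \<Rightarrow> nat instr \<Rightarrow> config \<Rightarrow> config" where
  "exec w G (Const r a) c = set_reg w r a c"
| "exec w G (Complement r s) c = set_reg w r (2 ^ w - 1 - regs c s) c"
| "exec w G (Binop f r s t) c = set_reg w r (binop_val w f (regs c s) (regs c t)) c"
| "exec w G (Load r s) c = set_reg w r (mem c (regs c s)) c"
| "exec w G (Store r s) c = c\<lparr>pc := Suc (pc c), mem := (mem c)(regs c r := regs c s)\<rparr>"
| "exec w G (Jump l) c = c\<lparr>pc := l\<rparr>"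
| "exec w G (JumpEq r s l) c = c\<lparr>pc := (if regs c r = regs c s then l else Suc (pc c))\<rparr>"
| "exec w G (JumpLess r s l) c = c\<lparr>pc := (if regs c r < regs c s then l else Suc (pc c))\<rparr>"
| "exec w G (ReadN r) c = set_reg w r (nverts G) c"
| "exec w G (ReadOutdeg r u) c = set_reg w r (length (out_arr G (regs c u))) c"
| "exec w G (ReadIndeg r v) c = set_reg w r (length (in_arr G (regs c v))) c"
| "exec w G (ReadOut r u i) c = set_reg w r (out_arr G (regs c u) ! regs c i) c"
| "exec w G (ReadIn r v j) c = set_reg w r (in_arr G (regs c v) ! regs c j) c"
| "exec w G (ReadMateOut r u i) c = set_reg w r (mate_out G (regs c u) (regs c i)) c"
| "exec w G (ReadMateIn r v j) c = set_reg w r (mate_in G (regs c v) (regs c j)) c"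
| "exec w G (Output r) c = c\<lparr>pc := Suc (pc c), printed := printed c @ [regs c r]\<rparr>"

text \<open>A run ends by leaving the program text.\<close>

definition halted :: "program \<Rightarrow> config \<Rightarrow> bool" where
  "halted P c \<longleftrightarrow> pc c \<ge> length P"

definition step :: "program \<Rightarrow> nat \<Rightarrow> input_graph \<Rightarrow> config \<Rightarrow> config" where
  "step P w G c = (if halted P c then c else exec w G (P ! pc c) c)"

definition init_config :: config where
  "init_config = \<lparr>pc = 0, regs = (\<lambda>_. 0), mem = (\<lambda>_. 0), printed = []\<rparr>"

definition config_at :: "program \<Rightarrow> nat \<Rightarrow> input_graph \<Rightarrow> nat \<Rightarrow> config" where
  "config_at P w G t = (step P w G ^^ t) init_config"

definition computes_in_time ::
  "program \<Rightarrow> nat \<Rightarrow> input_graph \<Rightarrow> (nat list \<Rightarrow> bool) \<Rightarrow> real \<Rightarrow> bool" where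
  "computes_in_time P w G spec T \<longleftrightarrow>
     (\<exists>t. real t \<le> T \<and> halted P (config_at P w G t) \<and> spec (printed (config_at P w G t)))"

fun instr_addresses :: "nat instr \<Rightarrow> config \<Rightarrow> nat set" where
  "instr_addresses (Load r s) c = {regs c s}"
| "instr_addresses (Store r s) c = {regs c r}"
| "instr_addresses _ c = {}"

definition accessed :: "program \<Rightarrow> config \<Rightarrow> nat set" where
  "accessed P c = (if halted P c then {} else instr_addresses (P ! pc c) c)"

definition num_regs :: "program \<Rightarrow> nat" where
  "num_regs P = card (\<Union>i\<in>set P. set_instr i)"

text \<open>
  The working memory consists of the registers and an initial segment of \<open>A\<close> memory cells. All
  of these count with the same number \<open>b\<close> of bits, where \<open>b\<close> bits suffice for every value held in
  any of them during the run. Always \<open>b = w\<close> is possible; charging \<open>b\<close> rather than \<open>w\<close> only matters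
  if \<open>w\<close> is much larger than needed, where a single word could exceed the whole space bound.
  The program counter belongs to the finite control and is not counted.
\<close>

definition runs_in_space :: "program \<Rightarrow> nat \<Rightarrow> input_graph \<Rightarrow> real \<Rightarrow> bool" where
  "runs_in_space P w G S \<longleftrightarrow>
     (\<exists>A b. (\<forall>t. let c = config_at P w G t in
               accessed P c \<subseteq> {..<A} \<and> (\<forall>r. regs c r < 2 ^ b) \<and> (\<forall>a. mem c a < 2 ^ b)) \<and>
            real ((num_regs P + A) * b) \<le> S)"

text \<open>Every number up to \<open>n + m\<close> fits into a word. This is the proviso implicit in
  \<open>w = \<Omega>(log n)\<close> that vertices and memory cells in use can be addressed; there is no upper
  bound on \<open>w\<close>.\<close>

definition word_length_ok :: "nat \<Rightarrow> input_graph \<Rightarrow> bool" where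
  "word_length_ok w G \<longleftrightarrow> nverts G + nedges G < 2 ^ w"

end

theory Submission
  imports Defs
begin

text \<open>
  Kahn's algorithm is organised as a depth-first traversal that needs no stack. Every vertex \<open>v\<close> of
  indegree \<open>d\<close> owns a field with values below \<open>d\<close>. The field first counts the in-edges of \<open>v\<close> that
  have not been scanned yet. When the last one, \<open>(u, v)\<close>, is scanned, \<open>v\<close> is output, the traversal
  continues at \<open>v\<close>, and the field, no longer needed as a counter, records the position of \<open>u\<close> in the
  in-array of \<open>v\<close>; the cross link at this position leads back to the place in the out-array of \<open>u\<close>
  where the scan is to be resumed.

  The fields are stored as bit planes: plane \<open>t\<close> holds bit \<open>t\<close> of every field with more than \<open>t\<close> bits,
  together with a mark that tells whether the field continues in plane \<open>t + 1\<close>. If the planes are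
  concatenated, a bit at position \<open>p\<close> is continued at position \<open>n + rank p\<close>, where \<open>rank p\<close> is the number of
  marks before \<open>p\<close>, and ranks are available in constant time with \<open>O(log log n / log n)\<close> extra bits per
  position. There are at most \<open>n + L0_in G\<close> positions of two bits each. A decrement of a binary counter
  touches \<open>O(1)\<close> bits on average, and the parent position is written and read once, so the running time
  is linear. The bounds (b) and (c) follow from (a), since \<open>3 \<lceil>log d\<rceil> \<le> 2 d\<close> for \<open>d \<ge> 2\<close>
  and by the concavity of the logarithm.
\<close>

section \<open>A structured language and its compiler\<close>

text \<open>Memory is charged by the number \<open>b\<close> of bits that suffice for every value of
  a run, while words may be much longer and the program does not know \<open>w\<close>. So the
  program has to work with the bit length \<open>b\<close> of \<open>n + m\<close>, which it
  computes itself, and no value may reach \<open>2 ^ b\<close>; hence the exact arithmetic with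
  no-overflow conditions in the language below. A cell offers \<open>b\<close> bits:
  \<open>q\<close> data bits, \<open>q\<close> marks, and \<open>O(log b)\<close> bits for a rank
  relative to a block. Thus \<open>b / q = 2 + O(log b / b)\<close>, and this quotient is the factor
  2 in front of \<open>n + L0_in G\<close>. As \<open>m \<le> n * n\<close>, \<open>b\<close> lies
  between \<open>log n\<close> and about \<open>2 * log n\<close>, which turns
  \<open>log b / b\<close> into \<open>log log n / log n\<close>; moreover anything of size
  \<open>2 ^ (b / 2)\<close> is \<open>O(n)\<close>, so that the popcount table, the block ranks and
  the counters vanish in the error term. This works for \<open>b \<ge> 64\<close>. Inputs with
  \<open>n < 2 ^ 63\<close> get a whole cell per vertex instead; their bounded space need is
  absorbed by an error term that is constant there.\<close>

datatype expr =
    V nat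
  | K nat
  | Op binop expr expr
  | Mem expr
  | NV
  | OutDeg expr
  | InDeg expr
  | OutV expr expr
  | InV expr expr
  | MOut expr expr
  | MIn expr expr

datatype bexp = Lt expr expr | Eq expr expr

datatype com =
    Skip
  | Assign nat expr  ("_ ::= _" [1000, 61] 61)
  | Put expr expr
  | Print expr
  | Seq com com  (infixr ";;" 60)
  | If bexp com com
  | While bexp com

fun opv :: "binop \<Rightarrow> nat \<Rightarrow> nat \<Rightarrow> nat" where
  "opv Add x y = x + y"
| "opv Sub x y = x - y"
| "opv Mul x y = x * y"
| "opv Div x y = x div y"
| "opv Mod x y = x mod y"
| "opv And x y = x AND y"
| "opv Or x y = x OR y"
| "opv Xor x y = x XOR y"
| "opv Shl x y = x * 2 ^ y"
| "opv Shr x y = x div 2 ^ y"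

text \<open>
  The following conditions keep every intermediate value below \<open>2 ^ b\<close>, so that no operation wraps
  around on words of at least \<open>b\<close> bits, and they keep the accesses to the input within range.
\<close>

fun op_ok :: "nat \<Rightarrow> binop \<Rightarrow> nat \<Rightarrow> nat \<Rightarrow> bool" where
  "op_ok b Add x y \<longleftrightarrow> x + y < 2 ^ b"
| "op_ok b Sub x y \<longleftrightarrow> y \<le> x"
| "op_ok b Mul x y \<longleftrightarrow> x * y < 2 ^ b"
| "op_ok b Shl x y \<longleftrightarrow> x * 2 ^ y < 2 ^ b"
| "op_ok b _ x y \<longleftrightarrow> True"

fun ev :: "input_graph \<Rightarrow> (nat \<Rightarrow> nat) \<Rightarrow> (nat \<Rightarrow> nat) \<Rightarrow> expr \<Rightarrow> nat" where
  "ev G R M (V r) = R r"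
| "ev G R M (K k) = k"
| "ev G R M (Op f x y) = opv f (ev G R M x) (ev G R M y)"
| "ev G R M (Mem x) = M (ev G R M x)"
| "ev G R M NV = nverts G"
| "ev G R M (OutDeg x) = length (out_arr G (ev G R M x))"
| "ev G R M (InDeg x) = length (in_arr G (ev G R M x))"
| "ev G R M (OutV x y) = out_arr G (ev G R M x) ! ev G R M y"
| "ev G R M (InV x y) = in_arr G (ev G R M x) ! ev G R M y"
| "ev G R M (MOut x y) = mate_out G (ev G R M x) (ev G R M y)"
| "ev G R M (MIn x y) = mate_in G (ev G R M x) (ev G R M y)"

fun safe :: "input_graph \<Rightarrow> nat \<Rightarrow> nat \<Rightarrow> (nat \<Rightarrow> nat) \<Rightarrow> (nat \<Rightarrow> nat) \<Rightarrow> expr \<Rightarrow> bool" where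
  "safe G b A R M (V r) \<longleftrightarrow> r < 100"
| "safe G b A R M (K k) \<longleftrightarrow> k < 2 ^ b"
| "safe G b A R M (Op f x y) \<longleftrightarrow> safe G b A R M x \<and> safe G b A R M y \<and>
     op_ok b f (ev G R M x) (ev G R M y)"
| "safe G b A R M (Mem x) \<longleftrightarrow> safe G b A R M x \<and> ev G R M x < A"
| "safe G b A R M NV \<longleftrightarrow> True"
| "safe G b A R M (OutDeg x) \<longleftrightarrow> safe G b A R M x \<and> ev G R M x \<in> verts G"
| "safe G b A R M (InDeg x) \<longleftrightarrow> safe G b A R M x \<and> ev G R M x \<in> verts G"
| "safe G b A R M (OutV x y) \<longleftrightarrow> safe G b A R M x \<and> safe G b A R M y \<and>
     ev G R M x \<in> verts G \<and> ev G R M y < length (out_arr G (ev G R M x))"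
| "safe G b A R M (InV x y) \<longleftrightarrow> safe G b A R M x \<and> safe G b A R M y \<and>
     ev G R M x \<in> verts G \<and> ev G R M y < length (in_arr G (ev G R M x))"
| "safe G b A R M (MOut x y) \<longleftrightarrow> safe G b A R M x \<and> safe G b A R M y \<and>
     ev G R M x \<in> verts G \<and> ev G R M y < length (out_arr G (ev G R M x))"
| "safe G b A R M (MIn x y) \<longleftrightarrow> safe G b A R M x \<and> safe G b A R M y \<and>
     ev G R M x \<in> verts G \<and> ev G R M y < length (in_arr G (ev G R M x))"

fun bev :: "input_graph \<Rightarrow> (nat \<Rightarrow> nat) \<Rightarrow> (nat \<Rightarrow> nat) \<Rightarrow> bexp \<Rightarrow> bool" where
  "bev G R M (Lt x y) \<longleftrightarrow> ev G R M x < ev G R M y"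
| "bev G R M (Eq x y) \<longleftrightarrow> ev G R M x = ev G R M y"

fun bsafe :: "input_graph \<Rightarrow> nat \<Rightarrow> nat \<Rightarrow> (nat \<Rightarrow> nat) \<Rightarrow> (nat \<Rightarrow> nat) \<Rightarrow> bexp \<Rightarrow> bool" where
  "bsafe G b A R M (Lt x y) \<longleftrightarrow> safe G b A R M x \<and> safe G b A R M y"
| "bsafe G b A R M (Eq x y) \<longleftrightarrow> safe G b A R M x \<and> safe G b A R M y"

fun esize :: "expr \<Rightarrow> nat" where
  "esize (V r) = 1"
| "esize (K k) = 1"
| "esize (Op f x y) = esize x + esize y + 1"
| "esize (Mem x) = esize x + 1"
| "esize NV = 1"
| "esize (OutDeg x) = esize x + 1"
| "esize (InDeg x) = esize x + 1"
| "esize (OutV x y) = esize x + esize y + 1"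
| "esize (InV x y) = esize x + esize y + 1"
| "esize (MOut x y) = esize x + esize y + 1"
| "esize (MIn x y) = esize x + esize y + 1"

fun bsize :: "bexp \<Rightarrow> nat" where
  "bsize (Lt x y) = esize x + esize y + 1"
| "bsize (Eq x y) = esize x + esize y + 1"

text \<open>The number of steps is the exact instruction count of the compiled code; the additional
  1 in \<open>IfF\<close>, \<open>WhileT\<close> and \<open>WhileF\<close> is a \<open>Jump\<close>.
  Since unsafe evaluation has no rule, the existence of a run includes both safety and
  termination.\<close>

inductive run :: "input_graph \<Rightarrow> nat \<Rightarrow> nat \<Rightarrow> com \<Rightarrow> (nat \<Rightarrow> nat) \<Rightarrow> (nat \<Rightarrow> nat) \<Rightarrow> nat list \<Rightarrow>
    nat \<Rightarrow> (nat \<Rightarrow> nat) \<Rightarrow> (nat \<Rightarrow> nat) \<Rightarrow> nat list \<Rightarrow> bool" for G b A where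
  Skip: "run G b A Skip R M os 0 R M os"
| Assign: "safe G b A R M e \<Longrightarrow> r < 100 \<Longrightarrow>
    run G b A (r ::= e) R M os (esize e + 1) (R(r := ev G R M e)) M os"
| Put: "safe G b A R M x \<Longrightarrow> safe G b A R M y \<Longrightarrow> ev G R M x < A \<Longrightarrow>
    run G b A (Put x y) R M os (esize x + esize y + 1) R (M(ev G R M x := ev G R M y)) os"
| Print: "safe G b A R M e \<Longrightarrow> run G b A (Print e) R M os (esize e + 1) R M (os @ [ev G R M e])"
| Seq: "run G b A c R M os t R' M' os' \<Longrightarrow> run G b A d R' M' os' t' R'' M'' os'' \<Longrightarrow>
    run G b A (c ;; d) R M os (t + t') R'' M'' os''"
| IfT: "bsafe G b A R M e \<Longrightarrow> bev G R M e \<Longrightarrow> run G b A c R M os t R' M' os' \<Longrightarrow>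
    run G b A (If e c d) R M os (bsize e + t) R' M' os'"
| IfF: "bsafe G b A R M e \<Longrightarrow> \<not> bev G R M e \<Longrightarrow> run G b A d R M os t R' M' os' \<Longrightarrow>
    run G b A (If e c d) R M os (bsize e + t + 1) R' M' os'"
| WhileT: "bsafe G b A R M e \<Longrightarrow> bev G R M e \<Longrightarrow> run G b A c R M os t R' M' os' \<Longrightarrow>
    run G b A (While e c) R' M' os' t' R'' M'' os'' \<Longrightarrow>
    run G b A (While e c) R M os (bsize e + t + 1 + t') R'' M'' os''"
| WhileF: "bsafe G b A R M e \<Longrightarrow> \<not> bev G R M e \<Longrightarrow>
    run G b A (While e c) R M os (bsize e + 1) R M os"

text \<open>Registers below 100 are the variables of the language, the others hold intermediate results.\<close>

fun cexpr :: "nat \<Rightarrow> expr \<Rightarrow> program" where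
  "cexpr t (V r) = [Binop And t r r]"
| "cexpr t (K k) = [Const t k]"
| "cexpr t (Op f x y) = cexpr t x @ cexpr (Suc t) y @ [Binop f t t (Suc t)]"
| "cexpr t (Mem x) = cexpr t x @ [Load t t]"
| "cexpr t NV = [ReadN t]"
| "cexpr t (OutDeg x) = cexpr t x @ [ReadOutdeg t t]"
| "cexpr t (InDeg x) = cexpr t x @ [ReadIndeg t t]"
| "cexpr t (OutV x y) = cexpr t x @ cexpr (Suc t) y @ [ReadOut t t (Suc t)]"
| "cexpr t (InV x y) = cexpr t x @ cexpr (Suc t) y @ [ReadIn t t (Suc t)]"
| "cexpr t (MOut x y) = cexpr t x @ cexpr (Suc t) y @ [ReadMateOut t t (Suc t)]"
| "cexpr t (MIn x y) = cexpr t x @ cexpr (Suc t) y @ [ReadMateIn t t (Suc t)]"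

lemma length_cexpr [simp]: "length (cexpr t e) = esize e"
  by (induction e arbitrary: t) auto

fun cbexp :: "bexp \<Rightarrow> nat \<Rightarrow> program" where
  "cbexp (Lt x y) l = cexpr 100 x @ cexpr 101 y @ [JumpLess 100 101 l]"
| "cbexp (Eq x y) l = cexpr 100 x @ cexpr 101 y @ [JumpEq 100 101 l]"

lemma length_cbexp [simp]: "length (cbexp e l) = bsize e"
  by (cases e) auto

fun csize :: "com \<Rightarrow> nat" where
  "csize Skip = 0"
| "csize (r ::= e) = esize e + 1"
| "csize (Put x y) = esize x + esize y + 1"
| "csize (Print e) = esize e + 1"
| "csize (c ;; d) = csize c + csize d"
| "csize (If e c d) = bsize e + csize c + csize d + 1"
| "csize (While e c) = bsize e + csize c + 2"

text \<open>Jumps are absolute, hence the start address \<open>k\<close>. \<open>And\<close> of a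
  register with itself serves as a move instruction. The else branch precedes the then branch
  because a conditional jump is taken when the test succeeds.\<close>

fun ccom :: "nat \<Rightarrow> com \<Rightarrow> program" where
  "ccom k Skip = []"
| "ccom k (r ::= e) = cexpr 100 e @ [Binop And r 100 100]"
| "ccom k (Put x y) = cexpr 100 x @ cexpr 101 y @ [Store 100 101]"
| "ccom k (Print e) = cexpr 100 e @ [Output 100]"
| "ccom k (c ;; d) = ccom k c @ ccom (k + csize c) d"
| "ccom k (If e c d) = cbexp e (k + bsize e + csize d + 1) @ ccom (k + bsize e) d @
     [Jump (k + bsize e + csize d + 1 + csize c)] @ ccom (k + bsize e + csize d + 1) c"
| "ccom k (While e c) = cbexp e (k + bsize e + 1) @ [Jump (k + bsize e + 2 + csize c)] @
     ccom (k + bsize e + 1) c @ [Jump k]"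

lemma length_ccom [simp]: "length (ccom k c) = csize c"
  by (induction c arbitrary: k) auto

definition code_at :: "program \<Rightarrow> nat \<Rightarrow> program \<Rightarrow> bool" where
  "code_at P k xs \<longleftrightarrow> (\<forall>i<length xs. k + i < length P \<and> P ! (k + i) = xs ! i)"

lemma code_at_append [simp]:
  "code_at P k (xs @ ys) \<longleftrightarrow> code_at P k xs \<and> code_at P (k + length xs) ys"
proof
  assume *: "code_at P k (xs @ ys)"
  have "k + length xs + i < length P \<and> P ! (k + length xs + i) = ys ! i" if "i < length ys" for i
    using *[unfolded code_at_def, rule_format, of "length xs + i"] that by (simp add: add.assoc)
  moreover have "k + i < length P \<and> P ! (k + i) = xs ! i" if "i < length xs" for i
    using *[unfolded code_at_def, rule_format, of i] that by (simp add: nth_append)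
  ultimately show "code_at P k xs \<and> code_at P (k + length xs) ys"
    by (simp add: code_at_def)
next
  assume *: "code_at P k xs \<and> code_at P (k + length xs) ys"
  show "code_at P k (xs @ ys)"
    unfolding code_at_def
  proof (intro allI impI)
    fix i assume i: "i < length (xs @ ys)"
    show "k + i < length P \<and> P ! (k + i) = (xs @ ys) ! i"
    proof (cases "i < length xs")
      case True
      then show ?thesis using * by (simp add: code_at_def nth_append)
    next
      case False
      then obtain j where "i = length xs + j" "j < length ys"
        using i by (metis add_less_cancel_left le_Suc_ex length_append not_less)
      then show ?thesis using * by (simp add: code_at_def add.assoc)
    qed
  qed
qed

lemma code_at_single [simp]: "code_at P k [i] \<longleftrightarrow> k < length P \<and> P ! k = i"
  by (simp add: code_at_def)

lemma code_at_Nil [simp]: "code_at P k []"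
  by (simp add: code_at_def)

lemma code_at_self: "code_at P 0 P"
  by (simp add: code_at_def)

section \<open>Arithmetic below a power of two\<close>

lemma xor_less_pow: "x < 2 ^ b \<Longrightarrow> y < 2 ^ b \<Longrightarrow> x XOR y < (2 ^ b :: nat)"
  by (metis take_bit_nat_eq_self take_bit_nat_less_exp take_bit_xor)

lemma or_less_pow: "x < 2 ^ b \<Longrightarrow> y < 2 ^ b \<Longrightarrow> x OR y < (2 ^ b :: nat)"
  by (metis take_bit_nat_eq_self take_bit_nat_less_exp take_bit_or)

lemma and_less_pow: "x < 2 ^ b \<Longrightarrow> y < 2 ^ b \<Longrightarrow> x AND y < (2 ^ b :: nat)"
  by (metis take_bit_nat_eq_self take_bit_nat_less_exp take_bit_and)

lemma opv_less:
  assumes "op_ok b f x y" "x < 2 ^ b" "y < 2 ^ b"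
  shows "opv f x y < 2 ^ b"
  using assms
  by (cases f) (auto intro: xor_less_pow or_less_pow and_less_pow
      order.strict_trans1[OF div_le_dividend] order.strict_trans1[OF mod_less_eq_dividend])

text \<open>The result stays below \<open>2 ^ b\<close> and \<open>b \<le> w\<close>, so truncation
  to \<open>w\<close> bits has no effect. This is what makes the behaviour of a program independent
  of the word length.\<close>

lemma binop_val_eq:
  assumes "op_ok b f x y" "x < 2 ^ b" "y < 2 ^ b" "b \<le> w"
  shows "take_bit w (binop_val w f x y) = opv f x y"
proof -
  have w: "(2::nat) ^ b \<le> 2 ^ w"
    using \<open>b \<le> w\<close> by simp
  have less: "opv f x y < 2 ^ w"
    using opv_less[OF assms(1-3)] w by linarith
  show ?thesis
  proof (cases "f = Sub")
    case True
    then have "y \<le> x" using assms(1) by simp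
    \<comment> \<open>The summand \<open>2 ^ w\<close>, which keeps machine subtraction nonnegative,
      vanishes modulo \<open>2 ^ w\<close>.\<close>
    then have "x + 2 ^ w - y = (x - y) + 2 ^ w" by linarith
    then have "binop_val w f x y = take_bit w (x - y)"
      unfolding True binop_val.simps by (metis add.commute take_bit_eq_mod mod_add_self2)
    then show ?thesis
      using take_bit_nat_eq_self[OF less] unfolding True by (metis opv.simps(2) take_bit_nat_eq_self less True)
  next
    case False
    have "binop_val w f x y = take_bit w (opv f x y) \<or> binop_val w f x y = opv f x y"
      using False by (cases f) (simp_all add: push_bit_eq_mult drop_bit_eq_div)
    then show ?thesis
      using take_bit_nat_eq_self[OF less] by auto
  qed
qed

text \<open>\<open>b\<close> is the number of bits charged per cell, \<open>w\<close> the actual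
  word length. Only \<open>b \<le> w\<close> is assumed about \<open>w\<close>, so the results hold
  for all sufficiently long words at once.\<close>

locale machine =
  fixes G :: input_graph and w b A :: nat
  assumes valid: "valid_input G"
    and size_less: "nverts G + nedges G < 2 ^ b"
    and b_le_w: "b \<le> w"
begin

lemma finite_edges: "finite (edges G)"
  using valid finite_subset unfolding valid_input_def by blast

lemma verts_less: "v \<in> verts G \<Longrightarrow> v < 2 ^ b"
  using size_less by auto

lemma out_arr_props:
  assumes "u \<in> verts G"
  shows "distinct (out_arr G u)" "set (out_arr G u) = {v. (u, v) \<in> edges G}"
    "set (out_arr G u) \<subseteq> verts G" "length (out_arr G u) \<le> nverts G"
proof -
  show *: "distinct (out_arr G u)" "set (out_arr G u) = {v. (u, v) \<in> edges G}"
    using valid assms unfolding valid_input_def by auto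
  then show **: "set (out_arr G u) \<subseteq> verts G"
    using valid unfolding valid_input_def by auto
  show "length (out_arr G u) \<le> nverts G"
    using card_mono[OF _ **] distinct_card[OF *(1)] by simp
qed

lemma in_arr_props:
  assumes "u \<in> verts G"
  shows "distinct (in_arr G u)" "set (in_arr G u) = {v. (v, u) \<in> edges G}"
    "set (in_arr G u) \<subseteq> verts G" "length (in_arr G u) \<le> nverts G"
proof -
  show *: "distinct (in_arr G u)" "set (in_arr G u) = {v. (v, u) \<in> edges G}"
    using valid assms unfolding valid_input_def by auto
  then show **: "set (in_arr G u) \<subseteq> verts G"
    using valid unfolding valid_input_def by auto
  show "length (in_arr G u) \<le> nverts G"
    using card_mono[OF _ **] distinct_card[OF *(1)] by simp
qed

lemma mate_out_props:
  assumes "u \<in> verts G" "i < length (out_arr G u)"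
  shows "mate_out G u i < length (in_arr G (out_arr G u ! i))"
    "in_arr G (out_arr G u ! i) ! mate_out G u i = u"
    "out_arr G u ! i \<in> verts G"
  using valid assms out_arr_props(3)[of u] nth_mem[of i "out_arr G u"]
  unfolding valid_input_def Let_def by blast+

lemma mate_in_props:
  assumes "v \<in> verts G" "j < length (in_arr G v)"
  shows "mate_in G v j < length (out_arr G (in_arr G v ! j))"
    "out_arr G (in_arr G v ! j) ! mate_in G v j = v"
    "in_arr G v ! j \<in> verts G"
  using valid assms in_arr_props(3)[of v] nth_mem[of j "in_arr G v"]
  unfolding valid_input_def Let_def by blast+

text \<open>Values taken from the input are at most \<open>n\<close>: adjacency arrays are distinct
  lists of vertices, which bounds the degrees, and a cross link is a position in such an array.
  Arithmetic is covered by \<open>opv_less\<close>.\<close>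

lemma ev_less:
  assumes "safe G b A R M e" "\<And>r. r < 100 \<Longrightarrow> R r < 2 ^ b" "\<And>a. M a < 2 ^ b"
  shows "ev G R M e < 2 ^ b"
proof -
  have n: "nverts G < 2 ^ b"
    using size_less by simp
  show ?thesis
    using assms(1)
  proof (induction e)
    case (Op f x y)
    then show ?case using opv_less by simp
  next
    case (OutDeg x)
    then have "length (out_arr G (ev G R M x)) \<le> nverts G"
      using out_arr_props(4) by simp
    then show ?case using n by simp
  next
    case (InDeg x)
    then have "length (in_arr G (ev G R M x)) \<le> nverts G"
      using in_arr_props(4) by simp
    then show ?case using n by simp
  next
    case (OutV x y)
    then show ?case using mate_out_props(3) verts_less by simp
  next
    case (InV x y)
    then show ?case using mate_in_props(3) verts_less by simp
  next
    case (MOut x y)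
    then have u: "ev G R M x \<in> verts G" and i: "ev G R M y < length (out_arr G (ev G R M x))"
      by simp_all
    show ?case
      using mate_out_props(1)[OF u i] in_arr_props(4)[OF mate_out_props(3)[OF u i]] n by simp
  next
    case (MIn x y)
    then have u: "ev G R M x \<in> verts G" and i: "ev G R M y < length (in_arr G (ev G R M x))"
      by simp_all
    show ?case
      using mate_in_props(1)[OF u i] out_arr_props(4)[OF mate_in_props(3)[OF u i]] n by simp
  qed (use assms(2,3) n in auto)
qed

section \<open>Correctness of the compiler\<close>

definition bounded :: "config \<Rightarrow> bool" where
  "bounded c \<longleftrightarrow> (\<forall>r. regs c r < 2 ^ b) \<and> (\<forall>a. mem c a < 2 ^ b)"

text \<open>The intermediate configurations are recorded as well, since \<open>runs_in_space\<close>
  speaks about every moment of a run.\<close>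

definition reach :: "program \<Rightarrow> nat \<Rightarrow> config \<Rightarrow> config \<Rightarrow> bool" where
  "reach P k c c' \<longleftrightarrow> (step P w G ^^ k) c = c' \<and> bounded c' \<and>
     (\<forall>i<k. accessed P ((step P w G ^^ i) c) \<subseteq> {..<A} \<and> bounded ((step P w G ^^ i) c))"

lemma reach_0: "bounded c \<Longrightarrow> reach P 0 c c"
  by (simp add: reach_def)

lemma reach_refl: "bounded c \<Longrightarrow> pc c = p \<Longrightarrow> reach P 0 c (c\<lparr>pc := p\<rparr>)"
  by (cases c) (simp add: reach_def)

lemma reach_trans:
  assumes "reach P k c c'" "reach P l c' c''"
  shows "reach P (k + l) c c''"
proof -
  have "(step P w G ^^ (k + l)) c = c''"
    using assms by (simp add: reach_def funpow_add add.commute[of k l])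
  moreover have "accessed P ((step P w G ^^ i) c) \<subseteq> {..<A} \<and> bounded ((step P w G ^^ i) c)"
    if "i < k + l" for i
  proof (cases "i < k")
    case True
    then show ?thesis using assms by (simp add: reach_def)
  next
    case False
    then have "(step P w G ^^ i) c = (step P w G ^^ (i - k)) c'"
      using assms(1) funpow_add[of "i - k" k "step P w G"] by (simp add: reach_def)
    then show ?thesis using assms(2) False that by (simp add: reach_def)
  qed
  ultimately show ?thesis
    using assms(2) by (simp add: reach_def)
qed

lemma reach_step:
  assumes "pc c < length P" "P ! pc c = i" "instr_addresses i c \<subseteq> {..<A}"
    and "bounded c" "bounded c'" "c' = exec w G i c"
  shows "reach P 1 c c'"
  using assms by (simp add: reach_def step_def halted_def accessed_def)

lemma reach_set_reg:
  assumes "pc c < length P" "P ! pc c = i" "instr_addresses i c \<subseteq> {..<A}" "bounded c"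
    and "exec w G i c = set_reg w r x c" "take_bit w x = y" "y < 2 ^ b"
  shows "reach P 1 c (c\<lparr>pc := Suc (pc c), regs := (regs c)(r := y)\<rparr>)"
  by (rule reach_step[OF assms(1-4)]) (use assms in \<open>auto simp: bounded_def set_reg_def\<close>)

text \<open>The common end of all expression cases: once the operands are available, a single
  instruction writes register \<open>t\<close> and leaves the registers below \<open>t\<close>
  alone.\<close>

lemma reach_last:
  assumes "reach P n c (c\<lparr>pc := p, regs := rg\<rparr>)" "\<forall>r<t. rg r = regs c r"
    and "p < length P" "P ! p = i" "instr_addresses i (c\<lparr>pc := p, regs := rg\<rparr>) \<subseteq> {..<A}"
    and "exec w G i (c\<lparr>pc := p, regs := rg\<rparr>) = set_reg w t x (c\<lparr>pc := p, regs := rg\<rparr>)"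
    and "take_bit w x = y" "y < 2 ^ b"
  shows "\<exists>rg. reach P (Suc n) c (c\<lparr>pc := Suc p, regs := rg\<rparr>) \<and> rg t = y \<and> (\<forall>r<t. rg r = regs c r)"
proof -
  have "reach P 1 (c\<lparr>pc := p, regs := rg\<rparr>) (c\<lparr>pc := Suc p, regs := rg(t := y)\<rparr>)"
    by (rule reach_step[where i = i])
      (use assms in \<open>auto simp: set_reg_def bounded_def reach_def\<close>)
  from reach_trans[OF assms(1) this]
  have "reach P (Suc n) c (c\<lparr>pc := Suc p, regs := rg(t := y)\<rparr>)"
    by (simp del: fun_upd_apply)
  then show ?thesis
    using assms(2) by (intro exI[of _ "rg(t := y)"] conjI) auto
qed

lemma take_bit_w: "x < 2 ^ b \<Longrightarrow> take_bit w x = (x::nat)"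
  using b_le_w by (meson order.strict_trans2 power_increasing one_le_numeral take_bit_nat_eq_self)

text \<open>The scratch registers form a stack: the second operand is evaluated from
  \<open>Suc t\<close> upwards, so the value of the first one survives in \<open>t\<close>.
  \<open>IH1\<close> and \<open>IH2\<close> have the shape of the induction hypotheses of
  \<open>cexpr_correct\<close>, which lets all binary constructs share the argument.\<close>

lemma reach_binary:
  assumes IH1: "\<And>t k c. code_at P k (cexpr t x) \<Longrightarrow> pc c = k \<Longrightarrow> bounded c \<Longrightarrow>
      (\<forall>r<100. regs c r = R r) \<Longrightarrow> mem c = M \<Longrightarrow> 100 \<le> t \<Longrightarrow>
      \<exists>rg. reach P (esize x) c (c\<lparr>pc := k + esize x, regs := rg\<rparr>) \<and> rg t = ev G R M x \<and>
        (\<forall>r<t. rg r = regs c r)"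
    and IH2: "\<And>t k c. code_at P k (cexpr t y) \<Longrightarrow> pc c = k \<Longrightarrow> bounded c \<Longrightarrow>
      (\<forall>r<100. regs c r = R r) \<Longrightarrow> mem c = M \<Longrightarrow> 100 \<le> t \<Longrightarrow>
      \<exists>rg. reach P (esize y) c (c\<lparr>pc := k + esize y, regs := rg\<rparr>) \<and> rg t = ev G R M y \<and>
        (\<forall>r<t. rg r = regs c r)"
    and code: "code_at P k (cexpr t x)" "code_at P (k + esize x) (cexpr (Suc t) y)"
    and c: "pc c = k" "bounded c" "\<forall>r<100. regs c r = R r" "mem c = M" "100 \<le> t"
  shows "\<exists>rg. reach P (esize x + esize y) c (c\<lparr>pc := k + esize x + esize y, regs := rg\<rparr>) \<and>
    rg t = ev G R M x \<and> rg (Suc t) = ev G R M y \<and> (\<forall>r<t. rg r = regs c r)"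
proof -
  obtain rg where rg: "reach P (esize x) c (c\<lparr>pc := k + esize x, regs := rg\<rparr>)"
    "rg t = ev G R M x" "\<forall>r<t. rg r = regs c r"
    using IH1[OF code(1) c] by blast
  let ?c = "c\<lparr>pc := k + esize x, regs := rg\<rparr>"
  have "bounded ?c"
    using rg(1) by (simp add: reach_def)
  then obtain rg' where rg': "reach P (esize y) ?c (?c\<lparr>pc := k + esize x + esize y, regs := rg'\<rparr>)"
    "rg' (Suc t) = ev G R M y" "\<forall>r<Suc t. rg' r = rg r"
    using IH2[OF code(2), of ?c] c rg by auto
  show ?thesis
    using reach_trans[OF rg(1) rg'(1)] rg rg' by (intro exI[of _ rg']) simp
qed

lemma ev_less_config:
  assumes "safe G b A R M e" "bounded c" "\<forall>r<100. regs c r = R r" "mem c = M"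
  shows "ev G R M e < 2 ^ b"
proof (rule ev_less[OF assms(1)])
  show "R r < 2 ^ b" if "r < 100" for r
    using assms(2,3) that unfolding bounded_def by metis
  show "M a < 2 ^ b" for a
    using assms(2,4) unfolding bounded_def by blast
qed

lemma cexpr_correct:
  assumes "safe G b A R M e" "code_at P k (cexpr t e)" "pc c = k" "bounded c"
    and "\<forall>r<100. regs c r = R r" "mem c = M" "100 \<le> t"
  shows "\<exists>rg. reach P (esize e) c (c\<lparr>pc := k + esize e, regs := rg\<rparr>) \<and> rg t = ev G R M e \<and>
    (\<forall>r<t. rg r = regs c r)"
  using assms
proof (induction e arbitrary: t k c)
  case (V r)
  have "regs c r < 2 ^ b" using \<open>bounded c\<close> unfolding bounded_def by blast
  then have "\<exists>rg. reach P (Suc 0) c (c\<lparr>pc := Suc (pc c), regs := rg\<rparr>) \<and> rg t = regs c r \<and>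
      (\<forall>r<t. rg r = regs c r)"
    using V by (intro reach_last[where rg = "regs c" and i = "Binop And t r r" and x = "regs c r"])
      (simp_all add: take_bit_w reach_refl)
  then show ?case using V by auto
next
  case (K k')
  have "\<exists>rg. reach P (Suc 0) c (c\<lparr>pc := Suc (pc c), regs := rg\<rparr>) \<and> rg t = k' \<and>
      (\<forall>r<t. rg r = regs c r)"
    using K by (intro reach_last[where rg = "regs c" and i = "Const t k'" and x = k'])
      (simp_all add: take_bit_w reach_refl)
  then show ?case using K by auto
next
  case NV
  have "\<exists>rg. reach P (Suc 0) c (c\<lparr>pc := Suc (pc c), regs := rg\<rparr>) \<and> rg t = nverts G \<and>
      (\<forall>r<t. rg r = regs c r)"
    using NV size_less by (intro reach_last[where rg = "regs c" and i = "ReadN t" and x = "nverts G"])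
      (simp_all add: take_bit_w reach_refl)
  then show ?case using NV by auto
next
  case (Op f x y)
  have "\<exists>rg. reach P (esize x + esize y) c (c\<lparr>pc := k + esize x + esize y, regs := rg\<rparr>) \<and>
      rg t = ev G R M x \<and> rg (Suc t) = ev G R M y \<and> (\<forall>r<t. rg r = regs c r)"
    by (rule reach_binary[OF Op.IH]) (use Op.prems in auto)
  then obtain rg where rg: "reach P (esize x + esize y) c (c\<lparr>pc := k + esize x + esize y, regs := rg\<rparr>)"
      "rg t = ev G R M x" "rg (Suc t) = ev G R M y" "\<forall>r<t. rg r = regs c r"
    by blast
  have "\<exists>rg. reach P (Suc (esize x + esize y)) c (c\<lparr>pc := Suc (k + esize x + esize y), regs := rg\<rparr>) \<and>
      rg t = ev G R M (Op f x y) \<and> (\<forall>r<t. rg r = regs c r)"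
    by (rule reach_last[OF rg(1,4), where i = "Binop f t t (Suc t)" and x = "binop_val w f (ev G R M x) (ev G R M y)"])
      (use Op.prems rg(2,3) ev_less_config[OF Op.prems(1,4,5,6)] binop_val_eq[OF _ ev_less_config[OF _ Op.prems(4,5,6)] ev_less_config[OF _ Op.prems(4,5,6)] b_le_w]
        in \<open>simp_all add: take_bit_w add.assoc\<close>)
  then show ?case by (simp add: add.assoc)
next
  case (Mem x)
  obtain rg where rg: "reach P (esize x) c (c\<lparr>pc := k + esize x, regs := rg\<rparr>)"
      "rg t = ev G R M x" "\<forall>r<t. rg r = regs c r"
    using Mem.IH[of k t c] Mem.prems by auto
  have "\<exists>rg. reach P (Suc (esize x)) c (c\<lparr>pc := Suc (k + esize x), regs := rg\<rparr>) \<and>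
      rg t = ev G R M (Mem x) \<and> (\<forall>r<t. rg r = regs c r)"
    by (rule reach_last[OF rg(1,3), where i = "Load t t" and x = "ev G R M (Mem x)"])
      (use Mem.prems rg(2) ev_less_config[OF Mem.prems(1,4,5,6)] in \<open>simp_all add: take_bit_w\<close>)
  then show ?case by simp
next
  case (OutDeg x)
  obtain rg where rg: "reach P (esize x) c (c\<lparr>pc := k + esize x, regs := rg\<rparr>)"
      "rg t = ev G R M x" "\<forall>r<t. rg r = regs c r"
    using OutDeg.IH[of k t c] OutDeg.prems by auto
  have "\<exists>rg. reach P (Suc (esize x)) c (c\<lparr>pc := Suc (k + esize x), regs := rg\<rparr>) \<and>
      rg t = ev G R M (OutDeg x) \<and> (\<forall>r<t. rg r = regs c r)"
    by (rule reach_last[OF rg(1,3), where i = "ReadOutdeg t t" and x = "ev G R M (OutDeg x)"])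
      (use OutDeg.prems rg(2) ev_less_config[OF OutDeg.prems(1,4,5,6)] in \<open>simp_all add: take_bit_w\<close>)
  then show ?case by simp
next
  case (InDeg x)
  obtain rg where rg: "reach P (esize x) c (c\<lparr>pc := k + esize x, regs := rg\<rparr>)"
      "rg t = ev G R M x" "\<forall>r<t. rg r = regs c r"
    using InDeg.IH[of k t c] InDeg.prems by auto
  have "\<exists>rg. reach P (Suc (esize x)) c (c\<lparr>pc := Suc (k + esize x), regs := rg\<rparr>) \<and>
      rg t = ev G R M (InDeg x) \<and> (\<forall>r<t. rg r = regs c r)"
    by (rule reach_last[OF rg(1,3), where i = "ReadIndeg t t" and x = "ev G R M (InDeg x)"])
      (use InDeg.prems rg(2) ev_less_config[OF InDeg.prems(1,4,5,6)] in \<open>simp_all add: take_bit_w\<close>)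
  then show ?case by simp
next
  case (OutV x y)
  have "\<exists>rg. reach P (esize x + esize y) c (c\<lparr>pc := k + esize x + esize y, regs := rg\<rparr>) \<and>
      rg t = ev G R M x \<and> rg (Suc t) = ev G R M y \<and> (\<forall>r<t. rg r = regs c r)"
    by (rule reach_binary[OF OutV.IH]) (use OutV.prems in auto)
  then obtain rg where rg: "reach P (esize x + esize y) c (c\<lparr>pc := k + esize x + esize y, regs := rg\<rparr>)"
      "rg t = ev G R M x" "rg (Suc t) = ev G R M y" "\<forall>r<t. rg r = regs c r"
    by blast
  have "\<exists>rg. reach P (Suc (esize x + esize y)) c (c\<lparr>pc := Suc (k + esize x + esize y), regs := rg\<rparr>) \<and>
      rg t = ev G R M (OutV x y) \<and> (\<forall>r<t. rg r = regs c r)"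
    by (rule reach_last[OF rg(1,4), where i = "ReadOut t t (Suc t)" and x = "ev G R M (OutV x y)"])
      (use OutV.prems rg(2,3) ev_less_config[OF OutV.prems(1,4,5,6)]
        in \<open>simp_all add: take_bit_w add.assoc\<close>)
  then show ?case by (simp add: add.assoc)
next
  case (InV x y)
  have "\<exists>rg. reach P (esize x + esize y) c (c\<lparr>pc := k + esize x + esize y, regs := rg\<rparr>) \<and>
      rg t = ev G R M x \<and> rg (Suc t) = ev G R M y \<and> (\<forall>r<t. rg r = regs c r)"
    by (rule reach_binary[OF InV.IH]) (use InV.prems in auto)
  then obtain rg where rg: "reach P (esize x + esize y) c (c\<lparr>pc := k + esize x + esize y, regs := rg\<rparr>)"
      "rg t = ev G R M x" "rg (Suc t) = ev G R M y" "\<forall>r<t. rg r = regs c r"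
    by blast
  have "\<exists>rg. reach P (Suc (esize x + esize y)) c (c\<lparr>pc := Suc (k + esize x + esize y), regs := rg\<rparr>) \<and>
      rg t = ev G R M (InV x y) \<and> (\<forall>r<t. rg r = regs c r)"
    by (rule reach_last[OF rg(1,4), where i = "ReadIn t t (Suc t)" and x = "ev G R M (InV x y)"])
      (use InV.prems rg(2,3) ev_less_config[OF InV.prems(1,4,5,6)]
        in \<open>simp_all add: take_bit_w add.assoc\<close>)
  then show ?case by (simp add: add.assoc)
next
  case (MOut x y)
  have "\<exists>rg. reach P (esize x + esize y) c (c\<lparr>pc := k + esize x + esize y, regs := rg\<rparr>) \<and>
      rg t = ev G R M x \<and> rg (Suc t) = ev G R M y \<and> (\<forall>r<t. rg r = regs c r)"
    by (rule reach_binary[OF MOut.IH]) (use MOut.prems in auto)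
  then obtain rg where rg: "reach P (esize x + esize y) c (c\<lparr>pc := k + esize x + esize y, regs := rg\<rparr>)"
      "rg t = ev G R M x" "rg (Suc t) = ev G R M y" "\<forall>r<t. rg r = regs c r"
    by blast
  have "\<exists>rg. reach P (Suc (esize x + esize y)) c (c\<lparr>pc := Suc (k + esize x + esize y), regs := rg\<rparr>) \<and>
      rg t = ev G R M (MOut x y) \<and> (\<forall>r<t. rg r = regs c r)"
    by (rule reach_last[OF rg(1,4), where i = "ReadMateOut t t (Suc t)" and x = "ev G R M (MOut x y)"])
      (use MOut.prems rg(2,3) ev_less_config[OF MOut.prems(1,4,5,6)]
        in \<open>simp_all add: take_bit_w add.assoc\<close>)
  then show ?case by (simp add: add.assoc)
next
  case (MIn x y)
  have "\<exists>rg. reach P (esize x + esize y) c (c\<lparr>pc := k + esize x + esize y, regs := rg\<rparr>) \<and>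
      rg t = ev G R M x \<and> rg (Suc t) = ev G R M y \<and> (\<forall>r<t. rg r = regs c r)"
    by (rule reach_binary[OF MIn.IH]) (use MIn.prems in auto)
  then obtain rg where rg: "reach P (esize x + esize y) c (c\<lparr>pc := k + esize x + esize y, regs := rg\<rparr>)"
      "rg t = ev G R M x" "rg (Suc t) = ev G R M y" "\<forall>r<t. rg r = regs c r"
    by blast
  have "\<exists>rg. reach P (Suc (esize x + esize y)) c (c\<lparr>pc := Suc (k + esize x + esize y), regs := rg\<rparr>) \<and>
      rg t = ev G R M (MIn x y) \<and> (\<forall>r<t. rg r = regs c r)"
    by (rule reach_last[OF rg(1,4), where i = "ReadMateIn t t (Suc t)" and x = "ev G R M (MIn x y)"])
      (use MIn.prems rg(2,3) ev_less_config[OF MIn.prems(1,4,5,6)]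
        in \<open>simp_all add: take_bit_w add.assoc\<close>)
  then show ?case by (simp add: add.assoc)
qed

lemma cexpr2_correct:
  assumes "safe G b A R M x" "safe G b A R M y"
    and "code_at P k (cexpr 100 x)" "code_at P (k + esize x) (cexpr 101 y)" "pc c = k" "bounded c"
    and "\<forall>r<100. regs c r = R r" "mem c = M"
  shows "\<exists>rg. reach P (esize x + esize y) c (c\<lparr>pc := k + esize x + esize y, regs := rg\<rparr>) \<and>
    rg 100 = ev G R M x \<and> rg 101 = ev G R M y \<and> (\<forall>r<100. rg r = regs c r)"
proof -
  have code: "code_at P (k + esize x) (cexpr (Suc 100) y)"
    using assms(4) by (simp only: Suc_numeral semiring_norm)
  have "\<exists>rg. reach P (esize x + esize y) c (c\<lparr>pc := k + esize x + esize y, regs := rg\<rparr>) \<and>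
    rg 100 = ev G R M x \<and> rg (Suc 100) = ev G R M y \<and> (\<forall>r<100. rg r = regs c r)"
    by (rule reach_binary[OF cexpr_correct[OF assms(1)] cexpr_correct[OF assms(2)] assms(3) code
          assms(5-8) order.refl])
  then show ?thesis
    by (simp only: Suc_numeral semiring_norm)
qed

end

lemma code_at_Cons [simp]:
  "code_at P k (x # xs) \<longleftrightarrow> k < length P \<and> P ! k = x \<and> code_at P (Suc k) xs"
  using code_at_append[of P k "[x]" xs] by simp

context machine begin

lemma cbexp_correct:
  assumes "bsafe G b A R M e" "code_at P k (cbexp e l)" "pc c = k" "bounded c"
    and "\<forall>r<100. regs c r = R r" "mem c = M"
  shows "\<exists>rg. reach P (bsize e) c (c\<lparr>pc := (if bev G R M e then l else k + bsize e), regs := rg\<rparr>) \<and>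
    (\<forall>r<100. rg r = R r)"
proof -
  have *: "\<exists>rg. reach P (esize x + esize y + 1) c
          (c\<lparr>pc := (if bev G R M e then l else k + (esize x + esize y + 1)), regs := rg\<rparr>) \<and>
        (\<forall>r<100. rg r = R r)"
    if xy: "safe G b A R M x" "safe G b A R M y" "code_at P k (cexpr 100 x)"
      "code_at P (k + esize x) (cexpr 101 y)" "k + esize x + esize y < length P"
      and j: "P ! (k + esize x + esize y) = j" "instr_addresses j = (\<lambda>_. {})"
      "\<And>c. regs c 100 = ev G R M x \<Longrightarrow> regs c 101 = ev G R M y \<Longrightarrow>
         exec w G j c = c\<lparr>pc := (if bev G R M e then l else Suc (pc c))\<rparr>"
    for x y j
  proof -
    obtain rg where rg: "reach P (esize x + esize y) c (c\<lparr>pc := k + esize x + esize y, regs := rg\<rparr>)"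
      "rg 100 = ev G R M x" "rg 101 = ev G R M y" "\<forall>r<100. rg r = regs c r"
      using cexpr2_correct[OF xy(1-4) assms(3-6)] by blast
    have "bounded (c\<lparr>pc := k + esize x + esize y, regs := rg\<rparr>)"
      using rg(1) by (simp add: reach_def)
    then have "reach P 1 (c\<lparr>pc := k + esize x + esize y, regs := rg\<rparr>)
       (c\<lparr>pc := (if bev G R M e then l else k + (esize x + esize y + 1)), regs := rg\<rparr>)"
      using xy j rg(2,3) by (intro reach_step[where i = j]) (auto simp: bounded_def)
    from reach_trans[OF rg(1) this] show ?thesis
      using rg(4) assms(5) by auto
  qed
  then show ?thesis
    
  proof (cases e)
    case (Lt x y)
    then show ?thesis
      using *[of x y "JumpLess 100 101 l"] assms(1,2) unfolding Lt bsize.simps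
      by (simp add: add.assoc fun_eq_iff split del: if_split)
  next
    case (Eq x y)
    then show ?thesis
      using *[of x y "JumpEq 100 101 l"] assms(1,2) unfolding Eq bsize.simps
      by (simp add: add.assoc fun_eq_iff split del: if_split)
  qed
qed

lemma ccom_correct:
  assumes "run G b A c R M os t R' M' os'" "code_at P k (ccom k c)" "pc s = k" "bounded s"
    and "\<forall>r<100. regs s r = R r" "mem s = M" "printed s = os"
  shows "\<exists>s'. reach P t s s' \<and> pc s' = k + csize c \<and> (\<forall>r<100. regs s' r = R' r) \<and>
    mem s' = M' \<and> printed s' = os'"
  using assms
proof (induction arbitrary: k s rule: run.induct)
  case (Skip R M os)
  then show ?case using reach_0 by auto
next
  case (Assign R M e r os)
  obtain rg where rg: "reach P (esize e) s (s\<lparr>pc := k + esize e, regs := rg\<rparr>)"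
      "rg 100 = ev G R M e" "\<forall>r<100. rg r = regs s r"
    using cexpr_correct[OF Assign(1), of P k 100 s] Assign by auto
  have bd: "bounded (s\<lparr>pc := k + esize e, regs := rg\<rparr>)"
    using rg(1) by (simp add: reach_def)
  then have "ev G R M e < 2 ^ b"
    using rg(2) by (metis bounded_def config.select_convs(2) config.surjective config.update_convs(1,2))
  then have "reach P (esize e + 1) s (s\<lparr>pc := Suc (k + esize e), regs := rg(r := ev G R M e)\<rparr>)"
    using reach_trans[OF rg(1) reach_set_reg[where i = "Binop And r 100 100" and r = r and
          x = "ev G R M e"]] bd rg Assign.prems
    by (simp add: take_bit_w)
  then show ?case
    using rg(3) Assign.prems
    by (intro exI[of _ "s\<lparr>pc := Suc (k + esize e), regs := rg(r := ev G R M e)\<rparr>"] conjI) auto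
next
  case (Put R M x y os)
  obtain rg where rg: "reach P (esize x + esize y) s (s\<lparr>pc := k + esize x + esize y, regs := rg\<rparr>)"
      "rg 100 = ev G R M x" "rg 101 = ev G R M y" "\<forall>r<100. rg r = regs s r"
    using cexpr2_correct[OF Put(1,2), of P k s] Put by auto
  let ?s = "s\<lparr>pc := k + esize x + esize y, regs := rg\<rparr>"
  let ?s' = "s\<lparr>pc := k + esize x + esize y + 1, regs := rg, mem := M(ev G R M x := ev G R M y)\<rparr>"
  have bd: "bounded ?s"
    using rg(1) by (simp add: reach_def)
  then have "ev G R M y < 2 ^ b"
    using rg(3) by (metis bounded_def config.select_convs(2) config.surjective config.update_convs(1,2))
  then have "reach P 1 ?s ?s'"
    using Put bd rg by (intro reach_step[where i = "Store 100 101"]) (auto simp: bounded_def add.assoc)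
  from reach_trans[OF rg(1) this] show ?case
    using rg(4) Put by (intro exI[of _ ?s']) auto
next
  case (Print R M e os)
  obtain rg where rg: "reach P (esize e) s (s\<lparr>pc := k + esize e, regs := rg\<rparr>)"
      "rg 100 = ev G R M e" "\<forall>r<100. rg r = regs s r"
    using cexpr_correct[OF Print(1), of P k 100 s] Print by auto
  let ?s = "s\<lparr>pc := k + esize e, regs := rg\<rparr>"
  let ?s' = "s\<lparr>pc := k + esize e + 1, regs := rg, printed := os @ [ev G R M e]\<rparr>"
  have "bounded ?s"
    using rg(1) by (simp add: reach_def)
  then have "reach P 1 ?s ?s'"
    using Print rg by (intro reach_step[where i = "Output 100"]) (auto simp: bounded_def)
  from reach_trans[OF rg(1) this] show ?case
    using rg(3) Print by (intro exI[of _ ?s']) auto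
next
  case (Seq c R M os t R' M' os' d t' R'' M'' os'')
  obtain s' where s': "reach P t s s'" "pc s' = k + csize c" "\<forall>r<100. regs s' r = R' r"
    "mem s' = M'" "printed s' = os'"
    using Seq.IH(1)[of k s] Seq.prems by auto
  have "bounded s'" using s'(1) by (simp add: reach_def)
  then obtain s'' where s'': "reach P t' s' s''" "pc s'' = k + csize c + csize d"
    "\<forall>r<100. regs s'' r = R'' r" "mem s'' = M''" "printed s'' = os''"
    using Seq.IH(2)[of "k + csize c" s'] Seq.prems s' by auto
  from reach_trans[OF s'(1) s''(1)] show ?case
    using s'' by (intro exI[of _ s'']) (auto simp: add.assoc)
next
  case (IfT R M e c os t R' M' os' d)
  let ?l = "k + bsize e + csize d + 1"
  obtain rg where rg: "reach P (bsize e) s (s\<lparr>pc := ?l, regs := rg\<rparr>)" "\<forall>r<100. rg r = R r"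
    using cbexp_correct[OF IfT(1), of P k ?l s] IfT by auto
  have "bounded (s\<lparr>pc := ?l, regs := rg\<rparr>)" using rg(1) by (simp add: reach_def)
  then obtain s' where s': "reach P t (s\<lparr>pc := ?l, regs := rg\<rparr>) s'" "pc s' = ?l + csize c"
    "\<forall>r<100. regs s' r = R' r" "mem s' = M'" "printed s' = os'"
    using IfT.IH[of ?l "s\<lparr>pc := ?l, regs := rg\<rparr>"] IfT.prems rg(2) by (auto simp: add.assoc)
  from reach_trans[OF rg(1) s'(1)] show ?case
    using s' by (intro exI[of _ s']) (auto simp: algebra_simps)
next
  case (IfF R M e d os t R' M' os' c)
  let ?l = "k + bsize e" and ?end = "k + bsize e + csize d + 1 + csize c"
  obtain rg where rg: "reach P (bsize e) s (s\<lparr>pc := ?l, regs := rg\<rparr>)" "\<forall>r<100. rg r = R r"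
    using cbexp_correct[OF IfF(1), of P k "k + bsize e + csize d + 1" s] IfF by auto
  have "bounded (s\<lparr>pc := ?l, regs := rg\<rparr>)" using rg(1) by (simp add: reach_def)
  then obtain s' where s': "reach P t (s\<lparr>pc := ?l, regs := rg\<rparr>) s'" "pc s' = ?l + csize d"
    "\<forall>r<100. regs s' r = R' r" "mem s' = M'" "printed s' = os'"
    using IfF.IH[of ?l "s\<lparr>pc := ?l, regs := rg\<rparr>"] IfF.prems rg(2) by (auto simp: add.assoc)
  have "bounded s'" using s'(1) by (simp add: reach_def)
  then have "reach P 1 s' (s'\<lparr>pc := ?end\<rparr>)"
    using IfF.prems s'(2) by (intro reach_step[where i = "Jump ?end"]) (auto simp: bounded_def add.assoc)
  from reach_trans[OF rg(1) reach_trans[OF s'(1) this]] show ?case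
    using s' by (intro exI[of _ "s'\<lparr>pc := ?end\<rparr>"]) (auto simp: algebra_simps)
next
  case (WhileT R M e c os t R' M' os' t' R'' M'' os'')
  let ?l = "k + bsize e + 1"
  obtain rg where rg: "reach P (bsize e) s (s\<lparr>pc := ?l, regs := rg\<rparr>)" "\<forall>r<100. rg r = R r"
    using cbexp_correct[OF WhileT(1), of P k ?l s] WhileT by auto
  have "bounded (s\<lparr>pc := ?l, regs := rg\<rparr>)" using rg(1) by (simp add: reach_def)
  then obtain s' where s': "reach P t (s\<lparr>pc := ?l, regs := rg\<rparr>) s'" "pc s' = ?l + csize c"
    "\<forall>r<100. regs s' r = R' r" "mem s' = M'" "printed s' = os'"
    using WhileT.IH(1)[of ?l "s\<lparr>pc := ?l, regs := rg\<rparr>"] WhileT.prems rg(2) by (auto simp: add.assoc)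
  have "bounded s'" using s'(1) by (simp add: reach_def)
  then have j: "reach P 1 s' (s'\<lparr>pc := k\<rparr>)"
    using WhileT.prems s'(2) by (intro reach_step[where i = "Jump k"]) (auto simp: bounded_def add.assoc)
  then have "bounded (s'\<lparr>pc := k\<rparr>)" by (simp add: reach_def)
  then obtain s'' where s'': "reach P t' (s'\<lparr>pc := k\<rparr>) s''" "pc s'' = k + csize (While e c)"
    "\<forall>r<100. regs s'' r = R'' r" "mem s'' = M''" "printed s'' = os''"
    using WhileT.IH(2)[of k "s'\<lparr>pc := k\<rparr>"] WhileT.prems s' by auto
  from reach_trans[OF rg(1) reach_trans[OF s'(1) reach_trans[OF j s''(1)]]] show ?case
    using s'' by (intro exI[of _ s'']) (auto simp: algebra_simps)
next
  case (WhileF R M e c os)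
  let ?end = "k + bsize e + 2 + csize c"
  obtain rg where rg: "reach P (bsize e) s (s\<lparr>pc := k + bsize e, regs := rg\<rparr>)" "\<forall>r<100. rg r = R r"
    using cbexp_correct[OF WhileF(1), of P k "k + bsize e + 1" s] WhileF by auto
  have "bounded (s\<lparr>pc := k + bsize e, regs := rg\<rparr>)" using rg(1) by (simp add: reach_def)
  then have "reach P 1 (s\<lparr>pc := k + bsize e, regs := rg\<rparr>) (s\<lparr>pc := ?end, regs := rg\<rparr>)"
    using WhileF.prems by (intro reach_step[where i = "Jump ?end"]) (auto simp: bounded_def)
  from reach_trans[OF rg(1) this] show ?case
    using rg WhileF.prems by (intro exI[of _ "s\<lparr>pc := ?end, regs := rg\<rparr>"]) auto
qed

theorem run_program:
  assumes "run G b A c (\<lambda>_. 0) (\<lambda>_. 0) [] t R M os"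
  shows "real t \<le> T \<Longrightarrow> spec os \<Longrightarrow> computes_in_time (ccom 0 c) w G spec T"
    and "real ((num_regs (ccom 0 c) + A) * b) \<le> S \<Longrightarrow> runs_in_space (ccom 0 c) w G S"
proof -
  let ?P = "ccom 0 c"
  have "\<exists>s. reach ?P t init_config s \<and> pc s = 0 + csize c \<and> (\<forall>r<100. regs s r = R r) \<and>
    mem s = M \<and> printed s = os"
    by (rule ccom_correct[OF assms]) (simp_all add: code_at_self init_config_def bounded_def)
  then obtain s where s: "reach ?P t init_config s" "pc s = csize c" "printed s = os"
    by auto
  then have halt: "halted ?P s"
    by (simp add: halted_def)
  have at: "config_at ?P w G t = s"
    using s(1) by (simp add: reach_def config_at_def)
  show "computes_in_time ?P w G spec T" if "real t \<le> T" "spec os"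
    unfolding computes_in_time_def using that at halt s(3) by blast
  show "runs_in_space ?P w G S" if S: "real ((num_regs ?P + A) * b) \<le> S"
  proof -
    \<comment> \<open>The space bound is required at all times, also after halting, where the
      configuration is a fixed point of \<open>step\<close>.\<close>
    have stay: "(step ?P w G ^^ i) s = s" for i
      by (induction i) (use halt in \<open>auto simp: step_def\<close>)
    have "accessed ?P (config_at ?P w G i) \<subseteq> {..<A} \<and> bounded (config_at ?P w G i)" for i
    proof (cases "i < t")
      case True
      then show ?thesis using s(1) by (simp add: reach_def config_at_def)
    next
      case False
      then have "config_at ?P w G i = (step ?P w G ^^ (i - t)) (config_at ?P w G t)"
        using funpow_add[of "i - t" t "step ?P w G"] by (simp add: config_at_def)
      then have "config_at ?P w G i = s"
        using at stay by simp
      then show ?thesis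
        using s(1) halt by (simp add: reach_def accessed_def)
    qed
    then show ?thesis
      unfolding runs_in_space_def Let_def bounded_def using S by blast
  qed
qed

end

section \<open>Program verification\<close>

context machine begin

text \<open>Total correctness, with the step count passed to the postcondition. The equations for
  the loop-free constructs let the simplifier execute straight-line code symbolically.\<close>

definition wp :: "com \<Rightarrow> (nat \<Rightarrow> (nat \<Rightarrow> nat) \<Rightarrow> (nat \<Rightarrow> nat) \<Rightarrow> nat list \<Rightarrow> bool) \<Rightarrow>
    (nat \<Rightarrow> nat) \<Rightarrow> (nat \<Rightarrow> nat) \<Rightarrow> nat list \<Rightarrow> bool" where
  "wp c Q R M os \<longleftrightarrow> (\<exists>t R' M' os'. run G b A c R M os t R' M' os' \<and> Q t R' M' os')"

lemma wp_Skip [simp]: "wp Skip Q R M os \<longleftrightarrow> Q 0 R M os"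
  by (simp add: wp_def run.simps[of _ _ _ "Skip"])

lemma wp_Assign [simp]:
  "wp (r ::= e) Q R M os \<longleftrightarrow> safe G b A R M e \<and> r < 100 \<and> Q (esize e + 1) (R(r := ev G R M e)) M os"
  by (simp add: wp_def run.simps[of _ _ _ "r ::= e"])

lemma wp_Put [simp]:
  "wp (Put x y) Q R M os \<longleftrightarrow> safe G b A R M x \<and> safe G b A R M y \<and> ev G R M x < A \<and>
     Q (esize x + esize y + 1) R (M(ev G R M x := ev G R M y)) os"
  by (simp add: wp_def run.simps[of _ _ _ "Put x y"])

lemma wp_Print [simp]:
  "wp (Print e) Q R M os \<longleftrightarrow> safe G b A R M e \<and> Q (esize e + 1) R M (os @ [ev G R M e])"
  by (simp add: wp_def run.simps[of _ _ _ "Print e"])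

lemma wp_Seq [simp]: "wp (c ;; d) Q R M os \<longleftrightarrow> wp c (\<lambda>t. wp d (\<lambda>t'. Q (t + t'))) R M os"
  unfolding wp_def run.simps[of _ _ _ "c ;; d"] by simp blast

lemma wp_If [simp]:
  "wp (If e c d) Q R M os \<longleftrightarrow> bsafe G b A R M e \<and>
     (if bev G R M e then wp c (\<lambda>t. Q (bsize e + t)) R M os
      else wp d (\<lambda>t. Q (bsize e + t + 1)) R M os)"
  unfolding wp_def run.simps[of _ _ _ "If e c d"] by (simp, blast)

lemma wp_mono:
  assumes "wp c Q R M os" "\<And>t R M os. Q t R M os \<Longrightarrow> Q' t R M os"
  shows "wp c Q' R M os"
  using assms unfolding wp_def by blast

text \<open>The first argument of the invariant is a potential that pays for the running time.\<close>

lemma wp_While: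
  assumes "I \<phi> R M os"
    and "\<And>\<phi> R M os. I \<phi> R M os \<Longrightarrow> bsafe G b A R M e"
    and "\<And>\<phi> R M os. I \<phi> R M os \<Longrightarrow> bev G R M e \<Longrightarrow>
      wp c (\<lambda>t R' M' os'. \<exists>\<phi>'. I \<phi>' R' M' os' \<and> t + bsize e + 1 + \<phi>' \<le> \<phi>) R M os"
  shows "wp (While e c) (\<lambda>t R' M' os'. \<exists>\<phi>'. I \<phi>' R' M' os' \<and> \<not> bev G R' M' e \<and>
      t + \<phi>' \<le> \<phi> + bsize e + 1) R M os"
  using assms(1)
proof (induction \<phi> arbitrary: R M os rule: less_induct)
  case (less \<phi>)
  show ?case
  proof (cases "bev G R M e")
    case True
    obtain t R' M' os' \<phi>' where 1: "run G b A c R M os t R' M' os'" "I \<phi>' R' M' os'"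
      "t + bsize e + 1 + \<phi>' \<le> \<phi>"
      using assms(3)[OF less.prems True] unfolding wp_def by blast
    moreover from 1 obtain t' R'' M'' os'' \<phi>'' where
      "run G b A (While e c) R' M' os' t' R'' M'' os''" "I \<phi>'' R'' M'' os''" "\<not> bev G R'' M'' e"
      "t' + \<phi>'' \<le> \<phi>' + bsize e + 1"
      using less.IH[of \<phi>' R' M' os'] unfolding wp_def by auto
    ultimately show ?thesis
      unfolding wp_def using run.WhileT[OF assms(2)[OF less.prems] True 1(1)]
      by (intro exI[of _ "bsize e + t + 1 + t'"] exI conjI) auto
  next
    case False
    then show ?thesis
      unfolding wp_def using run.WhileF[OF assms(2)[OF less.prems] False] less.prems
      by (intro exI[of _ "bsize e + 1"] exI conjI) auto
  qed
qed

section \<open>Degrees and adjacency in the input graph\<close>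

lemma nverts_less: "nverts G < 2 ^ b"
  using size_less by linarith

lemma nverts_pos: "1 \<le> nverts G"
  using valid unfolding valid_input_def by blast

lemma one_less: "1 < (2::nat) ^ b"
  using size_less nverts_pos by linarith

abbreviation idg :: "nat \<Rightarrow> nat" where "idg v \<equiv> length (in_arr G v)"
abbreviation odg :: "nat \<Rightarrow> nat" where "odg u \<equiv> length (out_arr G u)"

lemma in_arr_edges: "v \<in> verts G \<Longrightarrow> u \<in> set (in_arr G v) \<longleftrightarrow> (u, v) \<in> edges G"
  using in_arr_props(2) by auto

lemma out_arr_edges: "u \<in> verts G \<Longrightarrow> v \<in> set (out_arr G u) \<longleftrightarrow> (u, v) \<in> edges G"
  using out_arr_props(2) by auto

lemma edge_verts: "(u, v) \<in> edges G \<Longrightarrow> u \<in> verts G \<and> v \<in> verts G"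
  using valid unfolding valid_input_def by blast

lemma idg_pos: "(u, v) \<in> edges G \<Longrightarrow> 0 < idg v"
  using in_arr_edges edge_verts by (metis length_pos_if_in_set)

lemma idg_indegree: "v \<in> verts G \<Longrightarrow> idg v = indegree G v"
  using in_arr_props(1,2) distinct_card unfolding indegree_def by metis

lemma sum_idg: "(\<Sum>v\<in>verts G. idg v) = nedges G"
proof -
  have "edges G = (\<Union>v\<in>verts G. set (in_arr G v) \<times> {v})"
  proof (intro set_eqI)
    show "e \<in> edges G \<longleftrightarrow> e \<in> (\<Union>v\<in>verts G. set (in_arr G v) \<times> {v})" for e
      using in_arr_edges edge_verts by (cases e) blast
  qed
  also have "card \<dots> = (\<Sum>v\<in>verts G. card (set (in_arr G v) \<times> {v}))"
    by (intro card_UN_disjoint) auto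
  also have "\<dots> = (\<Sum>v\<in>verts G. idg v)"
    by (intro sum.cong refl)
      (simp add: card_cartesian_product in_arr_props(1) distinct_card del: atLeastAtMost_iff)
  finally show ?thesis by simp
qed

lemma sum_odg: "(\<Sum>u\<in>verts G. odg u) = nedges G"
proof -
  have "edges G = (\<Union>u\<in>verts G. {u} \<times> set (out_arr G u))"
  proof (intro set_eqI)
    show "e \<in> edges G \<longleftrightarrow> e \<in> (\<Union>u\<in>verts G. {u} \<times> set (out_arr G u))" for e
      using out_arr_edges edge_verts by (cases e) blast
  qed
  also have "card \<dots> = (\<Sum>u\<in>verts G. card ({u} \<times> set (out_arr G u)))"
    by (intro card_UN_disjoint) auto
  also have "\<dots> = (\<Sum>u\<in>verts G. odg u)"
    by (intro sum.cong refl)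
      (simp add: card_cartesian_product out_arr_props(1) distinct_card del: atLeastAtMost_iff)
  finally show ?thesis by simp
qed

section \<open>Invariant of the traversal without a stack\<close>

definition scanned :: "(nat \<Rightarrow> nat) \<Rightarrow> nat \<Rightarrow> nat set" where
  "scanned sc v = {u \<in> verts G. \<exists>i < sc u. i < odg u \<and> out_arr G u ! i = v}"

definition before :: "nat list \<Rightarrow> nat \<Rightarrow> nat \<Rightarrow> bool" where
  "before xs u v \<longleftrightarrow> (\<exists>i j. i < j \<and> j < length xs \<and> xs ! i = u \<and> xs ! j = v)"

lemma before_append: "before xs u v \<Longrightarrow> before (xs @ [x]) u v"
  unfolding before_def by (metis butlast_snoc length_append_singleton less_SucI nth_butlast order.strict_trans)

lemma before_snoc: "u \<in> set xs \<Longrightarrow> before (xs @ [x]) u x"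
  unfolding before_def in_set_conv_nth
  by (metis length_append_singleton lessI nth_append nth_append_length)

text \<open>The stack, listed from its top, can be recovered from the top alone: \<open>c x\<close>
  locates the parent \<open>p\<close> in the in-array of \<open>x\<close>, and the edge to
  \<open>x\<close> is the one scanned last at \<open>p\<close>, hence the position
  \<open>sc p - 1\<close>. At the bottom lies the current root \<open>Suc r\<close>, a vertex of
  indegree 0.\<close>

fun linked :: "nat \<Rightarrow> (nat \<Rightarrow> nat) \<Rightarrow> (nat \<Rightarrow> nat) \<Rightarrow> nat list \<Rightarrow> bool" where
  "linked r c sc [] \<longleftrightarrow> True"
| "linked r c sc [x] \<longleftrightarrow> x = Suc r \<and> idg x = 0"
| "linked r c sc (x # p # s) \<longleftrightarrow> c x < idg x \<and> in_arr G x ! c x = p \<and> 0 < sc p \<and>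
     out_arr G p ! (sc p - 1) = x \<and> linked r c sc (p # s)"

lemma linked_cong:
  "(\<And>x. x \<in> set s \<Longrightarrow> c x = c' x) \<Longrightarrow> (\<And>x. x \<in> set (tl s) \<Longrightarrow> sc x = sc' x) \<Longrightarrow>
    linked r c sc s \<longleftrightarrow> linked r c' sc' s"
  by (induction r c sc s rule: linked.induct) auto

text \<open>
  \<open>r\<close> candidate roots have been handled, \<open>os\<close> is the output, \<open>sc u\<close> counts the scanned out-edges of
  \<open>u\<close>. The stack \<open>stk\<close> of vertices in progress is not stored: \<open>c v\<close> is one less than the number of
  unscanned in-edges of \<open>v\<close> until \<open>v\<close> is output, and later the position of the parent of \<open>v\<close>.
\<close>

definition good :: "nat \<Rightarrow> (nat \<Rightarrow> nat) \<Rightarrow> (nat \<Rightarrow> nat) \<Rightarrow> nat list \<Rightarrow> nat list \<Rightarrow> bool" where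
  "good r c sc stk os \<longleftrightarrow>
     r \<le> nverts G \<and> (stk \<noteq> [] \<longrightarrow> r < nverts G) \<and>
     distinct os \<and> set os \<subseteq> verts G \<and> set stk \<subseteq> set os \<and> distinct stk \<and>
     (\<forall>u\<in>verts G. sc u \<le> odg u \<and> (u \<notin> set os \<longrightarrow> sc u = 0) \<and>
        (u \<in> set os - set stk \<longrightarrow> sc u = odg u)) \<and>
     linked r c sc stk \<and>
     (\<forall>v\<in>verts G. 0 < idg v \<longrightarrow>
        (if v \<in> set os then scanned sc v = set (in_arr G v) else card (scanned sc v) + c v + 1 = idg v)) \<and>
     (\<forall>v\<in>verts G. idg v = 0 \<longrightarrow> (v \<in> set os \<longleftrightarrow> v \<le> r \<or> (stk \<noteq> [] \<and> v = Suc r))) \<and>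
     (\<forall>(u, v)\<in>edges G. v \<in> set os \<longrightarrow> before os u v)"

lemma good_unscanned: "good r c sc stk os \<Longrightarrow> u \<in> verts G \<Longrightarrow> u \<notin> set os \<Longrightarrow> sc u = 0"
  unfolding good_def by blast

lemma good_init:
  assumes "\<And>v. v \<in> verts G \<Longrightarrow> 0 < idg v \<Longrightarrow> c v = idg v - 1"
  shows "good 0 c (\<lambda>_. 0) [] []"
  using assms by (auto simp: good_def scanned_def)

lemma good_skip:
  assumes "good r c sc [] os" "r < nverts G" "0 < idg (Suc r)"
  shows "good (Suc r) c sc [] os"
  using assms unfolding good_def by (auto simp: le_Suc_eq)

lemma good_root:
  assumes g: "good r c sc [] os" and r: "r < nverts G" "idg (Suc r) = 0"
  shows "good r c sc [Suc r] (os @ [Suc r])" "Suc r \<notin> set os"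
proof -
  have v: "Suc r \<in> verts G" using r by simp
  then show new: "Suc r \<notin> set os"
    using g r unfolding good_def by auto
  have no_edge: "(u, Suc r) \<notin> edges G" for u
    using idg_pos r by fastforce
  show "good r c sc [Suc r] (os @ [Suc r])"
    using g r v new no_edge unfolding good_def
    by (auto simp: before_append split: if_splits)
qed

lemma scanned_subset: "v \<in> verts G \<Longrightarrow> scanned sc v \<subseteq> set (in_arr G v)"
proof
  fix u assume v: "v \<in> verts G" and "u \<in> scanned sc v"
  then obtain i where u: "u \<in> verts G" "i < odg u" "out_arr G u ! i = v"
    unfolding scanned_def by blast
  then have "v \<in> set (out_arr G u)" by auto
  then show "u \<in> set (in_arr G v)"
    using in_arr_edges[OF v] out_arr_edges[OF u(1)] by simp
qed

lemma scanned_upd: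
  assumes "u \<in> verts G" "sc u < odg u"
  shows "scanned (sc(u := Suc (sc u))) x =
    (if x = out_arr G u ! sc u then insert u (scanned sc x) else scanned sc x)"
  unfolding scanned_def using assms by (auto simp: less_Suc_eq)

text \<open>The edge from \<open>u\<close> is unscanned, whereas all in-edges of a vertex in
  \<open>os\<close> have been scanned; so \<open>v\<close> has not been output, and
  \<open>c v = 0\<close> says that this edge is the last one missing.\<close>

lemma good_scan:
  assumes g: "good r c sc (u # s) os" and i: "sc u < odg u" and v: "v = out_arr G u ! sc u"
    and acyc: "acyclic (edges G)"
  shows "v \<in> verts G" "0 < idg v" "v \<notin> set os" "u \<noteq> v" "c v < idg v" "u \<in> verts G"
    and "0 < c v \<Longrightarrow> good r (c(v := c v - 1)) (sc(u := Suc (sc u))) (u # s) os"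
    and "c v = 0 \<Longrightarrow> good r (c(v := mate_out G u (sc u))) (sc(u := Suc (sc u))) (v # u # s) (os @ [v])"
proof -
  have u: "u \<in> verts G" "u \<in> set os" "u \<notin> set s"
    using g unfolding good_def by auto
  show "u \<in> verts G" by fact
  have e: "(u, v) \<in> edges G"
    using out_arr_edges[OF u(1)] i v by force
  then show vV: "v \<in> verts G" and pos: "0 < idg v"
    using edge_verts idg_pos by auto
  show uv: "u \<noteq> v"
    using acyc e unfolding acyclic_def by blast
  have u_new: "u \<notin> scanned sc v"
    using out_arr_props(1)[OF u(1)] i v unfolding scanned_def
    by (auto simp: nth_eq_iff_index_eq)
  moreover have "u \<in> set (in_arr G v)"
    using in_arr_edges[OF vV] e by simp
  ultimately show new: "v \<notin> set os"
    using g vV pos unfolding good_def by auto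
  have card: "card (scanned sc v) + c v + 1 = idg v"
    using g vV pos new unfolding good_def by auto
  then show "c v < idg v" by simp
  have fin: "finite (scanned sc v)"
    unfolding scanned_def by simp
  let ?sc = "sc(u := Suc (sc u))"
  have sc: "scanned ?sc x = (if x = v then insert u (scanned sc x) else scanned sc x)" for x
    using scanned_upd[of u sc, OF u(1) i] v by simp
  have card': "card (scanned ?sc v) + c v = idg v"
    using card u_new fin sc by simp
  have v_stk: "v \<notin> set (u # s)"
    using g new unfolding good_def by auto
  have s: "linked r c sc (u # s)" "sc v = 0"
    using g vV new unfolding good_def by auto
  show "good r (c(v := c v - 1)) ?sc (u # s) os" if "0 < c v"
  proof -
    have "linked r c sc (u # s) \<longleftrightarrow> linked r (c(v := c v - 1)) ?sc (u # s)"
      by (rule linked_cong) (use v_stk u(3) in auto)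
    then have "linked r (c(v := c v - 1)) ?sc (u # s)"
      using s(1) by simp
    then show ?thesis
      using g i u new card' that unfolding good_def
      by (auto simp: sc v_stk split: if_splits)
  qed
  show "good r (c(v := mate_out G u (sc u))) ?sc (v # u # s) (os @ [v])" if "c v = 0"
  proof -
    let ?c = "c(v := mate_out G u (sc u))"
    have full: "scanned ?sc v = set (in_arr G v)"
      using card' that scanned_subset[OF vV] in_arr_props(1)[OF vV] 
      by (intro card_subset_eq) (simp_all add: distinct_card)
    \<comment> \<open>Only vertices that have been output own scanned out-edges, so all predecessors
      of \<open>v\<close> precede it in the output.\<close>
    have "set (in_arr G v) \<subseteq> set os"
    proof
      fix x assume "x \<in> set (in_arr G v)"
      then have "x \<in> insert u (scanned sc v)" using full by (simp add: sc)
      moreover have "x \<in> set os" if "x \<in> scanned sc v"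
      proof (rule ccontr)
        assume "x \<notin> set os"
        then have "sc x = 0"
          using g that unfolding good_def scanned_def by blast
        then show False
          using that unfolding scanned_def by simp
      qed
      ultimately show "x \<in> set os"
        using u by blast
    qed
    then have bef: "before (os @ [v]) x v" if "(x, v) \<in> edges G" for x
      using that in_arr_edges[OF vV] before_snoc by blast
    have "linked r c sc (u # s) \<longleftrightarrow> linked r ?c ?sc (u # s)"
      by (rule linked_cong) (use v_stk u(3) in auto)
    then have "linked r ?c ?sc (u # s)"
      using s(1) by simp
    then have link: "linked r ?c ?sc (v # u # s)"
      using mate_out_props[OF u(1) i] v by simp
    have "\<forall>x\<in>verts G. 0 < idg x \<longrightarrow> (if x \<in> set (os @ [v]) then scanned ?sc x = set (in_arr G x)
        else card (scanned ?sc x) + ?c x + 1 = idg x)"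
      using g full new unfolding good_def by (auto simp: sc)
    moreover have "\<forall>(x, y)\<in>edges G. y \<in> set (os @ [v]) \<longrightarrow> before (os @ [v]) x y"
      using g bef unfolding good_def by (auto simp: before_append)
    ultimately show ?thesis
      using g link i u new v_stk pos vV unfolding good_def by (auto split: if_splits)
  qed
qed

lemma good_pop_root:
  assumes g: "good r c sc (u # s) os" and "sc u = odg u" "idg u = 0"
  shows "s = []" "u = Suc r" "good (Suc r) c sc [] os" "u \<in> verts G"
proof -
  have "linked r c sc (u # s)"
    using g unfolding good_def by auto
  then show s: "s = []"
    using assms(3) by (cases s) auto
  with \<open>linked r c sc (u # s)\<close> show u: "u = Suc r" by simp
  show "u \<in> verts G" using g unfolding good_def by auto
  show "good (Suc r) c sc [] os"
    using g assms(2) unfolding good_def s u by (auto simp: le_Suc_eq)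
qed

text \<open>Both \<open>mate_in\<close> at the recorded parent position and \<open>sc p - 1\<close>
  are positions of \<open>u\<close> in the out-array of the parent \<open>p\<close>. This array is
  distinct, so the cross link yields the place where the scan of \<open>p\<close> is resumed. The
  field of \<open>u\<close> may then take any value \<open>j\<close>, as \<open>good\<close>
  constrains \<open>c\<close> only on the stack and on vertices still to be output.\<close>

lemma good_pop:
  assumes g: "good r c sc (u # s) os" and "sc u = odg u" "0 < idg u"
  shows "c u < idg u" "u \<in> verts G" "in_arr G u ! c u \<in> verts G"
    "s \<noteq> []" "hd s = in_arr G u ! c u" "sc (hd s) = Suc (mate_in G u (c u))"
    "good r (c(u := j)) sc s os"
proof -
  have l: "linked r c sc (u # s)"
    using g unfolding good_def by auto
  then obtain p s' where s: "s = p # s'"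
    using assms(3) by (cases s) auto
  show u: "u \<in> verts G" using g unfolding good_def by auto
  show *: "c u < idg u" "s \<noteq> []" "hd s = in_arr G u ! c u"
    using l s by auto
  have p: "p \<in> verts G" "0 < sc p" "out_arr G p ! (sc p - 1) = u" "in_arr G u ! c u = p"
    using l s g unfolding good_def by auto
  show "in_arr G u ! c u \<in> verts G" using p by simp
  have "sc p \<le> odg p"
    using g p unfolding good_def by auto
  moreover have "mate_in G u (c u) < odg p" "out_arr G p ! mate_in G u (c u) = u"
    using mate_in_props[OF u *(1)] p by auto
  ultimately have "mate_in G u (c u) = sc p - 1"
    using out_arr_props(1)[OF p(1)] p(2,3) by (subst nth_eq_iff_index_eq[symmetric, of "out_arr G p"]) auto
  then show "sc (hd s) = Suc (mate_in G u (c u))"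
    using s p(2) by simp
  have "u \<notin> set s" using g unfolding good_def by auto
  then have "linked r c sc s \<longleftrightarrow> linked r (c(u := j)) sc s"
    by (intro linked_cong) auto
  then have "linked r (c(u := j)) sc s"
    using l s by simp
  then show "good r (c(u := j)) sc s os"
    using g assms(2) s \<open>u \<notin> set s\<close> unfolding good_def by (auto split: if_splits)
qed

text \<open>Well-founded induction along the edges: if all predecessors of \<open>v\<close> have
  been output, their out-edges are all scanned as the stack is empty. Then every in-edge of
  \<open>v\<close> is scanned, while the counter of a vertex not yet output demands an unscanned
  one.\<close>

lemma good_final:
  assumes g: "good (nverts G) c sc [] os" and acyc: "acyclic (edges G)"
  shows "topological_sorting G os"
proof -
  have "wf (edges G)"
    using finite_acyclic_wf[OF finite_edges acyc] .
  then have "v \<in> verts G \<longrightarrow> v \<in> set os" for v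
  proof (induction v rule: wf_induct_rule)
    case (less v)
    show ?case
    proof (intro impI, rule ccontr)
      assume v: "v \<in> verts G" "v \<notin> set os"
      have "0 < idg v"
        using g v unfolding good_def by auto
      then have card: "card (scanned sc v) + c v + 1 = idg v"
        using g v unfolding good_def by auto
      have "set (in_arr G v) \<subseteq> scanned sc v"
      proof
        fix u assume "u \<in> set (in_arr G v)"
        then have e: "(u, v) \<in> edges G" using in_arr_edges v by simp
        then have u: "u \<in> verts G" "u \<in> set os" using less edge_verts by auto
        then have "sc u = odg u" using g unfolding good_def by auto
        then show "u \<in> scanned sc v"
          using e u out_arr_edges[OF u(1), of v] unfolding scanned_def in_set_conv_nth by auto
      qed
      then have "card (set (in_arr G v)) \<le> card (scanned sc v)"
        by (intro card_mono) (simp_all add: scanned_def)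
      then show False
        using card in_arr_props(1)[OF v(1)] by (simp add: distinct_card)
    qed
  qed
  then have os: "set os = verts G"
    using g unfolding good_def by auto
  have "before os u v" if "(u, v) \<in> edges G" for u v
    using g that edge_verts[OF that] os unfolding good_def by blast
  then show ?thesis
    using g os unfolding good_def topological_sorting_def before_def by blast
qed

text \<open>For potentials that are sums over the vertices, where a step changes the summand of one
  vertex only, or of two in \<open>sum_decrease2\<close>.\<close>

lemma sum_decrease:
  fixes f g :: "nat \<Rightarrow> nat"
  assumes "finite S" "u \<in> S" "f u + x \<le> g u" "\<And>v. v \<in> S \<Longrightarrow> v \<noteq> u \<Longrightarrow> f v \<le> g v"
  shows "sum f S + x \<le> sum g S"
proof -
  have "sum f (S - {u}) \<le> sum g (S - {u})"
    using assms by (intro sum_mono) auto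
  then show ?thesis
    using assms by (simp add: sum.remove)
qed

lemma sum_decrease2:
  fixes f g :: "nat \<Rightarrow> nat"
  assumes "finite S" "u \<in> S" "v \<in> S" "u \<noteq> v" "f u + x \<le> g u" "f v + y \<le> g v"
    "\<And>z. z \<in> S \<Longrightarrow> z \<noteq> u \<Longrightarrow> z \<noteq> v \<Longrightarrow> f z \<le> g z"
  shows "sum f S + x + y \<le> sum g S"
proof -
  have "sum f (S - {u}) + y \<le> sum g (S - {u})"
    using assms by (intro sum_decrease[of _ v]) auto
  then show ?thesis
    using assms by (simp add: sum.remove)
qed

end

text \<open>
  The value that \<open>dec\<close> leaves behind when it finds 0 is arbitrary, because \<open>xchg\<close> overwrites it.
  Registers from 10 on belong to the representation of the fields.
\<close>

locale dfs = machine +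
  fixes dec xchg :: com and rep :: "(nat \<Rightarrow> nat) \<Rightarrow> (nat \<Rightarrow> nat) \<Rightarrow> (nat \<Rightarrow> nat) \<Rightarrow> bool"
    and \<kappa> :: "nat \<Rightarrow> nat \<Rightarrow> nat" and B :: nat
  assumes acyc: "acyclic (edges G)"
    and rep_frame: "rep c R M \<Longrightarrow> (\<forall>r\<ge>10. R' r = R r) \<Longrightarrow> rep c R' M"
    and dec: "rep c R M \<Longrightarrow> R 3 \<in> verts G \<Longrightarrow> 0 < idg (R 3) \<Longrightarrow> c (R 3) < idg (R 3) \<Longrightarrow>
      wp dec (\<lambda>t R' M' os'. t \<le> \<kappa> (R 3) (c (R 3)) \<and> os' = os \<and> (\<forall>r<10. r \<noteq> 5 \<longrightarrow> R' r = R r) \<and>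
        (if c (R 3) = 0 then R' 5 = 1 \<and> (\<exists>y. rep (c(R 3 := y)) R' M')
         else R' 5 = 0 \<and> rep (c(R 3 := c (R 3) - 1)) R' M')) R M os"
    and xchg: "rep c R M \<Longrightarrow> R 3 \<in> verts G \<Longrightarrow> R 4 < idg (R 3) \<Longrightarrow>
      wp xchg (\<lambda>t R' M' os'. t \<le> B * idg (R 3) \<and> os' = os \<and> (\<forall>r<10. r \<noteq> 5 \<longrightarrow> R' r = R r) \<and>
        R' 5 = c (R 3) \<and> rep (c(R 3 := R 4)) R' M') R M os"
    and kappa: "v \<in> verts G \<Longrightarrow> (\<Sum>x<idg v. \<kappa> v x) \<le> B * idg v"
begin

section \<open>Potential and running time of the traversal\<close>

abbreviation KK :: nat where "KK \<equiv> B + 60"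

text \<open>\<open>KK\<close> is reserved for each root and each out-edge still to be examined. A
  vertex not yet output carries the costs \<open>\<kappa> v x\<close> of its future decrements, at
  the values \<open>x\<close> from \<open>c v\<close> down to 0, and \<open>KK * (idg v + 1)\<close>
  twice: once for the \<open>xchg\<close> at its output and once, kept while it is on the stack, for
  leaving it. The 60 in \<open>KK\<close> covers the code around \<open>dec\<close> and
  \<open>xchg\<close>.\<close>

definition pot :: "nat \<Rightarrow> (nat \<Rightarrow> nat) \<Rightarrow> (nat \<Rightarrow> nat) \<Rightarrow> nat list \<Rightarrow> nat list \<Rightarrow> nat" where
  "pot r c sc stk os = KK * (nverts G - r) + (\<Sum>v\<in>verts G. KK * (odg v - sc v) +
     (if v \<in> set os then 0 else 2 * (KK * (idg v + 1)) + (if idg v = 0 then 0 else \<Sum>x<Suc (c v). \<kappa> v x)) +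
     (if v \<in> set stk then KK * (idg v + 1) else 0))"

lemma pot_skip: "r < nverts G \<Longrightarrow> pot (Suc r) c sc [] os + KK \<le> pot r c sc [] os"
  unfolding pot_def by (auto simp: Suc_diff_Suc[symmetric])

lemma pot_root:
  assumes "good r c sc [] os" "r < nverts G" "idg (Suc r) = 0"
  shows "pot r c sc [Suc r] (os @ [Suc r]) + KK \<le> pot r c sc [] os"
  unfolding pot_def add.assoc
  by (intro add_left_mono sum_decrease[of _ "Suc r"])
    (use good_root[OF assms] assms in auto)

lemma pot_scan:
  assumes g: "good r c sc (u # s) os" and i: "sc u < odg u" and v: "v = out_arr G u ! sc u"
  shows "0 < c v \<Longrightarrow> pot r (c(v := c v - 1)) (sc(u := Suc (sc u))) (u # s) os + KK + \<kappa> v (c v)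
      \<le> pot r c sc (u # s) os"
    and "c v = 0 \<Longrightarrow> pot r (c(v := j)) (sc(u := Suc (sc u))) (v # u # s) (os @ [v])
      + KK + (KK * (idg v + 1) + \<kappa> v (c v)) \<le> pot r c sc (u # s) os"
proof -
  note gs = good_scan[OF g i v acyc]
  have us: "u \<in> set os" "u \<notin> set s" "v \<notin> set s"
    using g gs(3) unfolding good_def by auto
  have sc: "odg u - sc u = Suc (odg u - Suc (sc u))"
    using i by simp
  have scv: "sc v = 0"
    using g gs unfolding good_def by auto
  show "pot r (c(v := c v - 1)) (sc(u := Suc (sc u))) (u # s) os + KK + \<kappa> v (c v)
      \<le> pot r c sc (u # s) os" if "0 < c v"
    unfolding pot_def add.assoc[of "KK * (nverts G - r)"]
    unfolding add.assoc[of "KK * (nverts G - r)" _ KK] add.assoc[of "KK * (nverts G - r)" _ "\<kappa> v (c v)"]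
    by (intro add_left_mono sum_decrease2[of _ u v])
      (use gs us that in \<open>auto simp: sc lessThan_Suc[of "c v"]\<close>)
  show "pot r (c(v := j)) (sc(u := Suc (sc u))) (v # u # s) (os @ [v])
      + KK + (KK * (idg v + 1) + \<kappa> v (c v)) \<le> pot r c sc (u # s) os" if "c v = 0"
    unfolding pot_def add.assoc[of "KK * (nverts G - r)"]
    unfolding add.assoc[of "KK * (nverts G - r)" _ KK]
      add.assoc[of "KK * (nverts G - r)" _ "KK * (idg v + 1) + \<kappa> v (c v)"]
    by (intro add_left_mono sum_decrease2[of _ u v])
      (use gs us that in \<open>auto simp: sc scv\<close>)
qed

lemma pot_pop:
  assumes g: "good r c sc (u # s) os"
  shows "pot r (c(u := j)) sc s os + KK * (idg u + 1) \<le> pot r c sc (u # s) os"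
proof -
  have us: "u \<in> set os" "u \<notin> set s" "u \<in> verts G"
    using g unfolding good_def by auto
  show ?thesis
    unfolding pot_def add.assoc[of "KK * (nverts G - r)"]
    by (intro add_left_mono sum_decrease[of _ u]) (use us in auto)
qed

lemma pot_pop_root:
  assumes g: "good r c sc [u] os"
  shows "pot (Suc r) c sc [] os + KK \<le> pot r c sc [u] os"
proof -
  have "r < nverts G" using g unfolding good_def by auto
  from pot_skip[OF this, of c sc os] pot_pop[OF g, of "c u"] show ?thesis
    by (simp del: One_nat_def)
qed

text \<open>
  Register 8 counts the roots that have been examined, register 6 tells whether the stack is nonempty.
  If so, register 2 is the vertex on top of it and register 7 the position in its out-array. Registers
  3 and 4 pass arguments to \<open>dec\<close> and \<open>xchg\<close>, which return their result in register 5.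
\<close>

definition dfs_step :: com where
  "dfs_step =
    If (Eq (V 6) (K 0))
      (If (Eq (InDeg (Op Add (V 8) (K 1))) (K 0))
        (2 ::= Op Add (V 8) (K 1);; 7 ::= K 0;; 6 ::= K 1;; Print (V 2))
        (8 ::= Op Add (V 8) (K 1)))
      (If (Lt (V 7) (OutDeg (V 2)))
        (3 ::= OutV (V 2) (V 7);; dec;;
         If (Eq (V 5) (K 1))
          (4 ::= MOut (V 2) (V 7);; Print (V 3);; xchg;; 2 ::= V 3;; 7 ::= K 0)
          (7 ::= Op Add (V 7) (K 1)))
        (If (Eq (InDeg (V 2)) (K 0))
          (6 ::= K 0;; 8 ::= Op Add (V 8) (K 1))
          (3 ::= V 2;; 4 ::= K 0;; xchg;; 2 ::= InV (V 3) (V 5);;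
           7 ::= Op Add (MIn (V 3) (V 5)) (K 1))))"

definition dfs_prog :: com where
  "dfs_prog = (8 ::= K 0;; 6 ::= K 0;; While (Lt (V 8) NV) dfs_step)"

text \<open>\<open>sc\<close> and \<open>stk\<close> are ghost state: apart from what the fields
  encode, only the top of the stack and its scan position are held in registers.\<close>

definition conc :: "(nat \<Rightarrow> nat) \<Rightarrow> (nat \<Rightarrow> nat) \<Rightarrow> nat list \<Rightarrow> (nat \<Rightarrow> nat) \<Rightarrow> (nat \<Rightarrow> nat) \<Rightarrow> bool" where
  "conc c sc stk R M \<longleftrightarrow> rep c R M \<and> R 6 = (if stk = [] then 0 else 1) \<and>
     (stk \<noteq> [] \<longrightarrow> R 2 = hd stk \<and> R 7 = sc (hd stk))"

definition inv :: "(nat \<Rightarrow> nat) \<Rightarrow> (nat \<Rightarrow> nat) \<Rightarrow> nat list \<Rightarrow> nat \<Rightarrow> bool" where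
  "inv R M os p \<longleftrightarrow> (\<exists>c sc stk. good (R 8) c sc stk os \<and> conc c sc stk R M \<and>
     pot (R 8) c sc stk os \<le> p)"

lemma invI: "good (R 8) c sc stk os \<Longrightarrow> conc c sc stk R M \<Longrightarrow> pot (R 8) c sc stk os \<le> p \<Longrightarrow> inv R M os p"
  unfolding inv_def by blast

text \<open>The 10 extra units pay for the test and the backward jump of the enclosing loop, as the
  premise of \<open>wp_While\<close> demands.\<close>

lemma dfs_step_correct:
  assumes g: "good (R 8) c sc stk os" and c: "conc c sc stk R M" and r: "R 8 < nverts G"
    and p: "pot (R 8) c sc stk os \<le> \<phi>"
  shows "wp dfs_step (\<lambda>t R' M' os'. \<exists>\<phi>'. inv R' M' os' \<phi>' \<and> t + 10 + \<phi>' \<le> \<phi>) R M os"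
proof (cases stk)
  case Nil
  note n = nverts_less one_less
  have R8: "Suc (R 8) \<in> verts G" using r by simp
  have R6: "R 6 = 0" using c Nil by (simp add: conc_def)
  have bd: "Suc (R 8) < 2 ^ b" using r n(1) by linarith
  have rep: "rep c R M" using c by (simp add: conc_def)
  show ?thesis
  proof (cases "idg (Suc (R 8)) = 0")
    case True
    note gr = good_root[OF g[unfolded Nil] r True]
    let ?R = "R(2 := Suc (R 8), 7 := 0, 6 := Suc 0)"
    have sc: "sc (Suc (R 8)) = 0"
      by (rule good_unscanned[OF g]) (use gr(2) R8 in blast)+
    have pot: "pot (R 8) c sc [Suc (R 8)] (os @ [Suc (R 8)]) + KK \<le> \<phi>"
      using pot_root[OF g[unfolded Nil] r True] p[unfolded Nil] by linarith
    have "rep c ?R M"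
      by (rule rep_frame[OF rep]) simp
    then have "conc c sc [Suc (R 8)] ?R M"
      using sc by (simp add: conc_def)
    then have "inv ?R M (os @ [Suc (R 8)]) (\<phi> - 60)"
      using gr(1) pot by (intro invI) (assumption | simp)+
    then show ?thesis
      unfolding dfs_step_def using R8 R6 bd n True pot
      by (auto intro!: exI[of _ "\<phi> - 60"])
  next
    case False
    let ?R = "R(8 := Suc (R 8))"
    have gs: "good (Suc (R 8)) c sc [] os"
      using good_skip[OF g[unfolded Nil] r] False by blast
    have pot: "pot (Suc (R 8)) c sc [] os + KK \<le> \<phi>"
      using pot_skip[OF r, of c sc os] p[unfolded Nil] by linarith
    have "rep c ?R M"
      by (rule rep_frame[OF rep]) simp
    then have "conc c sc [] ?R M"
      using R6 by (simp add: conc_def)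
    then have "inv ?R M os (\<phi> - 60)"
      using gs pot by (intro invI) (assumption | simp)+
    then show ?thesis
      unfolding dfs_step_def using R8 R6 bd n False pot
      by (auto intro!: exI[of _ "\<phi> - 60"])
  qed
next
  case (Cons u s)
  note n = nverts_less one_less
  have R: "R 2 = u" "R 7 = sc u" "R 6 = Suc 0" "rep c R M"
    using c Cons by (auto simp: conc_def)
  have u: "u \<in> verts G" "sc u \<le> odg u"
    using g unfolding Cons good_def by auto
  have odg: "odg x < 2 ^ b" if "x \<in> verts G" for x
    using out_arr_props(4)[OF that] n by linarith
  \<comment> \<open>Another edge to scan, the end of the traversal from a root, or the return to the
    parent.\<close>
  consider "sc u < odg u" | "sc u = odg u" "idg u = 0" | "sc u = odg u" "0 < idg u"
    using u(2) by linarith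
  then show ?thesis
  proof cases
    case 1
    let ?v = "out_arr G u ! sc u" and ?sc = "sc(u := Suc (sc u))"
    note gs = good_scan[OF g[unfolded Cons] 1 refl acyc]
    note ps = pot_scan[OF g[unfolded Cons] 1 refl]
    let ?R = "R(3 := ?v)"
    have rep: "rep c ?R M"
      by (rule rep_frame[OF R(4)]) simp
    have d: "wp dec (\<lambda>t R' M' os'. t \<le> \<kappa> ?v (c ?v) \<and> os' = os \<and>
        (\<forall>r<10. r \<noteq> 5 \<longrightarrow> R' r = ?R r) \<and>
        (if c ?v = 0 then R' 5 = 1 \<and> (\<exists>y. rep (c(?v := y)) R' M')
         else R' 5 = 0 \<and> rep (c(?v := c ?v - 1)) R' M')) ?R M os"
      by (rule dec[OF rep, unfolded fun_upd_same, OF gs(1,2,5)])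
    let ?rest = "If (Eq (V 5) (K 1))
          (4 ::= MOut (V 2) (V 7);; Print (V 3);; xchg;; 2 ::= V 3;; 7 ::= K 0)
          (7 ::= Op Add (V 7) (K 1))"
    have rest: "wp ?rest (\<lambda>t R' M' os'. \<exists>\<phi>'. inv R' M' os' \<phi>' \<and> t + td + 30 + \<phi>' \<le> \<phi>) R1 M1 os"
      if R1: "td \<le> \<kappa> ?v (c ?v)" "\<forall>r<10. r \<noteq> 5 \<longrightarrow> R1 r = ?R r"
        "if c ?v = 0 then R1 5 = 1 \<and> (\<exists>y. rep (c(?v := y)) R1 M1)
         else R1 5 = 0 \<and> rep (c(?v := c ?v - 1)) R1 M1" for td R1 M1
    proof (cases "c ?v = 0")
      case False
      have R1': "R1 8 = R 8" "R1 2 = u" "R1 7 = sc u" "R1 6 = Suc 0" "R1 5 = 0"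
        using R1 R False by auto
      have "rep (c(?v := c ?v - 1)) (R1(7 := Suc (sc u))) M1"
        by (rule rep_frame[of _ R1]) (use R1(3) False in auto)
      then have "conc (c(?v := c ?v - 1)) ?sc (u # s) (R1(7 := Suc (sc u))) M1"
        using R1' by (simp add: conc_def)
      moreover have pot: "pot (R 8) (c(?v := c ?v - 1)) ?sc (u # s) os + KK + td \<le> \<phi>"
        using ps(1) False R1(1) p[unfolded Cons] by linarith
      moreover have "good (R 8) (c(?v := c ?v - 1)) ?sc (u # s) os"
        using gs(7) False by blast
      ultimately have "inv (R1(7 := Suc (sc u))) M1 os (\<phi> - KK - td)"
        using R1' by (intro invI) (assumption | simp)+
      then show ?thesis
        using R1' n 1 odg[OF u(1)] pot
        by (auto intro!: exI[of _ "\<phi> - KK - td"])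
    next
      case True
      let ?j = "mate_out G u (sc u)"
      have R1': "R1 8 = R 8" "R1 2 = u" "R1 7 = sc u" "R1 6 = Suc 0" "R1 5 = Suc 0" "R1 3 = ?v"
        using R1 R True by auto
      obtain y where "rep (c(?v := y)) R1 M1" using R1(3) True by auto
      then have rp: "rep (c(?v := y)) (R1(4 := ?j)) M1"
        by (rule rep_frame) simp
      have R3: "(R1(4 := ?j)) 3 = ?v" using R1' by simp
      have x: "wp xchg (\<lambda>t R' M' os'. t \<le> B * idg ?v \<and> os' = os @ [?v] \<and>
          (\<forall>r<10. r \<noteq> 5 \<longrightarrow> R' r = (R1(4 := ?j)) r) \<and>
          R' 5 = y \<and> rep (c(?v := ?j)) R' M') (R1(4 := ?j)) M1 (os @ [?v])"
        by (rule xchg[OF rp, unfolded R3, unfolded fun_upd_same fun_upd_upd,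
            OF gs(1) mate_out_props(1)[OF u(1) 1]])
      have "wp xchg (\<lambda>t R' M' os'. \<exists>\<phi>'. inv (R'(2 := R' 3, 7 := 0)) M' os' \<phi>' \<and>
        t + td + 60 + \<phi>' \<le> \<phi>) (R1(4 := ?j)) M1 (os @ [?v])"
      proof (rule wp_mono[OF x], elim conjE)
        fix t R2 M2 os2
        assume a: "t \<le> B * idg ?v" "os2 = os @ [?v]" "\<forall>r<10. r \<noteq> 5 \<longrightarrow> R2 r = (R1(4 := ?j)) r"
          "rep (c(?v := ?j)) R2 M2"
        let ?R2 = "R2(2 := R2 3, 7 := 0)"
        have R2: "R2 8 = R 8" "R2 3 = ?v" "R2 6 = Suc 0"
          using a(3) R1' by auto
        have "rep (c(?v := ?j)) ?R2 M2"
          by (rule rep_frame[OF a(4)]) simp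
        moreover have "?sc ?v = 0"
          using good_unscanned[OF g gs(1,3)] gs(4) by simp
        ultimately have conc: "conc (c(?v := ?j)) ?sc (?v # u # s) ?R2 M2"
          using R2 by (simp add: conc_def)
        have le: "B * idg ?v \<le> KK * (idg ?v + 1)"
          by (intro mult_mono) auto
        have pot: "t + td + 60 + pot (R 8) (c(?v := ?j)) ?sc (?v # u # s) os2 \<le> \<phi>"
          using a(1) R1(1) ps(2)[OF True, of ?j] p[unfolded Cons] le unfolding a(2) by linarith
        have gd: "good (R 8) (c(?v := ?j)) ?sc (?v # u # s) os2"
          using gs(8)[OF True] a(2) by simp
        have "inv ?R2 M2 os2 (pot (R 8) (c(?v := ?j)) ?sc (?v # u # s) os2)"
          by (rule invI[OF _ conc]) (use gd R2(1) in simp_all)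
        then show "\<exists>\<phi>'. inv ?R2 M2 os2 \<phi>' \<and> t + td + 60 + \<phi>' \<le> \<phi>"
          using pot by blast
      qed
      then have "wp xchg (\<lambda>t. wp (2 ::= V 3;; 7 ::= K 0) (\<lambda>t' R' M' os'. \<exists>\<phi>'. inv R' M' os' \<phi>' \<and>
        t + t' + td + 40 + \<phi>' \<le> \<phi>)) (R1(4 := ?j)) M1 (os @ [?v])"
        by (rule wp_mono) (use n in auto)
      then show ?thesis
        using R1' 1 u n by (auto elim!: wp_mono)
    qed
    have "wp dec (\<lambda>t. wp ?rest (\<lambda>t' R' M' os'. \<exists>\<phi>'. inv R' M' os' \<phi>' \<and> t' + t + 30 + \<phi>' \<le> \<phi>)) ?R M os"
      by (rule wp_mono[OF d]) (use rest in blast)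
    then have "wp dec (\<lambda>t. wp ?rest (\<lambda>t' R' M' os'. \<exists>\<phi>'. inv R' M' os' \<phi>' \<and>
        bsize (Eq (V 6) (K 0)) + (bsize (Lt (V 7) (OutDeg (V 2))) + (esize (OutV (V 2) (V 7)) + 1 + (t + t'))) + 1
          + 10 + \<phi>' \<le> \<phi>)) ?R M os"
      by (elim wp_mono) auto
    then show ?thesis
      unfolding dfs_step_def wp_If[of "Eq (V 6) (K 0)"] wp_If[of "Lt (V 7) (OutDeg (V 2))"]
        wp_Seq wp_Assign
      using R 1 u n by simp
  next
    case 2
    note gp = good_pop_root[OF g[unfolded Cons] 2]
    have pot: "pot (Suc (R 8)) c sc [] os + KK \<le> \<phi>"
      using pot_pop_root[of "R 8" c sc u os] g gp(1) Cons p by fastforce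
    have "rep c (R(6 := 0, 8 := Suc (R 8))) M"
      by (rule rep_frame[OF R(4)]) simp
    then have "conc c sc [] (R(6 := 0, 8 := Suc (R 8))) M"
      by (simp add: conc_def)
    then have "inv (R(6 := 0, 8 := Suc (R 8))) M os (\<phi> - 60)"
      using gp(3) pot by (intro invI) (assumption | simp)+
    moreover have "Suc (R 8) < 2 ^ b" using r n(1) by linarith
    ultimately show ?thesis
      unfolding dfs_step_def using R 2 u n pot
      by (auto intro!: exI[of _ "\<phi> - 60"])
  next
    case 3
    note gp = good_pop[OF g[unfolded Cons] 3]
    let ?R = "R(3 := u, 4 := 0)"
    let ?rest = "2 ::= InV (V 3) (V 5);; 7 ::= Op Add (MIn (V 3) (V 5)) (K 1)"
    have rep: "rep c ?R M"
      by (rule rep_frame[OF R(4)]) simp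
    have R3: "?R 3 = u" by simp
    have x: "wp xchg (\<lambda>t R' M' os'. t \<le> B * idg u \<and> os' = os \<and>
        (\<forall>r<10. r \<noteq> 5 \<longrightarrow> R' r = ?R r) \<and> R' 5 = c u \<and> rep (c(u := 0)) R' M') ?R M os"
      by (rule xchg[OF rep, unfolded R3, unfolded fun_upd_same, OF gp(2) 3(2)])
    have bd: "Suc (mate_in G u (c u)) < 2 ^ b"
      using mate_in_props(1)[OF gp(2,1)] odg[OF gp(3)] by linarith
    have "wp xchg (\<lambda>t. wp ?rest (\<lambda>t' R' M' os'. \<exists>\<phi>'. inv R' M' os' \<phi>' \<and> t + t' + 30 + \<phi>' \<le> \<phi>)) ?R M os"
    proof (rule wp_mono[OF x], elim conjE)
      fix t R2 M2 os2
      assume a: "t \<le> B * idg u" "os2 = os" "\<forall>r<10. r \<noteq> 5 \<longrightarrow> R2 r = ?R r" "R2 5 = c u"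
        "rep (c(u := 0)) R2 M2"
      let ?R2 = "R2(2 := in_arr G u ! c u, 7 := Suc (mate_in G u (c u)))"
      have R2: "R2 8 = R 8" "R2 3 = u" "R2 6 = Suc 0"
        using a(3) R by auto
      have "rep (c(u := 0)) ?R2 M2"
        by (rule rep_frame[OF a(5)]) simp
      then have conc: "conc (c(u := 0)) sc s ?R2 M2"
        using R2 gp by (simp add: conc_def)
      have "B * idg u + 60 \<le> KK * (idg u + 1)"
        by (simp add: algebra_simps)
      then have pot: "t + 60 + pot (R 8) (c(u := 0)) sc s os \<le> \<phi>"
        using a(1) pot_pop[OF g[unfolded Cons], of 0] p[unfolded Cons] by linarith
      have "inv ?R2 M2 os2 (pot (R 8) (c(u := 0)) sc s os)"
        by (rule invI[OF _ conc]) (use gp(7)[of 0] R2(1) a(2) in simp_all)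
      then show "wp ?rest (\<lambda>t' R' M' os'. \<exists>\<phi>'. inv R' M' os' \<phi>' \<and> t + t' + 30 + \<phi>' \<le> \<phi>) R2 M2 os2"
        using R2 a(4) gp(1,2) bd n pot
        by (auto intro!: exI[of _ "pot (R 8) (c(u := 0)) sc s os"])
    qed
    then show ?thesis
      unfolding dfs_step_def using R 3 u n by (auto elim!: wp_mono)
  qed
qed

theorem dfs_correct:
  assumes rep: "rep c R M" and c: "\<And>v. v \<in> verts G \<Longrightarrow> 0 < idg v \<Longrightarrow> c v = idg v - 1"
  shows "wp dfs_prog (\<lambda>t R' M' os'. t \<le> (7 * B + 500) * (nverts G + nedges G) \<and> topological_sorting G os')
    R M []"
proof -
  let ?R = "R(8 := 0, 6 := 0)"
  note n = nverts_less one_less nverts_pos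
  have rp: "rep c ?R M"
    by (rule rep_frame[OF rep]) simp
  define \<phi> where "\<phi> = pot 0 c (\<lambda>_. 0) [] []"
  have "conc c (\<lambda>_. 0) [] ?R M"
    using rp by (simp add: conc_def)
  then have "inv ?R M [] \<phi>"
    using good_init[OF c] by (intro invI[of _ c "\<lambda>_. 0" "[]"]) (simp_all add: \<phi>_def)
  then have "wp (While (Lt (V 8) NV) dfs_step) (\<lambda>t R' M' os'. \<exists>\<phi>'. inv R' M' os' \<phi>' \<and>
      \<not> bev G R' M' (Lt (V 8) NV) \<and> t + \<phi>' \<le> \<phi> + bsize (Lt (V 8) NV) + 1) ?R M []"
  proof (rule wp_While[where I = "\<lambda>\<phi> R M os. inv R M os \<phi>"])
    fix \<phi> R M os
    assume "inv R M os \<phi>" "bev G R M (Lt (V 8) NV)"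
    then obtain c sc stk where *: "good (R 8) c sc stk os" "conc c sc stk R M" "R 8 < nverts G"
      "pot (R 8) c sc stk os \<le> \<phi>"
      unfolding inv_def by auto
    show "wp dfs_step (\<lambda>t R' M' os'. \<exists>\<phi>'. inv R' M' os' \<phi>' \<and> t + bsize (Lt (V 8) NV) + 1 + \<phi>' \<le> \<phi>)
        R M os"
      by (rule wp_mono[OF dfs_step_correct[OF *]]) auto
  qed simp
  moreover have "\<phi> \<le> KK * nverts G + (KK * nedges G + 2 * (KK * (nedges G + nverts G)) + B * nedges G)"
  proof -
    have "\<phi> \<le> KK * nverts G + (\<Sum>v\<in>verts G. KK * odg v + 2 * (KK * (idg v + 1)) + B * idg v)"
      unfolding \<phi>_def pot_def
    proof (rule add_mono[OF _ sum_mono])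
      fix v assume v: "v \<in> verts G"
      have k: "(if idg v = 0 then 0 else \<Sum>x<Suc (c v). \<kappa> v x) \<le> B * idg v"
        using kappa[OF v] c[OF v] by auto
      show "KK * (odg v - 0) + (if v \<in> set [] then 0 else 2 * (KK * (idg v + 1)) +
          (if idg v = 0 then 0 else \<Sum>x<Suc (c v). \<kappa> v x)) + (if v \<in> set [] then KK * (idg v + 1) else 0)
          \<le> KK * odg v + 2 * (KK * (idg v + 1)) + B * idg v"
        using k by simp
    qed simp
    also have "(\<Sum>v\<in>verts G. KK * odg v + 2 * (KK * (idg v + 1)) + B * idg v) =
        KK * nedges G + 2 * (KK * (nedges G + nverts G)) + B * nedges G"
      by (simp only: sum.distrib flip: sum_distrib_left) (use sum_idg sum_odg in simp)
    finally show ?thesis .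
  qed
  \<comment> \<open>With \<open>KK = B + 60\<close> the left side has the coefficients
    \<open>3 * B + 180\<close> at \<open>n\<close> and \<open>4 * B + 180\<close> at
    \<open>m\<close>, so the constants on the right leave ample room.\<close>
  moreover have "KK * nverts G + (KK * nedges G + 2 * (KK * (nedges G + nverts G)) + B * nedges G) + 20
      \<le> (7 * B + 500) * (nverts G + nedges G)"
    using n(3) by (simp add: algebra_simps)
  ultimately have le: "\<phi> + 20 \<le> (7 * B + 500) * (nverts G + nedges G)"
    and w: "wp (While (Lt (V 8) NV) dfs_step) (\<lambda>t R' M' os'. \<exists>\<phi>'. inv R' M' os' \<phi>' \<and>
      \<not> bev G R' M' (Lt (V 8) NV) \<and> t + \<phi>' \<le> \<phi> + bsize (Lt (V 8) NV) + 1) ?R M []"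
    by auto
  have "wp (While (Lt (V 8) NV) dfs_step) (\<lambda>t R' M' os'.
      t + 10 \<le> (7 * B + 500) * (nverts G + nedges G) \<and> topological_sorting G os') ?R M []"
  proof (rule wp_mono[OF w], elim exE conjE)
    fix t R' M' os' \<phi>'
    assume "inv R' M' os' \<phi>'" "\<not> bev G R' M' (Lt (V 8) NV)" "t + \<phi>' \<le> \<phi> + bsize (Lt (V 8) NV) + 1"
    moreover from this obtain c sc stk where g: "good (R' 8) c sc stk os'" "\<not> R' 8 < nverts G"
      unfolding inv_def by auto
    then have "R' 8 = nverts G" "stk = []"
      unfolding good_def by auto
    ultimately show "t + 10 \<le> (7 * B + 500) * (nverts G + nedges G) \<and> topological_sorting G os'"
      using good_final[OF _ acyc] g(1) le by auto
  qed
  then have "wp (While (Lt (V 8) NV) dfs_step) (\<lambda>t R' M' os'.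
      Suc (Suc (Suc (Suc t))) \<le> (7 * B + 500) * (nverts G + nedges G) \<and> topological_sorting G os') ?R M []"
    by (rule wp_mono) auto
  then show ?thesis
    unfolding dfs_prog_def using n by simp
qed

end

section \<open>Bit planes and ranks\<close>

locale tiers =
  fixes n :: nat and len :: "nat \<Rightarrow> nat"
  assumes len_pos: "v \<in> {1..n} \<Longrightarrow> 0 < len v"
begin

definition tier :: "nat \<Rightarrow> nat set" where
  "tier t = {v \<in> {1..n}. t < len v}"

definition tier_start :: "nat \<Rightarrow> nat" where
  "tier_start t = (\<Sum>s<t. card (tier s))"

definition pos :: "nat \<Rightarrow> nat \<Rightarrow> nat" where
  "pos v t = tier_start t + card {u \<in> tier t. u < v}"

definition mark :: "nat \<Rightarrow> bool" where
  "mark p \<longleftrightarrow> (\<exists>t. \<exists>v\<in>tier (Suc t). p = pos v t)"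

definition rank :: "nat \<Rightarrow> nat" where
  "rank p = card {k. k < p \<and> mark k}"

lemma finite_tier [simp]: "finite (tier t)"
  by (simp add: tier_def)

lemma tier_0: "tier 0 = {1..n}"
  using len_pos by (auto simp: tier_def)

lemma tier_Suc_subset: "tier (Suc t) \<subseteq> tier t"
  by (auto simp: tier_def)

lemma tier_SucD: "v \<in> tier (Suc t) \<Longrightarrow> v \<in> tier t"
  by (auto simp: tier_def)

lemma tier_start_mono: "s \<le> t \<Longrightarrow> tier_start s \<le> tier_start t"
  unfolding tier_start_def by (intro sum_mono2) auto

lemma pos_less_start: "v \<in> tier t \<Longrightarrow> pos v t < tier_start (Suc t)"
  unfolding pos_def tier_start_def using psubset_card_mono[of "tier t" "{u \<in> tier t. u < v}"]
  by fastforce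

lemma start_le_pos: "tier_start t \<le> pos v t"
  by (simp add: pos_def)

lemma pos_mono: "u \<in> tier t \<Longrightarrow> u < v \<Longrightarrow> pos u t < pos v t"
  unfolding pos_def using psubset_card_mono[of "{x \<in> tier t. x < v}" "{x \<in> tier t. x < u}"]
  by fastforce

lemma pos_less_iff:
  assumes "u \<in> tier s" "v \<in> tier t"
  shows "pos u s < pos v t \<longleftrightarrow> s < t \<or> (s = t \<and> u < v)"
proof -
  have less: "pos u s < pos v t" if "s < t" "u \<in> tier s" for s t u v
    using pos_less_start[OF that(2)] tier_start_mono[of "Suc s" t] start_le_pos[of t v] that(1)
    by linarith
  show ?thesis
    using less[of s t u v] less[of t s v u] pos_mono[of u t v] pos_mono[of v t u] assms
    by (metis linorder_neqE_nat order_less_asym order_less_irrefl)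
qed

lemma pos_inj: "u \<in> tier s \<Longrightarrow> v \<in> tier t \<Longrightarrow> pos u s = pos v t \<longleftrightarrow> u = v \<and> s = t"
  using pos_less_iff[of u s v t] pos_less_iff[of v t u s] by (metis linorder_neqE_nat less_irrefl)

lemma pos_0: "v \<in> {1..n} \<Longrightarrow> pos v 0 = v - 1"
proof -
  assume "v \<in> {1..n}"
  then have "{u \<in> tier 0. u < v} = {1..<v}"
    by (auto simp: tier_0)
  then show ?thesis
    by (simp add: pos_def tier_start_def)
qed

lemma mark_pos: "v \<in> tier t \<Longrightarrow> mark (pos v t) \<longleftrightarrow> Suc t < len v"
  unfolding mark_def using pos_inj tier_Suc_subset
  by (metis (mono_tags, lifting) mem_Collect_eq subsetD tier_def)

text \<open>Marks occur in the same order as the continuations they announce. Before the position of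
  \<open>v\<close> in plane \<open>t\<close> there is one mark for every entry of the planes
  \<open>1, ..., t\<close>, all set in the planes below \<open>t\<close>, and one for every smaller
  vertex of plane \<open>t + 1\<close>, set in plane \<open>t\<close>. The summand \<open>n\<close>
  accounts for plane 0, which contains all vertices.\<close>

lemma rank_pos:
  assumes v: "v \<in> tier t"
  shows "n + rank (pos v t) = pos v (Suc t)"
proof -
  let ?S = "SIGMA s:{..<t}. tier (Suc s)" and ?U = "{u \<in> tier (Suc t). u < v}"
  have eq: "{k. k < pos v t \<and> mark k} = (\<lambda>(s, u). pos u s) ` (?S \<union> {t} \<times> ?U)"
  proof (intro equalityI subsetI)
    fix k assume "k \<in> {k. k < pos v t \<and> mark k}"
    then obtain s u where su: "u \<in> tier (Suc s)" "k = pos u s" "pos u s < pos v t"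
      unfolding mark_def by auto
    have "u \<in> tier s" using su(1) tier_Suc_subset by blast
    then have "s < t \<or> (s = t \<and> u < v)"
      using pos_less_iff[OF _ v] su(3) by blast
    then have "(s, u) \<in> ?S \<union> {t} \<times> ?U"
      using su(1) by auto
    then show "k \<in> (\<lambda>(s, u). pos u s) ` (?S \<union> {t} \<times> ?U)"
      using su(2) by (intro image_eqI[of _ _ "(s, u)"]) simp
  next
    fix k assume "k \<in> (\<lambda>(s, u). pos u s) ` (?S \<union> {t} \<times> ?U)"
    then obtain s u where su: "u \<in> tier (Suc s)" "k = pos u s" "s < t \<or> (s = t \<and> u < v)"
      by auto
    have "u \<in> tier s" using su(1) tier_Suc_subset by blast
    then have "pos u s < pos v t" using pos_less_iff[OF _ v] su(3) by blast
    then show "k \<in> {k. k < pos v t \<and> mark k}"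
      using su unfolding mark_def by blast
  qed
  have inj: "inj_on (\<lambda>(s, u). pos u s) (?S \<union> {t} \<times> ?U)"
  proof (rule inj_onI)
    fix x y assume "x \<in> ?S \<union> {t} \<times> ?U" "y \<in> ?S \<union> {t} \<times> ?U"
      and eq: "(case x of (s, u) \<Rightarrow> pos u s) = (case y of (s, u) \<Rightarrow> pos u s)"
    then have "snd x \<in> tier (fst x)" "snd y \<in> tier (fst y)"
      by (auto dest: tier_SucD)
    then show "x = y"
      using eq pos_inj by (simp add: case_prod_unfold prod_eq_iff)
  qed
  have "rank (pos v t) = card (?S \<union> {t} \<times> ?U)"
    unfolding rank_def eq by (rule card_image[OF inj])
  also have "\<dots> = card ?S + card ({t} \<times> ?U)"
    by (intro card_Un_disjoint) auto
  also have "\<dots> = (\<Sum>s<t. card (tier (Suc s))) + card ?U"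
    by (simp add: card_SigmaI)
  finally have "n + rank (pos v t) = card (tier 0) + (\<Sum>s<t. card (tier (Suc s))) + card ?U"
    by (simp add: tier_0)
  then show ?thesis
    unfolding pos_def tier_start_def by (simp only: sum.lessThan_Suc_shift)
qed

text \<open>Double counting: \<open>v\<close> lies in exactly the tiers
  \<open>0, ..., len v - 1\<close>.\<close>

lemma tier_start_total:
  assumes "\<And>v. v \<in> {1..n} \<Longrightarrow> len v \<le> T"
  shows "tier_start T = (\<Sum>v\<in>{1..n}. len v)"
proof -
  have "tier_start T = (\<Sum>s<T. \<Sum>v\<in>{1..n}. if s < len v then 1 else 0)"
    unfolding tier_start_def tier_def by (intro sum.cong) (simp_all add: sum.If_cases Int_def)
  also have "\<dots> = (\<Sum>v\<in>{1..n}. \<Sum>s<T. if s < len v then 1 else 0)"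
    by (rule sum.swap)
  also have "\<dots> = (\<Sum>v\<in>{1..n}. len v)"
  proof (rule sum.cong)
    fix v assume "v \<in> {1..n}"
    then have "{..<T} \<inter> {s. s < len v} = {..<len v}"
      using assms by force
    then show "(\<Sum>s<T. if s < len v then 1 else 0) = len v"
      by (simp add: sum.If_cases)
  qed simp
  finally show ?thesis .
qed

lemma rank_mono: "p \<le> p' \<Longrightarrow> rank p \<le> rank p'"
  unfolding rank_def by (intro card_mono) auto

lemma rank_add: "rank (p + k) = rank p + card {i. i < k \<and> mark (p + i)}"
proof -
  have eq: "{i. i < p + k \<and> mark i} = {i. i < p \<and> mark i} \<union> (+) p ` {i. i < k \<and> mark (p + i)}"
  proof (intro equalityI subsetI)
    fix i assume i: "i \<in> {i. i < p + k \<and> mark i}"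
    show "i \<in> {i. i < p \<and> mark i} \<union> (+) p ` {i. i < k \<and> mark (p + i)}"
    proof (cases "i < p")
      case False
      then have "i = p + (i - p)" by simp
      then show ?thesis using i False by (intro UnI2 image_eqI[of _ _ "i - p"]) auto
    qed (use i in simp)
  qed auto
  have "card ({i. i < p \<and> mark i} \<union> (+) p ` {i. i < k \<and> mark (p + i)}) =
      card {i. i < p \<and> mark i} + card ((+) p ` {i. i < k \<and> mark (p + i)})"
  proof (rule card_Un_disjoint)
    show "finite {i. i < p \<and> mark i}"
      by simp
    show "finite ((+) p ` {i. i < k \<and> mark (p + i)})"
      by (intro finite_imageI) simp
    show "{i. i < p \<and> mark i} \<inter> (+) p ` {i. i < k \<and> mark (p + i)} = {}"
      by (intro equals0I) (elim IntE imageE, simp)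
  qed
  moreover have "card ((+) p ` {i. i < k \<and> mark (p + i)}) = card {i. i < k \<and> mark (p + i)}"
    by (rule card_image) simp
  ultimately show ?thesis
    unfolding rank_def eq by (rule trans[OF _ arg_cong])
qed

end

section \<open>Popcounts, bit lengths and trailing zeros\<close>

definition popcount :: "nat \<Rightarrow> nat" where
  "popcount x = card {i. bit x i}"

lemma finite_bits: "finite {i. bit (x::nat) i}"
proof (rule finite_subset)
  show "{i. bit x i} \<subseteq> {..<x}"
    using bit_imp_take_bit_positive less_exp
    by (metis (no_types, lifting) bit_take_bit_iff lessThan_iff mem_Collect_eq order.strict_trans
        subsetI take_bit_nat_eq_self)
qed simp

lemma popcount_0 [simp]: "popcount 0 = 0"
  by (simp add: popcount_def)

lemma popcount_split: "popcount x = popcount (take_bit h x) + popcount (drop_bit h x)"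
proof -
  have eq: "{i. bit x i} = {i. bit (take_bit h x) i} \<union> (+) h ` {i. bit (drop_bit h x) i}"
  proof (intro equalityI subsetI)
    fix i assume i: "i \<in> {i. bit x i}"
    show "i \<in> {i. bit (take_bit h x) i} \<union> (+) h ` {i. bit (drop_bit h x) i}"
    proof (cases "i < h")
      case False
      then have "i = h + (i - h)" by simp
      then show ?thesis
        using i by (intro UnI2 image_eqI[of _ _ "i - h"]) (auto simp: bit_drop_bit_eq)
    qed (use i in \<open>simp add: bit_take_bit_iff\<close>)
  qed (auto simp: bit_take_bit_iff bit_drop_bit_eq)
  have "card ({i. bit (take_bit h x) i} \<union> (+) h ` {i. bit (drop_bit h x) i}) =
      card {i. bit (take_bit h x) i} + card ((+) h ` {i. bit (drop_bit h x) i})"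
  proof (rule card_Un_disjoint)
    show "{i. bit (take_bit h x) i} \<inter> (+) h ` {i. bit (drop_bit h x) i} = {}"
      by (intro equals0I) (elim IntE imageE, simp add: bit_take_bit_iff)
  qed (intro finite_imageI finite_bits)+
  moreover have "card ((+) h ` {i. bit (drop_bit h x) i}) = card {i. bit (drop_bit h x) i}"
    by (rule card_image) simp
  ultimately show ?thesis
    unfolding popcount_def eq by (rule trans[OF _ arg_cong])
qed

text \<open>The recursion by which the table is filled: entry \<open>x\<close> needs only the
  earlier entry \<open>x div 2\<close>.\<close>

lemma popcount_rec: "popcount x = x mod 2 + popcount (x div 2)"
proof -
  have "popcount (x mod 2) = x mod 2"
  proof (cases "even x")
    case False
    then have "{i. bit (x mod 2) i} = {0}"
      by (auto simp: bit_Suc_0_iff odd_iff_mod_2_eq_one)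
    then show ?thesis
      unfolding popcount_def using False by (simp only: card.insert) (simp add: odd_iff_mod_2_eq_one)
  qed auto
  then show ?thesis
    using popcount_split[of x 1] by (simp add: take_bit_eq_mod drop_bit_eq_div)
qed

lemma popcount_card:
  assumes "x < 2 ^ q"
  shows "popcount x = card {i. i < q \<and> bit x i}"
proof -
  have "{i. bit x i} = {i. i < q \<and> bit x i}"
    using assms by (metis bit_take_bit_iff take_bit_nat_eq_self)
  then show ?thesis by (simp add: popcount_def)
qed

lemma popcount_le: "x < 2 ^ q \<Longrightarrow> popcount x \<le> q"
  using popcount_card[of x q] card_mono[of "{..<q}" "{i. i < q \<and> bit x i}"] by auto

lemma mod_two_bit: "x div 2 ^ i mod 2 = (of_bool (bit x i) :: nat)"
  by (simp add: bit_iff_odd mod_2_eq_odd)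

fun bitlen :: "nat \<Rightarrow> nat" where
  "bitlen x = (if x = 0 then 0 else Suc (bitlen (x div 2)))"

declare bitlen.simps [simp del]

lemma bitlen_0 [simp]: "bitlen 0 = 0"
  by (simp add: bitlen.simps)

lemma bitlen_rec: "0 < x \<Longrightarrow> bitlen x = Suc (bitlen (x div 2))"
  by (subst bitlen.simps) simp

lemma bitlen_less_iff: "t < bitlen x \<longleftrightarrow> 0 < x div 2 ^ t"
proof (induction x arbitrary: t rule: bitlen.induct)
  case (1 x)
  show ?case
  proof (cases "x = 0")
    case False
    then show ?thesis
      using 1 by (cases t) (simp_all add: bitlen_rec div_mult2_eq)
  qed simp
qed

lemma less_bitlen: "x < 2 ^ bitlen x"
  using bitlen_less_iff[of "bitlen x" x] by (simp add: div_eq_0_iff)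

lemma bitlen_le: "x < 2 ^ k \<Longrightarrow> bitlen x \<le> k"
  using bitlen_less_iff[of k x] by simp

lemma bitlen_ge: "0 < x \<Longrightarrow> 2 ^ (bitlen x - 1) \<le> x"
  using bitlen_less_iff[of "bitlen x - 1" x] bitlen_rec[of x]
  by (metis div_less diff_Suc_1 lessI linorder_not_le nat_less_le)

text \<open>The number of trailing zeros, with value 0 at 0. A decrement of \<open>x > 0\<close>
  changes exactly the lowest \<open>tz x + 1\<close> bits.\<close>

fun tz :: "nat \<Rightarrow> nat" where
  "tz x = (if x = 0 \<or> odd x then 0 else Suc (tz (x div 2)))"

declare tz.simps [simp del]

lemma bit_tz: "0 < x \<Longrightarrow> bit x (tz x)"
proof (induction x rule: tz.induct)
  case (1 x)
  then show ?case
    by (subst tz.simps) (auto simp: bit_0 bit_Suc elim!: evenE)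
qed

text \<open>The amortized cost of a binary counter: odd numbers contribute nothing, and halving the
  even ones lowers each positive contribution by 1, which reduces the sum to half the range.\<close>

lemma sum_tz: "(\<Sum>x<d. tz x) \<le> d"
proof (induction d rule: less_induct)
  case (less d)
  have odd: "(\<Sum>x<Suc (2 * k). tz x) = k + (\<Sum>x<Suc k. tz x)" for k
  proof (induction k)
    case (Suc k)
    have "tz (Suc (2 * k)) = 0" "tz (2 * Suc k) = Suc (tz (Suc k))"
      by (subst tz.simps, simp)+
    then show ?case using Suc by simp
  qed (simp add: tz.simps)
  \<comment> \<open>For \<open>d = 2 * k + 3\<close> the hypothesis at \<open>k + 2\<close> gives
    exactly \<open>(k + 1) + (k + 2) = d\<close>. An even \<open>d\<close> drops its last summand,
    which belongs to an odd number.\<close>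
  consider "d = 0" | "d = 1" | k where "d = Suc (2 * Suc k)" | k where "d = Suc (Suc (2 * k))"
  proof (cases "even d")
    case True
    then obtain j where "d = 2 * j" by blast
    then show ?thesis using that(1) that(4)[of "j - 1"] by (cases j) auto
  next
    case False
    then obtain j where "d = Suc (2 * j)" by (metis oddE Suc_eq_plus1)
    then show ?thesis using that(2) that(3)[of "j - 1"] by (cases j) auto
  qed
  then show ?case
  proof cases
    case (3 k)
    then show ?thesis using odd[of "Suc k"] less[of "Suc (Suc k)"] by simp
  next
    case (4 k)
    have "tz (Suc (2 * k)) = 0" by (subst tz.simps) simp
    then show ?thesis using 4 less[of "Suc (2 * k)"] by simp
  qed (simp_all add: tz.simps)
qed

lemma bit_xor_pow: "bit (x XOR 2 ^ t) i \<longleftrightarrow> (bit x i \<noteq> (i = t))" for x :: nat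
  by (auto simp: bit_xor_iff bit_exp_iff)

lemma xor_pow_flip: "x XOR 2 ^ t = (if bit x t then x - 2 ^ t else x + (2 ^ t :: nat))"
proof (cases "bit x t")
  case False
  then have "x XOR 2 ^ t = set_bit t x"
    by (intro bit_eqI) (auto simp: bit_xor_pow bit_set_bit_iff)
  then show ?thesis using False by (simp add: set_bit_eq)
next
  case True
  let ?y = "x XOR 2 ^ t"
  have "\<not> bit ?y t" using True by (simp add: bit_xor_pow)
  moreover have "x = set_bit t ?y"
    using True by (intro bit_eqI) (auto simp: bit_xor_pow bit_set_bit_iff)
  ultimately have "x = ?y + 2 ^ t" by (simp add: set_bit_eq)
  then show ?thesis using True by simp
qed

text \<open>The content of a field in which the \<open>t\<close> low bits of \<open>x\<close> have
  already been overwritten by those of \<open>j\<close>: the intermediate states of an exchange that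
  proceeds bit by bit.\<close>

definition mix :: "nat \<Rightarrow> nat \<Rightarrow> nat \<Rightarrow> nat" where
  "mix t j x = take_bit t j OR push_bit t (drop_bit t x)"

lemma bit_mix: "bit (mix t j x) i \<longleftrightarrow> (if i < t then bit j i else bit x i)"
  by (auto simp: mix_def bit_or_iff bit_take_bit_iff bit_push_bit_iff bit_drop_bit_eq)

lemma mix_0: "mix 0 j x = x"
  by (intro bit_eqI) (simp add: bit_mix)

lemma mix_Suc: "mix (Suc t) j x = (if bit j t = bit x t then mix t j x else mix t j x XOR 2 ^ t)"
  by (intro bit_eqI) (auto simp: bit_mix bit_xor_pow less_Suc_eq)

lemma mix_all: "j < 2 ^ l \<Longrightarrow> x < 2 ^ l \<Longrightarrow> mix l j x = j"
proof (rule bit_eqI)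
  fix i assume "j < 2 ^ l" "x < 2 ^ l"
  then have "bit j i \<longleftrightarrow> i < l \<and> bit j i" "bit x i \<longleftrightarrow> i < l \<and> bit x i"
    using take_bit_nat_eq_self bit_take_bit_iff by metis+
  then show "bit (mix l j x) i = bit j i"
    unfolding bit_mix by (cases "i < l") auto
qed

section \<open>Fields in succinct representation\<close>

text \<open>
  Positions \<open>j * q, \<dots>, j * q + q - 1\<close> share the memory cell \<open>CB + j\<close>. From low to high it consists of
  the \<open>q\<close> data bits, the \<open>q\<close> marks, and the number of marks in the preceding cells of its block of \<open>sK\<close>
  cells. The ranks of the blocks are stored from \<open>SB\<close> on, and the cells below \<open>2 ^ h\<close> contain a table of
  the function \<open>popcount\<close>.
\<close>

locale succinct = machine G w b A + tiers "nverts G" len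
  for G w b A and len :: "nat \<Rightarrow> nat" +
  fixes q sK h SB CB N :: nat
  assumes len_bound: "v \<in> verts G \<Longrightarrow> idg v \<le> 2 ^ len v"
    and len_le: "v \<in> verts G \<Longrightarrow> 0 < idg v \<Longrightarrow> len v \<le> idg v"
    and len_le_b: "v \<in> verts G \<Longrightarrow> len v \<le> b"
    and q: "0 < q" "2 * q < b" "q \<le> 5 * h" and h: "0 < h" "h < b" and sK: "0 < sK"
    and layout: "2 ^ h \<le> SB" "SB + N div (q * sK) < CB" "CB + N div q < A" "A \<le> 2 ^ b"
    and start_le: "tier_start t \<le> N" and N_less: "N < 2 ^ b"
begin

definition popc :: com where
  "popc = (31 ::= K 0;; While (Lt (K 0) (V 30))
     (31 ::= Op Add (V 31) (Mem (Op Mod (V 30) (V 25)));; 30 ::= Op Shr (V 30) (V 24)))"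

text \<open>The constant-time step from a bit to its continuation in the next plane. The rank is the
  sum of the block rank, the relative rank in the high bits of the cell, and the number of marks in
  the cell before the current position; \<open>Mod\<close> by a power of 2 cuts off the later
  marks.\<close>

definition adv :: com where
  "adv =
    (33 ::= Mem (Op Add (V 21) (Op Div (V 32) (V 20)));;
     30 ::= Op Mod (Op Shr (V 33) (V 20)) (Op Shl (K 1) (Op Mod (V 32) (V 20)));;
     popc;;
     32 ::= Op Add NV (Op Add (Mem (Op Add (V 22) (Op Div (V 32) (V 23))))
       (Op Add (Op Shr (V 33) (Op Add (V 20) (V 20))) (V 31))))"

text \<open>One step of subtracting 1 in binary: the bit is flipped. If it was 1, the borrow ends
  here; if it was 0, the borrow moves to the continuation. A borrow out of the last bit reveals that
  the field was 0.\<close>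

definition dec_body :: com where
  "dec_body =
    (35 ::= Op Add (V 21) (Op Div (V 32) (V 20));;
     36 ::= Op Mod (V 32) (V 20);;
     37 ::= Mem (V 35);;
     Put (V 35) (Op Xor (V 37) (Op Shl (K 1) (V 36)));;
     If (Eq (Op Mod (Op Shr (V 37) (V 36)) (K 2)) (K 1))
       (34 ::= K 0)
       (If (Eq (Op Mod (Op Shr (V 37) (Op Add (V 20) (V 36))) (K 2)) (K 1))
         adv
         (34 ::= K 0;; 5 ::= K 1)))"

definition dec_field :: com where
  "dec_field = (32 ::= Op Sub (V 3) (K 1);; 34 ::= K 1;; 5 ::= K 0;; While (Eq (V 34) (K 1)) dec_body)"

text \<open>Register 5 accumulates the old value with weights given by register 39, while register
  38 supplies the new bits; a bit is flipped only where the two differ.\<close>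

definition xchg_body :: com where
  "xchg_body =
    (35 ::= Op Add (V 21) (Op Div (V 32) (V 20));;
     36 ::= Op Mod (V 32) (V 20);;
     37 ::= Mem (V 35);;
     40 ::= Op Mod (Op Shr (V 37) (V 36)) (K 2);;
     5 ::= Op Add (V 5) (Op Shl (V 40) (V 39));;
     If (Eq (V 40) (Op Mod (V 38) (K 2))) Skip
       (Put (V 35) (Op Xor (V 37) (Op Shl (K 1) (V 36))));;
     38 ::= Op Shr (V 38) (K 1);;
     39 ::= Op Add (V 39) (K 1);;
     If (Eq (Op Mod (Op Shr (V 37) (Op Add (V 20) (V 36))) (K 2)) (K 1))
       adv
       (34 ::= K 0))"

definition xchg_field :: com where
  "xchg_field = (32 ::= Op Sub (V 3) (K 1);; 34 ::= K 1;; 5 ::= K 0;; 38 ::= V 4;; 39 ::= K 0;;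
     While (Eq (V 34) (K 1)) xchg_body)"

definition sregs :: "(nat \<Rightarrow> nat) \<Rightarrow> bool" where
  "sregs R \<longleftrightarrow> R 20 = q \<and> R 21 = CB \<and> R 22 = SB \<and> R 23 = q * sK \<and> R 24 = h \<and> R 25 = 2 ^ h"

text \<open>The static part of the memory: table, marks and ranks. Data bits do not occur in it, so
  it survives every update of a field.\<close>

definition dir :: "(nat \<Rightarrow> nat) \<Rightarrow> bool" where
  "dir M \<longleftrightarrow> (\<forall>x<2 ^ h. M x = popcount x) \<and>
     (\<forall>p<N. bit (M (CB + p div q)) (q + p mod q) = mark p) \<and>
     (\<forall>j\<le>N div q. M (CB + j) div 2 ^ (2 * q) + M (SB + j div sK) = rank (j * q))"

text \<open>The bound on \<open>c v\<close> is \<open>2 ^ len v\<close> rather than the indegree,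
  because a decrement of 0 leaves a field consisting of ones only.\<close>

definition rep :: "(nat \<Rightarrow> nat) \<Rightarrow> (nat \<Rightarrow> nat) \<Rightarrow> (nat \<Rightarrow> nat) \<Rightarrow> bool" where
  "rep c R M \<longleftrightarrow> sregs R \<and> dir M \<and> (\<forall>v\<in>verts G. c v < 2 ^ len v \<and>
     (\<forall>t<len v. bit (M (CB + pos v t div q)) (pos v t mod q) = bit (c v) t))"

lemma two_less: "2 < (2::nat) ^ b"
proof -
  have "(2::nat) ^ 1 < 2 ^ b"
    using q by (intro power_strict_increasing) auto
  then show ?thesis by simp
qed

lemma Suc_0_less: "Suc 0 < (2::nat) ^ b"
  using two_less by linarith

lemma pow_less: "i < b \<Longrightarrow> (2::nat) ^ i < 2 ^ b"
  by (intro power_strict_increasing) auto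

lemma b_less: "b < (2::nat) ^ b"
  by simp

lemma offset_less:
  assumes "i < q"
  shows "(2::nat) ^ i < 2 ^ b" "q + i < 2 ^ b" "2 ^ (q + i) < (2::nat) ^ b" "i < 2 ^ b"
proof -
  show "(2::nat) ^ i < 2 ^ b" "2 ^ (q + i) < (2::nat) ^ b"
    using assms q by (auto intro!: pow_less)
  show "q + i < 2 ^ b" "i < 2 ^ b"
    using assms q b_less by linarith+
qed

text \<open>As \<open>q \<le> 5 * h\<close>, the argument is consumed in at most five chunks of
  \<open>h\<close> bits, so the time is constant. In the loop invariant, \<open>k\<close> bounds the
  number of chunks left and \<open>y\<close> is what remains of the argument.\<close>

lemma popc_correct:
  assumes R: "sregs R" and M: "\<forall>x<2 ^ h. M x = popcount x" and x: "R 30 < 2 ^ q"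
  shows "wp popc (\<lambda>t R' M' os'. t \<le> 150 \<and> M' = M \<and> os' = os \<and>
    R' = R(30 := 0, 31 := popcount (R 30))) R M os"
proof -
  let ?I = "\<lambda>\<phi> R' M' os'. M' = M \<and> os' = os \<and>
    (\<exists>k y s. R' = R(31 := s, 30 := y) \<and> s + popcount y = popcount (R 30) \<and> y < 2 ^ (h * k) \<and>
       20 * k \<le> \<phi>)"
  have pc: "popcount (R 30) < 2 ^ b"
    using popcount_le[OF x] q b_less by linarith
  have "(2::nat) ^ q \<le> 2 ^ (h * 5)"
    using q by (intro power_increasing) auto
  then have "R 30 < 2 ^ (h * 5)"
    using x by linarith
  then have init: "?I 100 (R(31 := 0)) M os"
    by (intro conjI refl exI[of _ 5] exI[of _ "R 30"] exI[of _ 0]) auto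
  have hA: "(2::nat) ^ h < A" "y mod 2 ^ h < A" for y
  proof -
    show "(2::nat) ^ h < A" using layout by linarith
    moreover have "y mod 2 ^ h < 2 ^ h" by simp
    ultimately show "y mod 2 ^ h < A" by linarith
  qed
  have "wp (While (Lt (K 0) (V 30))
     (31 ::= Op Add (V 31) (Mem (Op Mod (V 30) (V 25)));; 30 ::= Op Shr (V 30) (V 24)))
     (\<lambda>t R' M' os'. \<exists>\<phi>'. ?I \<phi>' R' M' os' \<and> \<not> bev G R' M' (Lt (K 0) (V 30)) \<and>
       t + \<phi>' \<le> 100 + bsize (Lt (K 0) (V 30)) + 1) (R(31 := 0)) M os"
  proof (rule wp_While[where I = ?I, OF init])
    show "bsafe G b A R' M' (Lt (K 0) (V 30))" for R' M' by simp
    fix \<phi> R' M' os'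
    assume "?I \<phi> R' M' os'" and pos: "bev G R' M' (Lt (K 0) (V 30))"
    then obtain k y s where I: "M' = M" "os' = os" "R' = R(31 := s, 30 := y)"
      "s + popcount y = popcount (R 30)" "y < 2 ^ (h * k)" "20 * k \<le> \<phi>"
      by blast
    have y: "0 < y" using pos I(3) by simp
    then obtain k' where k': "k = Suc k'"
      using I(5) by (cases k) auto
    have split: "popcount y = popcount (y mod 2 ^ h) + popcount (y div 2 ^ h)"
      using popcount_split[of y h] by (simp add: take_bit_eq_mod drop_bit_eq_div)
    have y': "y div 2 ^ h < 2 ^ (h * k')"
      using I(5) k' by (simp add: div_less_iff_less_mult power_add mult.commute)
    have Mp: "M (y mod 2 ^ h) = popcount (y mod 2 ^ h)"
      using M by simp
    have sum: "s + popcount (y mod 2 ^ h) + popcount (y div 2 ^ h) = popcount (R 30)"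
      using split I(4) by simp
    then have less: "s + popcount (y mod 2 ^ h) < 2 ^ b"
      using pc by linarith
    have "?I (\<phi> - 20) (R(31 := s + popcount (y mod 2 ^ h), 30 := y div 2 ^ h)) M os"
      by (intro conjI refl exI[of _ k'] exI[of _ "y div 2 ^ h"] exI[of _ "s + popcount (y mod 2 ^ h)"])
        (use sum y' I(6) k' in auto)
    moreover have "R'(31 := s + popcount (y mod 2 ^ h), 30 := y div 2 ^ h) =
        R(31 := s + popcount (y mod 2 ^ h), 30 := y div 2 ^ h)"
      unfolding I(3) by auto
    moreover have "20 \<le> \<phi>" using I(6) k' by simp
    ultimately have I': "?I (\<phi> - 20) (R'(31 := s + popcount (y mod 2 ^ h), 30 := y div 2 ^ h)) M os"
      and \<phi>: "20 \<le> \<phi>"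
      by simp_all
    have R': "R' 31 = s" "R' 30 = y" "R' 25 = 2 ^ h" "R' 24 = h"
      using R I(3) by (simp_all add: sregs_def)
    define Q where "Q = (\<lambda>t R' M' os'. \<exists>\<phi>'. ?I \<phi>' R' M' os' \<and> t + bsize (Lt (K 0) (V 30)) + 1 + \<phi>' \<le> \<phi>)"
    have Q: "Q t (R'(31 := s + popcount (y mod 2 ^ h), 30 := y div 2 ^ h)) M os" if "t \<le> 15" for t
      unfolding Q_def by (rule exI[of _ "\<phi> - 20"]) (rule conjI[OF I'], use that \<phi> in simp)
    have "wp (31 ::= Op Add (V 31) (Mem (Op Mod (V 30) (V 25)));; 30 ::= Op Shr (V 30) (V 24)) Q R' M' os'"
      using R' hA less Q by (simp add: Mp I(1,2))
    then show "wp (31 ::= Op Add (V 31) (Mem (Op Mod (V 30) (V 25)));; 30 ::= Op Shr (V 30) (V 24))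
      (\<lambda>t R' M' os'. \<exists>\<phi>'. ?I \<phi>' R' M' os' \<and> t + bsize (Lt (K 0) (V 30)) + 1 + \<phi>' \<le> \<phi>) R' M' os'"
      unfolding Q_def .
  qed
  then have "wp (While (Lt (K 0) (V 30))
     (31 ::= Op Add (V 31) (Mem (Op Mod (V 30) (V 25)));; 30 ::= Op Shr (V 30) (V 24)))
     (\<lambda>t R' M' os'. Suc (Suc t) \<le> 150 \<and> M' = M \<and> os' = os \<and> R' = R(30 := 0, 31 := popcount (R 30)))
     (R(31 := 0)) M os"
    by (rule wp_mono) (auto simp: fun_upd_twist)
  then show ?thesis
    unfolding popc_def by simp
qed

lemma adv_correct:
  assumes R: "sregs R" and M: "dir M" and p: "R 32 = p" "p < N" "nverts G + rank p < 2 ^ b"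
  shows "wp adv (\<lambda>t R' M' os'. t \<le> 200 \<and> M' = M \<and> os' = os \<and>
    (\<exists>x y. R' = R(30 := 0, 31 := x, 33 := y, 32 := nverts G + rank p))) R M os"
proof -
  let ?j = "p div q" and ?i = "p mod q"
  let ?c = "M (CB + ?j)"
  let ?x = "?c div 2 ^ q mod 2 ^ ?i"
  have i: "?i < q" using q by simp
  have pji: "p = ?j * q + ?i" by simp
  have j: "?j \<le> N div q"
    using p(2) by (intro div_le_mono) simp
  have "?j div sK \<le> N div (q * sK)"
    using p(2) by (simp add: div_mult2_eq[symmetric] div_le_mono)
  then have jK: "SB + p div (q * sK) < A" "CB + ?j < A"
    using layout j by (simp_all add: div_mult2_eq)
  have less: "CB + ?j < 2 ^ b" "SB + p div (q * sK) < 2 ^ b"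
    using jK layout by linarith+
  have xi: "?x < 2 ^ ?i" by simp
  also have "(2::nat) ^ ?i \<le> 2 ^ q" using i by (intro power_increasing) auto
  finally have xq: "?x < 2 ^ q" .
  have ii: "(2::nat) ^ ?i < 2 ^ b"
    using i q by (intro pow_less) linarith
  have qq: "q + q < 2 ^ b"
    using q b_less by linarith
  \<comment> \<open>The bits of \<open>?x\<close> are the marks of the positions from the start of
    the cell up to, but not including, \<open>p\<close>.\<close>
  have "popcount ?x = card {k. k < ?i \<and> bit ?x k}"
    by (rule popcount_card[OF xi])
  also have "{k. k < ?i \<and> bit ?x k} = {k. k < ?i \<and> mark (?j * q + k)}"
  proof (intro Collect_cong conj_cong refl)
    fix k assume k: "k < ?i"
    then have kq: "k < q" using i by simp
    have "bit ?x k = bit ?c (q + k)"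
      using k by (simp add: take_bit_eq_mod[symmetric] drop_bit_eq_div[symmetric] bit_take_bit_iff
          bit_drop_bit_eq)
    moreover have "(?j * q + k) div q = ?j" "(?j * q + k) mod q = k" "?j * q + k < N"
      using kq k p(2) pji by (simp_all add: div_add1_eq, linarith)
    ultimately show "bit ?x k = mark (?j * q + k)"
      using M unfolding dir_def by metis
  qed
  finally have pop: "popcount ?x = card {k. k < ?i \<and> mark (?j * q + k)}" .
  have "rank p = rank (?j * q) + popcount ?x"
    using rank_add[of "?j * q" ?i] pop pji by simp
  moreover have "rank (?j * q) = ?c div 2 ^ (q + q) + M (SB + ?j div sK)"
    using M j unfolding dir_def by (simp add: mult_2)
  ultimately have rank: "rank p = M (SB + p div (q * sK)) + (?c div 2 ^ (q + q) + popcount ?x)"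
    by (simp add: div_mult2_eq)
  let ?R = "R(33 := ?c, 30 := ?x)"
  have sR: "sregs ?R" using R by (simp add: sregs_def)
  have "wp popc (\<lambda>t R' M' os'. t \<le> 150 \<and> M' = M \<and> os' = os \<and>
      R' = ?R(30 := 0, 31 := popcount (?R 30))) ?R M os"
    by (rule popc_correct[OF sR]) (use xq M in \<open>simp_all add: dir_def\<close>)
  then have "wp popc (\<lambda>t. wp (32 ::= Op Add NV (Op Add (Mem (Op Add (V 22) (Op Div (V 32) (V 23))))
       (Op Add (Op Shr (V 33) (Op Add (V 20) (V 20))) (V 31))))
      (\<lambda>t' R' M' os'. t + t' \<le> 180 \<and> M' = M \<and> os' = os \<and>
      (\<exists>x y. R' = R(30 := 0, 31 := x, 33 := y, 32 := nverts G + rank p)))) ?R M os"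
  proof (rule wp_mono, elim conjE)
    fix t :: nat and R' M' os'
    assume a: "t \<le> 150" "M' = M" "os' = os" "R' = ?R(30 := 0, 31 := popcount (?R 30))"
    have R': "R' 20 = q" "R' 22 = SB" "R' 23 = q * sK" "R' 31 = popcount ?x" "R' 32 = p" "R' 33 = ?c"
      using a(4) R p(1) by (simp_all add: sregs_def)
    have "R'(32 := nverts G + rank p) = R(30 := 0, 31 := popcount ?x, 33 := ?c, 32 := nverts G + rank p)"
      unfolding a(4) by auto
    then show "wp (32 ::= Op Add NV (Op Add (Mem (Op Add (V 22) (Op Div (V 32) (V 23))))
       (Op Add (Op Shr (V 33) (Op Add (V 20) (V 20))) (V 31))))
      (\<lambda>t' R' M' os'. t + t' \<le> 180 \<and> M' = M \<and> os' = os \<and>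
      (\<exists>x y. R' = R(30 := 0, 31 := x, 33 := y, 32 := nverts G + rank p))) R' M' os'"
      using a(1,2,3) R' p(3) jK less qq rank by auto
  qed
  then have w: "wp popc (\<lambda>t. wp (32 ::= Op Add NV (Op Add (Mem (Op Add (V 22) (Op Div (V 32) (V 23))))
       (Op Add (Op Shr (V 33) (Op Add (V 20) (V 20))) (V 31))))
      (\<lambda>t' R' M' os'. esize (Mem (Op Add (V 21) (Op Div (V 32) (V 20)))) + 1 +
        (esize (Op Mod (Op Shr (V 33) (V 20)) (Op Shl (K 1) (Op Mod (V 32) (V 20)))) + 1 + (t + t'))
        \<le> 200 \<and> M' = M \<and> os' = os \<and>
      (\<exists>x y. R' = R(30 := 0, 31 := x, 33 := y, 32 := nverts G + rank p)))) ?R M os"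
    by (rule wp_mono) (auto elim!: wp_mono simp del: wp_Assign)
  have sr: "R 20 = q" "R 21 = CB" using R by (simp_all add: sregs_def)
  show ?thesis
    unfolding adv_def
    using w sr p(1) jK less ii qq Suc_0_less
    by simp
qed

text \<open>A data bit lies below bit \<open>q\<close> of its cell, hence marks and relative rank
  are untouched; the cells of the table and of the block ranks lie elsewhere. Any other bit of a
  field sits in another cell or at another offset, since \<open>pos\<close> is injective.\<close>

lemma flip_field:
  assumes r: "rep c R M" and v: "v \<in> verts G" "t < len v"
  shows "rep (c(v := c v XOR 2 ^ t)) R (M(CB + pos v t div q := M (CB + pos v t div q) XOR 2 ^ (pos v t mod q)))"
proof -
  let ?a = "CB + pos v t div q" and ?i = "pos v t mod q"
  let ?M = "M(?a := M ?a XOR 2 ^ ?i)"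
  have i: "?i < q" using q by simp
  have vt: "v \<in> tier t" using v by (simp add: tier_def)
  have "dir ?M"
  proof -
    have "?M x = popcount x" if "x < 2 ^ h" for x
      using that r layout by (simp add: rep_def dir_def)
    moreover have "bit (?M (CB + p div q)) (q + p mod q) = mark p" if "p < N" for p
    proof -
      have "bit (M (CB + p div q)) (q + p mod q) = mark p"
        using that r by (simp add: rep_def dir_def)
      then show ?thesis
        using i by (auto simp: bit_xor_pow)
    qed
    moreover have "?M (CB + j) div 2 ^ (2 * q) + ?M (SB + j div sK) = rank (j * q)"
      if j: "j \<le> N div q" for j
    proof -
      have "j div sK \<le> N div (q * sK)"
        using j by (simp add: div_mult2_eq div_le_mono)
      then have "SB + j div sK \<noteq> ?a" using layout by linarith
      moreover have "(x XOR 2 ^ ?i) div 2 ^ (2 * q) = x div 2 ^ (2 * q)" for x :: nat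
        unfolding drop_bit_eq_div[symmetric]
        by (intro bit_eqI, simp only: bit_drop_bit_eq bit_xor_pow o_apply) (use i in auto)
      ultimately show ?thesis
        using r j by (auto simp: rep_def dir_def)
    qed
    ultimately show ?thesis by (auto simp: dir_def)
  qed
  moreover have "(c(v := c v XOR 2 ^ t)) u < 2 ^ len u" if "u \<in> verts G" for u
    using that r v xor_less_pow[of "c v" "len v" "2 ^ t"] power_strict_increasing[of t "len v" "2::nat"]
    by (simp add: rep_def)
  moreover have "bit (?M (CB + pos u s div q)) (pos u s mod q) = bit ((c(v := c v XOR 2 ^ t)) u) s"
    if u: "u \<in> verts G" "s < len u" for u s
  proof -
    have us: "u \<in> tier s" using u by (simp add: tier_def)
    have old: "bit (M (CB + pos u s div q)) (pos u s mod q) = bit (c u) s"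
      using r u by (simp add: rep_def)
    show ?thesis
    proof (cases "u = v \<and> s = t")
      case True
      then show ?thesis using old by (simp add: bit_xor_pow)
    next
      case False
      then have "pos u s \<noteq> pos v t" using pos_inj[OF us vt] by simp
      then have "pos u s div q \<noteq> pos v t div q \<or> pos u s mod q \<noteq> pos v t mod q"
        by (metis div_mult_mod_eq)
      then show ?thesis using old False by (auto simp: bit_xor_pow)
    qed
  qed
  ultimately show ?thesis
    using r unfolding rep_def by blast
qed

lemma rep_cong: "rep c R M \<Longrightarrow> (\<And>r. 20 \<le> r \<Longrightarrow> r < 30 \<Longrightarrow> R' r = R r) \<Longrightarrow> rep c R' M"
  by (simp add: rep_def sregs_def)

lemma field_props:
  assumes r: "rep c R M" and v: "v \<in> verts G" "t < len v"
  shows "CB + pos v t div q < A" "CB + pos v t div q < 2 ^ b" "pos v t mod q < q" "pos v t < N"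
    "bit (M (CB + pos v t div q)) (pos v t mod q) = bit (c v) t"
    "bit (M (CB + pos v t div q)) (q + pos v t mod q) \<longleftrightarrow> Suc t < len v"
    "nverts G + rank (pos v t) = pos v (Suc t)" "pos v (Suc t) < 2 ^ b"
    "R 20 = q" "R 21 = CB"
proof -
  have vt: "v \<in> tier t" using v by (simp add: tier_def)
  show N: "pos v t < N"
    using pos_less_start[OF vt] start_le[of "Suc t"] by linarith
  then have "pos v t div q \<le> N div q" by (intro div_le_mono) simp
  then show "CB + pos v t div q < A" "CB + pos v t div q < 2 ^ b"
    using layout by linarith+
  show "pos v t mod q < q" using q by simp
  show "bit (M (CB + pos v t div q)) (pos v t mod q) = bit (c v) t"
    using r v by (simp add: rep_def)
  show "bit (M (CB + pos v t div q)) (q + pos v t mod q) \<longleftrightarrow> Suc t < len v"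
    using r N mark_pos[OF vt] by (simp add: rep_def dir_def)
  show "nverts G + rank (pos v t) = pos v (Suc t)"
    by (rule rank_pos[OF vt])
  have "pos v (Suc t) \<le> tier_start (Suc (Suc t))"
    unfolding pos_def tier_start_def
    by (simp add: card_mono)
  then show "pos v (Suc t) < 2 ^ b"
    using start_le[of "Suc (Suc t)"] N_less by linarith
  show "R 20 = q" "R 21 = CB" using r by (simp_all add: rep_def sregs_def)
qed

section \<open>Decrement of a field\<close>

definition dec_runs :: "nat \<Rightarrow> nat \<Rightarrow> nat" where
  "dec_runs v x = (if x = 0 then len v else Suc (tz x))"

text \<open>In round \<open>t\<close> the low \<open>t\<close> bits of the field, all of them 0, have been replaced by 1.\<close>

definition dec_inv :: "(nat \<Rightarrow> nat) \<Rightarrow> nat \<Rightarrow> (nat \<Rightarrow> nat) \<Rightarrow> nat \<Rightarrow> (nat \<Rightarrow> nat) \<Rightarrow> (nat \<Rightarrow> nat) \<Rightarrow> bool" where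
  "dec_inv c v R0 \<phi> R M \<longleftrightarrow> (\<forall>r<10. r \<noteq> 5 \<longrightarrow> R r = R0 r) \<and>
     (if R 34 = 1 then R 5 = 0 \<and> (\<exists>t<len v. R 32 = pos v t \<and> take_bit t (c v) = 0 \<and>
          rep (c(v := c v + 2 ^ t - 1)) R M \<and> 300 * (dec_runs v (c v) - t) \<le> \<phi>)
      else if c v = 0 then R 5 = 1 \<and> (\<exists>y. rep (c(v := y)) R M)
      else R 5 = 0 \<and> rep (c(v := c v - 1)) R M)"

text \<open>Guarantees that the next round of the decrement loop is still paid for: if the low
  \<open>t\<close> bits are 0, the lowest 1, which is the last bit to be visited when
  \<open>x > 0\<close>, is at position \<open>t\<close> or above.\<close>

lemma dec_runs_gt:
  assumes "take_bit t x = 0" "t < len v"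
  shows "t < dec_runs v x"
proof (cases "x = 0")
  case False
  then have "bit x (tz x)" using bit_tz by simp
  then have "\<not> tz x < t" using assms(1) by (metis bit_0_eq bit_take_bit_iff bot_apply bot_bool_def)
  then show ?thesis using False by (simp add: dec_runs_def)
qed (use assms in \<open>simp add: dec_runs_def\<close>)

lemma dec_body_correct:
  assumes I: "dec_inv c v R0 \<phi> R M" and go: "R 34 = 1" and v: "v \<in> verts G"
  shows "wp dec_body (\<lambda>t R' M' os'. os' = os \<and> (\<exists>\<phi>'. dec_inv c v R0 \<phi>' R' M' \<and> t + 10 + \<phi>' \<le> \<phi>)) R M os"
proof -
  obtain t where t: "t < len v" "R 32 = pos v t" "take_bit t (c v) = 0" "R 5 = 0"
    "rep (c(v := c v + 2 ^ t - 1)) R M" "300 * (dec_runs v (c v) - t) \<le> \<phi>"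
    and frame: "\<forall>r<10. r \<noteq> 5 \<longrightarrow> R r = R0 r"
    using I go unfolding dec_inv_def by auto
  let ?x = "c v" and ?y = "c v + 2 ^ t - 1"
  let ?a = "CB + pos v t div q" and ?i = "pos v t mod q"
  let ?M = "M(?a := M ?a XOR 2 ^ ?i)"
  note fp = field_props[OF t(5) v t(1)]
  have \<phi>: "300 \<le> \<phi>"
    using dec_runs_gt[OF t(3,1)] t(6) by simp
  have dv: "2 ^ t dvd ?x"
    using t(3) by (simp add: take_bit_eq_0_iff)
  \<comment> \<open>The borrow has changed only bits below \<open>t\<close>, because
    \<open>2 ^ t\<close> divides the original value.\<close>
  have "bit ?y t \<longleftrightarrow> bit ?x t"
  proof -
    from dv obtain z where z: "?x = 2 ^ t * z" by blast
    have "?y = (2 ^ t - 1) + 2 ^ t * z" using z by simp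
    also have "\<dots> div 2 ^ t = z" by (subst div_mult_self2) simp_all
    finally have "?y div 2 ^ t = ?x div 2 ^ t" using z by simp
    then show ?thesis by (simp only: bit_iff_odd)
  qed
  then have bit: "bit (M ?a) ?i \<longleftrightarrow> bit ?x t"
    using fp(5) by simp
  have flip: "rep (c(v := ?y XOR 2 ^ t)) R ?M"
    using flip_field[OF t(5) v t(1)] by simp
  \<comment> \<open>A 1 absorbs the borrow and completes \<open>?x - 1\<close>; a 0 turns into 1 and
    passes the borrow on, which is the invariant for \<open>Suc t\<close>.\<close>
  have y: "?y XOR 2 ^ t = (if bit ?x t then ?x - 1 else ?x + 2 ^ Suc t - 1)"
    using \<open>bit ?y t \<longleftrightarrow> bit ?x t\<close> unfolding xor_pow_flip by auto
  note i = offset_less[OF fp(3)]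
  define Q where "Q = (\<lambda>t R' M' os'. os' = os \<and> (\<exists>\<phi>'. dec_inv c v R0 \<phi>' R' M' \<and> t + 10 + \<phi>' \<le> \<phi>))"
  let ?R = "R(35 := ?a, 36 := ?i, 37 := M ?a)"
  have rp: "rep (c(v := ?y XOR 2 ^ t)) R' ?M" if "\<And>r. 20 \<le> r \<Longrightarrow> r < 30 \<Longrightarrow> R' r = R r" for R'
    by (rule rep_cong[OF flip that])
  have "wp dec_body Q R M os"
  proof (cases "bit ?x t")
    case True
    then have "?x \<noteq> 0" by (intro notI) simp
    then have "dec_inv c v R0 0 (?R(34 := 0)) ?M"
      using frame rp[of "?R(34 := 0)"] y True t(4) unfolding dec_inv_def by simp
    then have "Q k (?R(34 := 0)) ?M os" if "k \<le> 60" for k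
      unfolding Q_def using that \<phi> by (intro conjI refl exI[of _ 0]) auto
    then show ?thesis
      unfolding dec_body_def using fp t(2) i two_less Suc_0_less True bit by (simp add: mod_two_bit)
  next
    case False
    show ?thesis
    proof (cases "Suc t < len v")
      case False
      \<comment> \<open>Without a mark, \<open>t\<close> is the last bit. The new content
        \<open>?x + 2 ^ len v - 1\<close> still fits into the field, which forces
        \<open>?x = 0\<close>.\<close>
      have "(c(v := ?y XOR 2 ^ t)) v < 2 ^ len v"
        using flip v unfolding rep_def by blast
      then have "?y XOR 2 ^ t < 2 ^ len v" by simp
      moreover have "2 ^ Suc t = (2::nat) ^ len v" using False t(1) by (metis Suc_lessI)
      ultimately have x0: "?x = 0"
        using \<open>\<not> bit ?x t\<close> y by simp
      then have "dec_inv c v R0 0 (?R(34 := 0, 5 := Suc 0)) ?M"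
        using frame rp[of "?R(34 := 0, 5 := Suc 0)"] unfolding dec_inv_def by auto
      then have "Q k (?R(34 := 0, 5 := Suc 0)) ?M os" if "k \<le> 60" for k
        unfolding Q_def using that \<phi> by (intro conjI refl exI[of _ 0]) auto
      then show ?thesis
        unfolding dec_body_def using fp t(2) i two_less Suc_0_less \<open>\<not> bit ?x t\<close> False bit
        by (simp add: mod_two_bit)
    next
      case True
      have t': "take_bit (Suc t) ?x = 0"
        using t(3) \<open>\<not> bit ?x t\<close>
        by (intro bit_eqI) (metis bit_0_eq bit_take_bit_iff bot_apply bot_bool_def less_Suc_eq)
      have gt: "Suc t < dec_runs v ?x"
        using dec_runs_gt[OF t' True] .
      have sR: "sregs ?R" and dM: "dir ?M"
        using rp[of ?R] by (simp_all add: rep_def)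
      have adv: "wp adv (\<lambda>t' R' M' os'. t' \<le> 200 \<and> M' = ?M \<and> os' = os \<and>
          (\<exists>x y. R' = ?R(30 := 0, 31 := x, 33 := y, 32 := nverts G + rank (pos v t)))) ?R ?M os"
        by (rule adv_correct[OF sR dM]) (use t(2) fp in simp_all)
      have Q60: "wp adv (\<lambda>t'. Q (60 + t')) ?R ?M os"
      proof (rule wp_mono[OF adv], elim conjE exE)
        fix t' :: nat and R' M' os' x y'
        assume a: "t' \<le> 200" "M' = ?M" "os' = os"
          "R' = ?R(30 := 0, 31 := x, 33 := y', 32 := nverts G + rank (pos v t))"
        have "rep (c(v := ?x + 2 ^ Suc t - 1)) R' ?M"
          using rp[of R'] a(4) y \<open>\<not> bit ?x t\<close> by simp
        moreover have "R' 34 = 1" "R' 5 = 0" "R' 32 = pos v (Suc t)" "\<forall>r<10. r \<noteq> 5 \<longrightarrow> R' r = R0 r"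
          using a(4) go t(4) fp(7) frame by auto
        ultimately have "dec_inv c v R0 (300 * (dec_runs v ?x - Suc t)) R' ?M"
          unfolding dec_inv_def using t' True by auto
        moreover have "300 * (dec_runs v ?x - Suc t) + 300 \<le> \<phi>"
          using gt t(6) by simp
        ultimately show "Q (60 + t') R' M' os'"
          unfolding Q_def a(2,3) using a(1)
          by (intro conjI refl exI[of _ "300 * (dec_runs v ?x - Suc t)"]) auto
      qed
      have Q_mono: "Q (60 + t') R' M' os' \<Longrightarrow> k \<le> 60 + t' \<Longrightarrow> Q k R' M' os'" for k t' R' M' os'
        unfolding Q_def by fastforce
      show ?thesis
        unfolding dec_body_def using fp t(2) i two_less Suc_0_less \<open>\<not> bit ?x t\<close> True bit
        by (simp add: mod_two_bit) (rule wp_mono[OF Q60], erule Q_mono, simp)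
    qed
  qed
  then show ?thesis unfolding Q_def .
qed

lemma dec_field_correct:
  assumes r: "rep c R M" and v: "R 3 \<in> verts G"
  shows "wp dec_field (\<lambda>t R' M' os'. t \<le> 300 * dec_runs (R 3) (c (R 3)) + 50 \<and> os' = os \<and>
      (\<forall>r<10. r \<noteq> 5 \<longrightarrow> R' r = R r) \<and>
      (if c (R 3) = 0 then R' 5 = 1 \<and> (\<exists>y. rep (c(R 3 := y)) R' M')
       else R' 5 = 0 \<and> rep (c(R 3 := c (R 3) - 1)) R' M')) R M os"
proof -
  let ?v = "R 3" and ?R = "R(32 := R 3 - Suc 0, 34 := Suc 0, 5 := 0)"
  let ?I = "\<lambda>\<phi> R' M' os'. os' = os \<and> dec_inv c ?v R \<phi> R' M'"
  have "rep c ?R M"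
    by (rule rep_cong[OF r]) simp
  moreover have "0 < len ?v" by (rule len_pos[OF v])
  ultimately have init: "?I (300 * dec_runs ?v (c ?v)) ?R M os"
    unfolding dec_inv_def using pos_0[OF v] by (auto intro!: exI[of _ 0])
  have "wp (While (Eq (V 34) (K 1)) dec_body) (\<lambda>t R' M' os'. \<exists>\<phi>'. ?I \<phi>' R' M' os' \<and>
      \<not> bev G R' M' (Eq (V 34) (K 1)) \<and>
      t + \<phi>' \<le> 300 * dec_runs ?v (c ?v) + bsize (Eq (V 34) (K 1)) + 1) ?R M os"
  proof (rule wp_While[where I = ?I, OF init])
    fix \<phi> R' M' os'
    assume I: "?I \<phi> R' M' os'" "bev G R' M' (Eq (V 34) (K 1))"
    then have "wp dec_body (\<lambda>t R2 M2 os2. os2 = os' \<and>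
        (\<exists>\<phi>'. dec_inv c ?v R \<phi>' R2 M2 \<and> t + 10 + \<phi>' \<le> \<phi>)) R' M' os'"
      using dec_body_correct[OF _ _ v] by simp
    then show "wp dec_body (\<lambda>t R' M' os'. \<exists>\<phi>'. ?I \<phi>' R' M' os' \<and>
        t + bsize (Eq (V 34) (K 1)) + 1 + \<phi>' \<le> \<phi>) R' M' os'"
      by (rule wp_mono) (use I in auto)
  qed (use Suc_0_less in simp)
  then have w: "wp (While (Eq (V 34) (K 1)) dec_body) (\<lambda>t R' M' os'. 30 + t \<le> 300 * dec_runs ?v (c ?v) + 50 \<and>
      os' = os \<and> (\<forall>r<10. r \<noteq> 5 \<longrightarrow> R' r = R r) \<and>
      (if c ?v = 0 then R' 5 = 1 \<and> (\<exists>y. rep (c(?v := y)) R' M')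
       else R' 5 = 0 \<and> rep (c(?v := c ?v - 1)) R' M')) ?R M os"
    by (rule wp_mono) (auto simp: dec_inv_def)
  have "1 \<le> R 3" using v by simp
  then show ?thesis
    unfolding dec_field_def using Suc_0_less
    by simp (rule wp_mono[OF w[unfolded One_nat_def]], auto)
qed

section \<open>Exchange of the value of a field\<close>

definition xchg_inv :: "(nat \<Rightarrow> nat) \<Rightarrow> nat \<Rightarrow> nat \<Rightarrow> (nat \<Rightarrow> nat) \<Rightarrow> nat \<Rightarrow> (nat \<Rightarrow> nat) \<Rightarrow> (nat \<Rightarrow> nat) \<Rightarrow> bool" where
  "xchg_inv c v j R0 \<phi> R M \<longleftrightarrow> (\<forall>r<10. r \<noteq> 5 \<longrightarrow> R r = R0 r) \<and>
     (if R 34 = 1 then (\<exists>t<len v. R 32 = pos v t \<and> R 5 = take_bit t (c v) \<and> R 38 = j div 2 ^ t \<and>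
          R 39 = t \<and> rep (c(v := mix t j (c v))) R M \<and> 300 * (len v - t) \<le> \<phi>)
      else R 5 = c v \<and> rep (c(v := j)) R M)"

lemma xchg_body_correct:
  assumes I: "xchg_inv c v j R0 \<phi> R M" and go: "R 34 = 1" and v: "v \<in> verts G"
    and j: "j < 2 ^ len v" and c: "c v < 2 ^ len v"
  shows "wp xchg_body (\<lambda>t R' M' os'. os' = os \<and> (\<exists>\<phi>'. xchg_inv c v j R0 \<phi>' R' M' \<and> t + 10 + \<phi>' \<le> \<phi>)) R M os"
proof -
  obtain t where t: "t < len v" "R 32 = pos v t" "R 5 = take_bit t (c v)" "R 38 = j div 2 ^ t" "R 39 = t"
    "rep (c(v := mix t j (c v))) R M" "300 * (len v - t) \<le> \<phi>"
    and frame: "\<forall>r<10. r \<noteq> 5 \<longrightarrow> R r = R0 r"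
    using I go unfolding xchg_inv_def by auto
  let ?x = "c v" and ?y = "mix t j (c v)"
  let ?a = "CB + pos v t div q" and ?i = "pos v t mod q"
  define e where "e \<longleftrightarrow> bit j t = bit ?x t"
  define M' where "M' = (if e then M else M(?a := M ?a XOR 2 ^ ?i))"
  note fp = field_props[OF t(6) v t(1)] and i = offset_less[OF field_props(3)[OF t(6) v t(1)]]
  have \<phi>: "300 \<le> \<phi>"
    using t(1,7) by simp
  have bit: "bit (M ?a) ?i \<longleftrightarrow> bit ?x t"
    using fp(5) by (simp add: bit_mix)
  have "rep (c(v := mix (Suc t) j ?x)) R M'"
    using flip_field[OF t(6) v t(1)] t(6) unfolding M'_def e_def by (simp add: mix_Suc)
  then have rp: "rep (c(v := mix (Suc t) j ?x)) R' M'" if "\<And>r. 20 \<le> r \<Longrightarrow> r < 30 \<Longrightarrow> R' r = R r" for R'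
    by (rule rep_cong) (rule that)
  have tb: "t < b" "Suc t < 2 ^ b" "t < 2 ^ b"
    using t(1) len_le_b[OF v] b_less by linarith+
  have "(2::nat) ^ len v \<le> 2 ^ b"
    using len_le_b[OF v] by (intro power_increasing) auto
  then have "?x < 2 ^ b" using c by linarith
  then have "take_bit (Suc t) ?x < 2 ^ b"
    using take_bit_nat_less_eq_self[of "Suc t" ?x] by linarith
  then have x5: "take_bit t ?x + of_bool (bit ?x t) * 2 ^ t < 2 ^ b"
    and x5': "of_bool (bit ?x t) * 2 ^ t < (2::nat) ^ b"
    by (simp_all add: take_bit_Suc_from_most add.commute mult.commute)
  have e5: "take_bit t ?x + of_bool (bit ?x t) * 2 ^ t = take_bit (Suc t) ?x"
    by (simp add: take_bit_Suc_from_most add.commute mult.commute)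
  have e38: "j div 2 ^ t div 2 = j div 2 ^ Suc t"
    by (simp only: power_Suc2 div_mult2_eq)
  define Q where "Q = (\<lambda>t R' M' os'. os' = os \<and> (\<exists>\<phi>'. xchg_inv c v j R0 \<phi>' R' M' \<and> t + 10 + \<phi>' \<le> \<phi>))"
  define R1 where "R1 = R(35 := ?a, 36 := ?i, 37 := M ?a, 40 := of_bool (bit ?x t),
      5 := take_bit t ?x + of_bool (bit ?x t) * 2 ^ t, 38 := j div 2 ^ t div 2, 39 := Suc t)"
  have R1: "R1 5 = take_bit (Suc t) ?x" "R1 38 = j div 2 ^ Suc t" "R1 39 = Suc t" "R1 32 = pos v t"
    "R1 34 = 1" "R1 20 = q" "R1 36 = ?i" "R1 37 = M ?a" "\<forall>r<10. r \<noteq> 5 \<longrightarrow> R1 r = R0 r"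
    "\<And>r. 20 \<le> r \<Longrightarrow> r < 30 \<Longrightarrow> R1 r = R r"
    unfolding R1_def using go t(2) e5 e38 fp frame by auto
  let ?tail = "If (Eq (Op Mod (Op Shr (V 37) (Op Add (V 20) (V 36))) (K 2)) (K 1)) adv (34 ::= K 0)"
  have tail: "wp ?tail (\<lambda>k. Q (k + 60)) R1 M' os"
  proof (cases "Suc t < len v")
    case False
    then have l: "Suc t = len v" using t(1) by simp
    have "rep (c(v := j)) (R1(34 := 0)) M'"
      using rp[of "R1(34 := 0)"] R1(10) mix_all[OF j c] l by simp
    moreover have "take_bit (Suc t) ?x = ?x"
      using c l by (simp add: take_bit_nat_eq_self)
    ultimately have "xchg_inv c v j R0 0 (R1(34 := 0)) M'"
      using R1(1,9) unfolding xchg_inv_def by simp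
    then have "Q k (R1(34 := 0)) M' os" if "k \<le> 100" for k
      unfolding Q_def using that \<phi> by (intro conjI refl exI[of _ 0]) auto
    then show ?thesis
      using R1 fp i two_less Suc_0_less False by (simp add: mod_two_bit)
  next
    case True
    have sR: "sregs R1" and dM: "dir M'"
      using rp[of R1] R1(10) by (simp_all add: rep_def)
    have adv: "wp adv (\<lambda>t' R' M2 os'. t' \<le> 200 \<and> M2 = M' \<and> os' = os \<and>
          (\<exists>x y. R' = R1(30 := 0, 31 := x, 33 := y, 32 := nverts G + rank (pos v t)))) R1 M' os"
      by (rule adv_correct[OF sR dM]) (use R1(4) fp in simp_all)
    have Q80: "wp adv (\<lambda>k. Q (80 + k)) R1 M' os"
    proof (rule wp_mono[OF adv], elim conjE exE)
      fix t' :: nat and R' M2 os' x y'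
      assume a: "t' \<le> 200" "M2 = M'" "os' = os"
        "R' = R1(30 := 0, 31 := x, 33 := y', 32 := nverts G + rank (pos v t))"
      have "rep (c(v := mix (Suc t) j ?x)) R' M'"
        using rp[of R'] a(4) R1(10) by simp
      moreover have "R' 34 = 1" "R' 32 = pos v (Suc t)" "\<forall>r<10. r \<noteq> 5 \<longrightarrow> R' r = R0 r"
        "R' 5 = take_bit (Suc t) ?x" "R' 38 = j div 2 ^ Suc t" "R' 39 = Suc t"
        unfolding a(4) using R1 fp(7) by simp_all
      ultimately have "xchg_inv c v j R0 (300 * (len v - Suc t)) R' M'"
        unfolding xchg_inv_def using True by auto
      moreover have "300 * (len v - Suc t) + 300 \<le> \<phi>"
        using t(1,7) by simp
      ultimately show "Q (80 + t') R' M2 os'"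
        unfolding Q_def a(2,3) using a(1)
        by (intro conjI refl exI[of _ "300 * (len v - Suc t)"]) auto
    qed
    have Q_mono: "Q (80 + t') R' M' os' \<Longrightarrow> k \<le> 80 + t' \<Longrightarrow> Q k R' M' os'" for k t' R' M' os'
      unfolding Q_def by fastforce
    show ?thesis
      using R1 fp i two_less Suc_0_less True
      by (simp add: mod_two_bit) (rule wp_mono[OF Q80], erule Q_mono, simp)
  qed
  have Q_mono: "Q k R' M' os' \<Longrightarrow> l \<le> k \<Longrightarrow> Q l R' M' os'" for k l R' M' os'
    unfolding Q_def by fastforce
  have tail': "wp ?tail (\<lambda>k. Q (l + k)) R1 M' os" if "l \<le> 60" for l
    by (rule wp_mono[OF tail], erule Q_mono) (use that in simp)
  let ?pre = "35 ::= Op Add (V 21) (Op Div (V 32) (V 20));;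
     36 ::= Op Mod (V 32) (V 20);;
     37 ::= Mem (V 35);;
     40 ::= Op Mod (Op Shr (V 37) (V 36)) (K 2);;
     5 ::= Op Add (V 5) (Op Shl (V 40) (V 39));;
     If (Eq (V 40) (Op Mod (V 38) (K 2))) Skip
       (Put (V 35) (Op Xor (V 37) (Op Shl (K 1) (V 36))));;
     38 ::= Op Shr (V 38) (K 1);;
     39 ::= Op Add (V 39) (K 1)"
  have seq: "wp xchg_body Q R M os = wp ?pre (\<lambda>t. wp ?tail (\<lambda>t'. Q (t + t'))) R M os"
    unfolding xchg_body_def wp_Seq by (simp only: add.assoc)
  define P where "P = (\<lambda>l R' M' os'. wp ?tail (\<lambda>t'. Q (l + t')) R' M' os')"
  have P: "P l R1 M' os" if "l \<le> 60" for l
    unfolding P_def using tail'[OF that] .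
  have "wp ?pre P R M os"
  proof (cases e)
    case True
    then show ?thesis
      using P fp t i two_less Suc_0_less bit tb x5 x5' unfolding R1_def M'_def e_def
      by (simp add: mod_two_bit)
  next
    case False
    then show ?thesis
      using P fp t i two_less Suc_0_less bit tb x5 x5' unfolding R1_def M'_def e_def
      by (simp add: mod_two_bit)
  qed
  then show ?thesis
    using seq unfolding P_def Q_def by blast
qed

lemma xchg_field_correct:
  assumes r: "rep c R M" and v: "R 3 \<in> verts G" and j: "R 4 < 2 ^ len (R 3)"
  shows "wp xchg_field (\<lambda>t R' M' os'. t \<le> 300 * len (R 3) + 50 \<and> os' = os \<and>
      (\<forall>r<10. r \<noteq> 5 \<longrightarrow> R' r = R r) \<and> R' 5 = c (R 3) \<and> rep (c(R 3 := R 4)) R' M') R M os"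
proof -
  let ?v = "R 3" and ?R = "R(32 := R 3 - Suc 0, 34 := Suc 0, 5 := 0, 38 := R 4, 39 := 0)"
  let ?I = "\<lambda>\<phi> R' M' os'. os' = os \<and> xchg_inv c ?v (R 4) R \<phi> R' M'"
  have c: "c ?v < 2 ^ len ?v" using r v by (simp add: rep_def)
  have "rep c ?R M"
    by (rule rep_cong[OF r]) simp
  moreover have "0 < len ?v" by (rule len_pos[OF v])
  ultimately have init: "?I (300 * len ?v) ?R M os"
    unfolding xchg_inv_def using pos_0[OF v] by (auto intro!: exI[of _ 0] simp: mix_0)
  have "wp (While (Eq (V 34) (K 1)) xchg_body) (\<lambda>t R' M' os'. \<exists>\<phi>'. ?I \<phi>' R' M' os' \<and>
      \<not> bev G R' M' (Eq (V 34) (K 1)) \<and>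
      t + \<phi>' \<le> 300 * len ?v + bsize (Eq (V 34) (K 1)) + 1) ?R M os"
  proof (rule wp_While[where I = ?I, OF init])
    fix \<phi> R' M' os'
    assume I: "?I \<phi> R' M' os'" "bev G R' M' (Eq (V 34) (K 1))"
    then have "wp xchg_body (\<lambda>t R2 M2 os2. os2 = os' \<and>
        (\<exists>\<phi>'. xchg_inv c ?v (R 4) R \<phi>' R2 M2 \<and> t + 10 + \<phi>' \<le> \<phi>)) R' M' os'"
      using xchg_body_correct[where c = c and v = ?v and j = "R 4", OF _ _ v j c] by simp
    then show "wp xchg_body (\<lambda>t R' M' os'. \<exists>\<phi>'. ?I \<phi>' R' M' os' \<and>
        t + bsize (Eq (V 34) (K 1)) + 1 + \<phi>' \<le> \<phi>) R' M' os'"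
      by (rule wp_mono) (use I in auto)
  qed (use Suc_0_less in simp)
  then have w: "wp (While (Eq (V 34) (K 1)) xchg_body) (\<lambda>t R' M' os'. 30 + t \<le> 300 * len ?v + 50 \<and>
      os' = os \<and> (\<forall>r<10. r \<noteq> 5 \<longrightarrow> R' r = R r) \<and> R' 5 = c ?v \<and> rep (c(?v := R 4)) R' M') ?R M os"
    by (rule wp_mono) (auto simp: xchg_inv_def)
  have "1 \<le> R 3" using v by simp
  then show ?thesis
    unfolding xchg_field_def using Suc_0_less
    by simp (rule wp_mono[OF w[unfolded One_nat_def]], auto)
qed

text \<open>The total number of rounds while a counter runs down to its borrow at 0: that last
  decrement visits the whole field, and all the others are paid for by
  \<open>sum_tz\<close>.\<close>

lemma sum_dec_runs: "(\<Sum>x<d. dec_runs v x) \<le> len v + 2 * d"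
proof -
  have "(\<Sum>x<d. dec_runs v x) \<le> (\<Sum>x<d. (if x = 0 then len v else 0) + (1 + tz x))"
    by (intro sum_mono) (simp add: dec_runs_def)
  also have "\<dots> = (\<Sum>x<d. if x = 0 then len v else 0) + (d + (\<Sum>x<d. tz x))"
    by (simp only: sum.distrib) simp
  also have "(\<Sum>x<d. if x = 0 then len v else 0) \<le> len v"
    by (simp add: sum.delta)
  finally show ?thesis using sum_tz[of d] by linarith
qed

lemma dfs_succinct:
  assumes "acyclic (edges G)"
  shows "dfs G w b A dec_field xchg_field rep (\<lambda>v x. 300 * dec_runs v x + 50) 1000"
proof (unfold_locales)
  show "acyclic (edges G)" by fact
  show "rep c R' M" if "rep c R M" "\<forall>r\<ge>10. R' r = R r" for c R R' M
    by (rule rep_cong[OF that(1)]) (use that(2) in simp)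
  show "wp dec_field (\<lambda>t R' M' os'. t \<le> 300 * dec_runs (R 3) (c (R 3)) + 50 \<and> os' = os \<and>
      (\<forall>r<10. r \<noteq> 5 \<longrightarrow> R' r = R r) \<and>
      (if c (R 3) = 0 then R' 5 = 1 \<and> (\<exists>y. rep (c(R 3 := y)) R' M')
       else R' 5 = 0 \<and> rep (c(R 3 := c (R 3) - 1)) R' M')) R M os"
    if "rep c R M" "R 3 \<in> verts G" for c R M os
    by (rule dec_field_correct[OF that])
  show "wp xchg_field (\<lambda>t R' M' os'. t \<le> 1000 * idg (R 3) \<and> os' = os \<and>
      (\<forall>r<10. r \<noteq> 5 \<longrightarrow> R' r = R r) \<and> R' 5 = c (R 3) \<and> rep (c(R 3 := R 4)) R' M') R M os"
    if "rep c R M" "R 3 \<in> verts G" "R 4 < idg (R 3)" for c R M os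
  proof -
    have "R 4 < 2 ^ len (R 3)" "300 * len (R 3) + 50 \<le> 1000 * idg (R 3)"
      using len_bound[OF that(2)] len_le[OF that(2)] that(3) by linarith+
    then show ?thesis
      using wp_mono[OF xchg_field_correct[OF that(1,2)]] by fastforce
  qed
  show "(\<Sum>x<idg v. 300 * dec_runs v x + 50) \<le> 1000 * idg v" if "v \<in> verts G" for v
  proof (cases "idg v = 0")
    case False
    \<comment> \<open>Since \<open>len v \<le> idg v\<close>, the sum is at most
      \<open>300 * (3 * idg v) + 50 * idg v = 950 * idg v\<close>.\<close>
    have "(\<Sum>x<idg v. 300 * dec_runs v x + 50) = 300 * (\<Sum>x<idg v. dec_runs v x) + 50 * idg v"
      by (simp only: sum.distrib flip: sum_distrib_left) simp
    then show ?thesis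
      using sum_dec_runs[of v "idg v"] len_le[OF that] False by linarith
  qed simp
qed

end

section \<open>Parameters of the representation\<close>

lemma bitlen_self: "bitlen x \<le> x"
  by (rule bitlen_le) simp

text \<open>The threshold 64 makes \<open>b * b\<close> fit into \<open>b div 4\<close> bits:
  relative ranks then take at most a quarter of a cell, and even \<open>b * b * b\<close> is
  \<open>O(n)\<close>. Rounding is absorbed by comparing with
  \<open>4 * (b div 4) + 4\<close>.\<close>

lemma square_less_pow:
  assumes "64 \<le> b"
  shows "b * b < (2::nat) ^ (b div 4)"
proof -
  have *: "(4 * k + 4) * (4 * k + 4) < (2::nat) ^ k" if "16 \<le> k" for k :: nat
    using that
  proof (induction k rule: nat_induct_at_least)
    case (Suc k)
    have "(4 * Suc k + 4) * (4 * Suc k + 4) = (4 * k + 4) * (4 * k + 4) + (32 * k + 48)"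
      by (simp add: algebra_simps)
    moreover have "16 * 16 \<le> k * k"
      using Suc.hyps by (intro mult_mono) auto
    then have "32 * k + 48 \<le> (4 * k + 4) * (4 * k + 4)"
      by (simp add: algebra_simps)
    ultimately show ?case using Suc.IH by simp
  qed simp
  have "b \<le> 4 * (b div 4) + 4" by linarith
  then have "b * b \<le> (4 * (b div 4) + 4) * (4 * (b div 4) + 4)"
    by (intro mult_mono) auto
  then show ?thesis
    using *[of "b div 4"] assms by linarith
qed

locale big_machine = machine +
  assumes b_eq: "b = bitlen (nverts G + nedges G)" and b_ge: "64 \<le> b"
begin

text \<open>\<open>OR 1\<close> replaces 0 by 1 and keeps the bit length of every positive number,
  so each vertex has at least one bit, even if its indegree is 0 or 1.\<close>

definition len :: "nat \<Rightarrow> nat" where "len v = bitlen ((idg v - 1) OR 1)"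
text \<open>Relative ranks are at most \<open>b * q\<close>, hence they fit into \<open>rr\<close> bits.\<close>

definition rr :: nat where "rr = bitlen (b * b)"
text \<open>As many two-bit positions as a cell of \<open>b\<close> bits can hold beside the
  \<open>rr\<close> bits of a relative rank.\<close>

definition q :: nat where "q = (b - rr) div 2"
text \<open>Large enough for five chunks of \<open>h\<close> bits to cover \<open>q\<close> marks,
  and small enough for the table of \<open>2 ^ h\<close> cells to be negligible against
  \<open>n\<close>, which is at least half of \<open>2 ^ (b div 2)\<close>.\<close>

definition h :: nat where "h = b div 8"
definition N :: nat where "N = (\<Sum>v\<in>verts G. len v)"
definition SB :: nat where "SB = 2 ^ h + (b + 1)"
definition CB :: nat where "CB = SB + (N div (q * b) + 1)"
definition cells :: nat where "cells = CB + (N div q + 1)"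

lemma rr_le: "rr \<le> b div 4" and rr_less: "b * b < 2 ^ rr" and rr_pos: "0 < rr"
  unfolding rr_def using bitlen_le[OF square_less_pow[OF b_ge]] less_bitlen[of "b * b"]
    bitlen_rec[of "b * b"] b_ge by auto

lemma q_ge: "24 \<le> q" and two_q: "2 * q + rr \<le> b" and q_ge': "3 * b \<le> 8 * q + 8"
  unfolding q_def using rr_le b_ge by linarith+

lemma or_one_pos: "0 < x OR (1::nat)"
  by (metis gr0I or_eq_0_iff zero_neq_one)

lemma or_one_le: "x OR 1 \<le> x + (1::nat)" "x \<le> x OR 1"
  unfolding or_one_eq by (cases "even x"; simp)+

lemma len_pos': "0 < len v"
  unfolding len_def using bitlen_rec[OF or_one_pos] by simp

lemma len_idg: "0 < idg v \<Longrightarrow> len v \<le> idg v" "idg v = 0 \<Longrightarrow> len v = 1"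
proof -
  show "len v \<le> idg v" if "0 < idg v"
  proof -
    have "(idg v - 1) OR 1 \<le> idg v"
      using or_one_le(1)[of "idg v - 1"] that by linarith
    then show ?thesis
      unfolding len_def using bitlen_self[of "(idg v - 1) OR 1"] by linarith
  qed
  show "len v = 1" if "idg v = 0"
    using that by (simp add: len_def bitlen.simps)
qed

lemma idg_len: "idg v \<le> 2 ^ len v"
  unfolding len_def using less_bitlen[of "(idg v - 1) OR 1"] or_one_le(2)[of "idg v - 1"] by linarith

lemma N_le: "N \<le> nverts G + nedges G"
proof -
  have "len v \<le> idg v + 1" for v
    using len_idg[of v] by (cases "idg v = 0") auto
  then have "N \<le> (\<Sum>v\<in>verts G. idg v + 1)"
    unfolding N_def by (intro sum_mono) blast
  also have "\<dots> = nedges G + nverts G"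
    using sum_idg by (simp only: sum.distrib) simp
  finally show ?thesis by simp
qed

lemma N_less: "N < 2 ^ b"
  using N_le size_less by linarith

lemma len_le_b: "v \<in> verts G \<Longrightarrow> len v \<le> b"
proof -
  assume v: "v \<in> verts G"
  have "(idg v - 1) OR 1 < 2 ^ b"
    using in_arr_props(4)[OF v] nverts_less nverts_pos b_ge
    by (intro or_less_pow) (auto intro: order.strict_trans1)
  then show "len v \<le> b"
    unfolding len_def by (rule bitlen_le)
qed

lemma size_ge: "2 ^ (b - 1) \<le> nverts G + nedges G"
  unfolding b_eq using bitlen_ge nverts_pos by simp

lemma pow_h: "8 * 2 ^ h \<le> nverts G + nedges G" "8 * 2 ^ h \<le> (2::nat) ^ (b - 1)"
proof -
  have "(2::nat) ^ (3 + h) \<le> 2 ^ (b - 1)"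
    using b_ge unfolding h_def by (intro power_increasing) linarith+
  then show "8 * 2 ^ h \<le> (2::nat) ^ (b - 1)" by (simp add: power_add)
  then show "8 * 2 ^ h \<le> nverts G + nedges G" using size_ge by linarith
qed

lemma b_small: "8 * b \<le> 2 ^ (b - 1)"
proof -
  have "b * b < 2 ^ (b div 4)" by (rule square_less_pow[OF b_ge])
  moreover have "(2::nat) ^ (b div 4) \<le> 2 ^ (b - 1)"
    using b_ge by (intro power_increasing) linarith+
  moreover have "8 * b \<le> b * b" using b_ge by simp
  ultimately show ?thesis by linarith
qed

lemma two_pow: "(2::nat) ^ b = 2 * 2 ^ (b - 1)"
  using b_ge by (cases b) auto

lemma N_div: "N div q * 24 \<le> N" "N div (q * b) \<le> N div q"
proof -
  have "N div q * 24 \<le> N div q * q" using q_ge by (intro mult_mono) auto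
  then show "N div q * 24 \<le> N" by (metis div_times_less_eq_dividend order.trans)
  show "N div (q * b) \<le> N div q"
    using b_ge by (simp add: div_mult2_eq)
qed

lemma cells_le: "cells \<le> 2 ^ b"
proof -
  have "N div q * 24 \<le> 2 * 2 ^ (b - 1)" using N_div(1) N_less two_pow by linarith
  moreover have "64 \<le> (2::nat) ^ (b - 1)" using b_small b_ge by linarith
  ultimately show ?thesis
    unfolding cells_def CB_def SB_def two_pow
    using N_div(2) b_small pow_h(2) by linarith
qed

lemma qb_less: "q * b < 2 ^ b"
proof -
  have "q * b \<le> b * b" using two_q by (intro mult_mono) auto
  also have "b * b < 2 ^ (b div 4)" by (rule square_less_pow[OF b_ge])
  also have "(2::nat) ^ (b div 4) \<le> 2 ^ b" by (intro power_increasing) auto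
  finally show ?thesis .
qed

lemma bb_less: "b * b < 2 ^ b"
proof -
  have "b * b < 2 ^ (b div 4)" by (rule square_less_pow[OF b_ge])
  also have "(2::nat) ^ (b div 4) \<le> 2 ^ b" by (intro power_increasing) auto
  finally show ?thesis .
qed

sublocale tiers "nverts G" len
  by unfold_locales (rule len_pos')

lemma start_N: "tier_start b = N"
  unfolding N_def by (rule tier_start_total) (rule len_le_b)

lemma start_le_N: "tier_start t \<le> N"
proof (cases "t \<le> b")
  case True
  then show ?thesis using tier_start_mono start_N by metis
next
  case False
  have "tier_start t = (\<Sum>v\<in>verts G. len v)"
    using False len_le_b by (intro tier_start_total) (metis dual_order.trans linear)
  then show ?thesis by (simp add: N_def)
qed

end

text \<open>\<open>cells\<close> depends only on \<open>G\<close> and \<open>b\<close>; it is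
  defined in the parent locale so that the memory bound \<open>A\<close> can be identified with it
  afterwards.\<close>

locale big_setup = big_machine +
  assumes A_eq: "A = cells"
begin

sublocale succinct G w b A len q b h SB CB N
proof unfold_locales
  show "2 * q < b" using two_q rr_pos by linarith
  show "0 < q" using q_ge by linarith
  show "q \<le> 5 * h" unfolding h_def using two_q rr_pos b_ge by linarith
  show "0 < h" "h < b" unfolding h_def using b_ge by linarith+
  show "0 < b" using b_ge by linarith
  show "2 ^ h \<le> SB" by (simp add: SB_def)
  show "SB + N div (q * b) < CB" by (simp add: CB_def)
  show "CB + N div q < A" by (simp add: A_eq cells_def)
  show "A \<le> 2 ^ b" using cells_le by (simp add: A_eq)
qed (use idg_len len_idg(1) len_le_b start_le_N N_less in auto)

end

section \<open>Construction of the representation\<close>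

text \<open>Only \<open>n\<close> can be read off the input directly; \<open>n + m\<close>, whose
  bit length is \<open>b\<close>, is obtained by summing the indegrees.\<close>

definition sum_degrees :: com where
  "sum_degrees = (11 ::= NV;; 10 ::= K 0;; While (Lt (V 10) NV)
     (10 ::= Op Add (V 10) (K 1);; 11 ::= Op Add (V 11) (InDeg (V 10))))"

definition count_bits :: "nat \<Rightarrow> com" where
  "count_bits r = While (Lt (K 0) (V 15)) (15 ::= Op Shr (V 15) (K 1);; r ::= Op Add (V r) (K 1))"

definition parameters :: com where
  "parameters = (sum_degrees;; 12 ::= K 0;; 15 ::= V 11;; count_bits 12;;
     13 ::= K 0;; 15 ::= Op Mul (V 12) (V 12);; count_bits 13;;
     20 ::= Op Div (Op Sub (V 12) (V 13)) (K 2);; 24 ::= Op Div (V 12) (K 8);;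
     25 ::= Op Shl (K 1) (V 24))"

definition popcount_table :: com where
  "popcount_table = (10 ::= K 1;; While (Lt (V 10) (V 25))
     (Put (V 10) (Op Add (Mem (Op Div (V 10) (K 2))) (Op Mod (V 10) (K 2)));;
      10 ::= Op Add (V 10) (K 1)))"

text \<open>The case distinction realizes truncated subtraction at indegree 0, where
  \<open>op_ok\<close> does not permit \<open>0 - 1\<close>.\<close>

definition load_field :: com where
  "load_field = (If (Lt (K 0) (InDeg (V 10))) (17 ::= Op Sub (InDeg (V 10)) (K 1)) (17 ::= K 0);;
     18 ::= Op Or (V 17) (K 1);; 16 ::= K 0)"

definition count_body :: com where
  "count_body = (Put (Op Add (V 25) (Op Add (V 16) (K 1)))
       (Op Add (Mem (Op Add (V 25) (Op Add (V 16) (K 1)))) (K 1));;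
     18 ::= Op Shr (V 18) (K 1);; 16 ::= Op Add (V 16) (K 1))"

definition count_tiers :: com where
  "count_tiers = (10 ::= K 0;; While (Lt (V 10) NV)
     (10 ::= Op Add (V 10) (K 1);; load_field;; While (Lt (K 0) (V 18)) count_body))"

definition sum_tiers :: com where
  "sum_tiers = (16 ::= K 0;; While (Lt (V 16) (V 12))
     (Put (Op Add (V 25) (Op Add (V 16) (K 1)))
       (Op Add (Mem (Op Add (V 25) (Op Add (V 16) (K 1)))) (Mem (Op Add (V 25) (V 16))));;
      16 ::= Op Add (V 16) (K 1)))"

definition addresses :: com where
  "addresses = (14 ::= Mem (Op Add (V 25) (V 12));; 23 ::= Op Mul (V 20) (V 12);;
     22 ::= Op Add (V 25) (Op Add (V 12) (K 1));;
     21 ::= Op Add (V 22) (Op Add (Op Div (V 14) (V 23)) (K 1)))"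

context big_setup
begin

lemma num_less: "2 < (2::nat) ^ b" "8 < (2::nat) ^ b" "Suc 0 < 2 ^ b" "b < 2 ^ b" "b + 1 < 2 ^ b"
proof -
  have *: "8 * b < 2 ^ b"
    using b_small two_pow b_ge by linarith
  then show "2 < (2::nat) ^ b" "8 < (2::nat) ^ b" "Suc 0 < 2 ^ b" "b < 2 ^ b" "b + 1 < 2 ^ b"
    using b_ge by linarith+
qed

lemma sum_degrees_correct:
  "wp sum_degrees (\<lambda>t R' M' os'. t \<le> 30 * nverts G + 20 \<and> M' = M \<and> os' = os \<and>
     R' 11 = nverts G + nedges G) R M os"
proof -
  let ?I = "\<lambda>\<phi> (R' :: nat \<Rightarrow> nat) (M' :: nat \<Rightarrow> nat) (os' :: nat list). M' = M \<and> os' = os \<and> (\<exists>k\<le>nverts G. R' 10 = k \<and>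
     R' 11 = nverts G + (\<Sum>v\<in>{1..k}. idg v) \<and> 20 * (nverts G - k) \<le> \<phi>)"
  have "wp (While (Lt (V 10) NV) (10 ::= Op Add (V 10) (K 1);; 11 ::= Op Add (V 11) (InDeg (V 10))))
    (\<lambda>t R' M' os'. \<exists>\<phi>'. ?I \<phi>' R' M' os' \<and> \<not> bev G R' M' (Lt (V 10) NV) \<and>
      t + \<phi>' \<le> 20 * nverts G + bsize (Lt (V 10) NV) + 1) (R(11 := nverts G, 10 := 0)) M os"
  proof (rule wp_While[where I = ?I])
    fix \<phi> :: nat and R' M' :: "nat \<Rightarrow> nat" and os' :: "nat list"
    assume "?I \<phi> R' M' os'" and c: "bev G R' M' (Lt (V 10) NV)"
    then obtain k where I: "M' = M" "os' = os" "R' 10 = k" "k < nverts G"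
      "R' 11 = nverts G + (\<Sum>v\<in>{1..k}. idg v)" "20 * (nverts G - k) \<le> \<phi>"
      by auto
    define Q where "Q = (\<lambda>t R' M' os'. \<exists>\<phi>'. ?I \<phi>' R' M' os' \<and> t + bsize (Lt (V 10) NV) + 1 + \<phi>' \<le> \<phi>)"
    have sum: "(\<Sum>v\<in>{1..Suc k}. idg v) = (\<Sum>v\<in>{1..k}. idg v) + idg (Suc k)"
      by simp
    have "nverts G + (\<Sum>v\<in>{1..Suc k}. idg v) \<le> nverts G + (\<Sum>v\<in>verts G. idg v)"
      using I(4) by (intro add_left_mono sum_mono2) auto
    then have less: "nverts G + sum idg {Suc 0..k} + idg (Suc k) < 2 ^ b"
      using sum sum_idg size_less by simp
    have "?I (20 * (nverts G - Suc k)) (R'(10 := Suc k, 11 := nverts G + sum idg {Suc 0..k} + idg (Suc k))) M os"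
      using I(4) by auto
    then have Q: "Q t (R'(10 := Suc k, 11 := nverts G + sum idg {Suc 0..k} + idg (Suc k))) M os" if "t \<le> 14" for t
      unfolding Q_def using that I(4,6)
      by (intro exI[of _ "20 * (nverts G - Suc k)"]) (rule conjI, assumption, simp)
    have "Suc k < 2 ^ b" using I(4) nverts_less by linarith
    then have "wp (10 ::= Op Add (V 10) (K 1);; 11 ::= Op Add (V 11) (InDeg (V 10))) Q R' M' os'"
      using I num_less less Q by simp
    then show "wp (10 ::= Op Add (V 10) (K 1);; 11 ::= Op Add (V 11) (InDeg (V 10)))
       (\<lambda>t R' M' os'. \<exists>\<phi>'. ?I \<phi>' R' M' os' \<and> t + bsize (Lt (V 10) NV) + 1 + \<phi>' \<le> \<phi>) R' M' os'"
      unfolding Q_def .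
  qed (use nverts_less in auto)
  then have w: "wp (While (Lt (V 10) NV) (10 ::= Op Add (V 10) (K 1);; 11 ::= Op Add (V 11) (InDeg (V 10))))
    (\<lambda>t R' M' os'. t + 10 \<le> 30 * nverts G + 20 \<and> M' = M \<and> os' = os \<and> R' 11 = nverts G + nedges G)
    (R(11 := nverts G, 10 := 0)) M os"
    by (rule wp_mono) (use sum_idg in auto)
  show ?thesis
    unfolding sum_degrees_def using num_less
    by simp (rule wp_mono[OF w[unfolded One_nat_def]], auto)
qed

lemma count_bits_correct:
  assumes r: "r < 100" "r \<noteq> 15" and less: "R r + bitlen (R 15) < 2 ^ b"
  shows "wp (count_bits r) (\<lambda>t R' M' os'. t \<le> 20 * bitlen (R 15) + 20 \<and> M' = M \<and> os' = os \<and>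
     R' r = R r + bitlen (R 15) \<and> (\<forall>s. s \<noteq> r \<longrightarrow> s \<noteq> 15 \<longrightarrow> R' s = R s)) R M os"
proof -
  let ?I = "\<lambda>\<phi> (R' :: nat \<Rightarrow> nat) (M' :: nat \<Rightarrow> nat) (os' :: nat list). M' = M \<and> os' = os \<and> (\<forall>s. s \<noteq> r \<longrightarrow> s \<noteq> 15 \<longrightarrow> R' s = R s) \<and>
     R' r + bitlen (R' 15) = R r + bitlen (R 15) \<and> 20 * bitlen (R' 15) \<le> \<phi>"
  have "wp (count_bits r)
    (\<lambda>t R' M' os'. \<exists>\<phi>'. ?I \<phi>' R' M' os' \<and> \<not> bev G R' M' (Lt (K 0) (V 15)) \<and>
      t + \<phi>' \<le> 20 * bitlen (R 15) + bsize (Lt (K 0) (V 15)) + 1) R M os"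
    unfolding count_bits_def
  proof (rule wp_While[where I = ?I])
    fix \<phi> :: nat and R' M' :: "nat \<Rightarrow> nat" and os' :: "nat list"
    assume I: "?I \<phi> R' M' os'" and c: "bev G R' M' (Lt (K 0) (V 15))"
    define Q where "Q = (\<lambda>t R' M' os'. \<exists>\<phi>'. ?I \<phi>' R' M' os' \<and> t + bsize (Lt (K 0) (V 15)) + 1 + \<phi>' \<le> \<phi>)"
    have x: "bitlen (R' 15) = Suc (bitlen (R' 15 div 2))"
      using c by (intro bitlen_rec) simp
    then have "?I (20 * bitlen (R' 15 div 2)) (R'(15 := R' 15 div 2, r := Suc (R' r))) M os"
      using I r by auto
    then have Q: "Q t (R'(15 := R' 15 div 2, r := Suc (R' r))) M os" if "t \<le> 14" for t
      unfolding Q_def using that x I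
      by (intro exI[of _ "20 * bitlen (R' 15 div 2)"]) (rule conjI, assumption, simp)
    have "Suc (R' r) < 2 ^ b" using I x less by linarith
    then have "wp (15 ::= Op Shr (V 15) (K 1);; r ::= Op Add (V r) (K 1)) Q R' M' os'"
      using I num_less Q r by simp
    then show "wp (15 ::= Op Shr (V 15) (K 1);; r ::= Op Add (V r) (K 1))
      (\<lambda>t R' M' os'. \<exists>\<phi>'. ?I \<phi>' R' M' os' \<and> t + bsize (Lt (K 0) (V 15)) + 1 + \<phi>' \<le> \<phi>) R' M' os'"
      unfolding Q_def .
  qed auto
  then show ?thesis
    by (rule wp_mono) auto
qed

definition base_regs :: "(nat \<Rightarrow> nat) \<Rightarrow> bool" where
  "base_regs R \<longleftrightarrow> R 12 = b \<and> R 20 = q \<and> R 24 = h \<and> R 25 = 2 ^ h"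

lemma parameters_correct:
  "wp parameters (\<lambda>t R' M' os'. t \<le> 30 * nverts G + 40 * b + 200 \<and> M' = M \<and> os' = os \<and> base_regs R') R M os"
proof -
  define P where "P = (\<lambda>t R' M' os'. t \<le> 30 * nverts G + 40 * b + 200 \<and> M' = M \<and> os' = os \<and> base_regs R')"
  have rrb: "rr \<le> b" using rr_le b_ge by linarith
  have P_mono: "P l R' M' os' \<Longrightarrow> k \<le> l \<Longrightarrow> P k R' M' os'" for k l R' M' os'
    unfolding P_def by auto
  have 1: "wp (20 ::= Op Div (Op Sub (V 12) (V 13)) (K 2);; 24 ::= Op Div (V 12) (K 8);;
     25 ::= Op Shl (K 1) (V 24)) (\<lambda>t. P (k + t)) R' M os"
    if "R' 12 = b" "R' 13 = rr" "k \<le> 30 * nverts G + 40 * b + 100" for R' k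
  proof -
    have "(2::nat) ^ (b div 8) < 2 ^ b"
      using b_ge by (intro power_strict_increasing) auto
    then show ?thesis
      using that num_less rrb unfolding P_def base_regs_def q_def h_def by simp
  qed
  have 2: "wp (count_bits 13;; 20 ::= Op Div (Op Sub (V 12) (V 13)) (K 2);; 24 ::= Op Div (V 12) (K 8);;
     25 ::= Op Shl (K 1) (V 24)) (\<lambda>t. P (k + t)) R' M os"
    if R': "R' 12 = b" "R' 13 = 0" "R' 15 = b * b" and k: "k \<le> 30 * nverts G + 20 * b + 80" for R' k
  proof -
    have "R' 13 + bitlen (R' 15) = rr"
      using R' by (simp add: rr_def)
    then have bd: "R' 13 + bitlen (R' 15) < 2 ^ b"
      using rrb num_less(4) by linarith
    show ?thesis
      unfolding wp_Seq[of "count_bits 13"]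
    proof (rule wp_mono[OF count_bits_correct[OF _ _ bd]], simp, simp, elim conjE)
      fix t :: nat and R2 M2 :: "nat \<Rightarrow> nat" and os2 :: "nat list"
      assume a: "t \<le> 20 * bitlen (R' 15) + 20" "M2 = M" "os2 = os" "R2 13 = R' 13 + bitlen (R' 15)"
        "\<forall>s. s \<noteq> 13 \<longrightarrow> s \<noteq> 15 \<longrightarrow> R2 s = R' s"
      have "bitlen (R' 15) = rr" using R' by (simp add: rr_def)
      then have "wp (20 ::= Op Div (Op Sub (V 12) (V 13)) (K 2);; 24 ::= Op Div (V 12) (K 8);;
         25 ::= Op Shl (K 1) (V 24)) (\<lambda>t'. P (k + t + t')) R2 M os"
        using a k R' rrb by (intro 1) simp_all
      then show "wp (20 ::= Op Div (Op Sub (V 12) (V 13)) (K 2);; 24 ::= Op Div (V 12) (K 8);;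
         25 ::= Op Shl (K 1) (V 24)) (\<lambda>t'. P (k + (t + t'))) R2 M2 os2"
        using a(2,3) by (simp only: add.assoc)
    qed
  qed
  let ?c3 = "13 ::= K 0;; 15 ::= Op Mul (V 12) (V 12);; count_bits 13;;
     20 ::= Op Div (Op Sub (V 12) (V 13)) (K 2);; 24 ::= Op Div (V 12) (K 8);;
     25 ::= Op Shl (K 1) (V 24)"
  have 3: "wp (count_bits 12;; ?c3) (\<lambda>t. P (k + t)) R' M os"
    if R': "R' 12 = 0" "R' 15 = nverts G + nedges G" and k: "k \<le> 30 * nverts G + 40" for R' k
  proof -
    have bl: "bitlen (R' 15) = b" using R' b_eq by simp
    have bd: "R' 12 + bitlen (R' 15) < 2 ^ b"
      using R' num_less(4) bl by simp
    show ?thesis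
      unfolding wp_Seq[of "count_bits 12"]
    proof (rule wp_mono[OF count_bits_correct[OF _ _ bd]], simp, simp, elim conjE)
      fix t :: nat and R2 M2 :: "nat \<Rightarrow> nat" and os2 :: "nat list"
      assume a: "t \<le> 20 * bitlen (R' 15) + 20" "M2 = M" "os2 = os" "R2 12 = R' 12 + bitlen (R' 15)"
      have R2: "R2 12 = b" using a(4) R' bl by simp
      have F: "wp (count_bits 13;; 20 ::= Op Div (Op Sub (V 12) (V 13)) (K 2);; 24 ::= Op Div (V 12) (K 8);;
         25 ::= Op Shl (K 1) (V 24)) (\<lambda>t'. P (k + t + 6 + t')) (R2(13 := 0, 15 := b * b)) M os"
        using a(1) bl k R2 by (intro 2) simp_all
      show "wp ?c3 (\<lambda>t'. P (k + (t + t'))) R2 M2 os2"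
        unfolding wp_Seq[of "13 ::= _"] wp_Seq[of "15 ::= _"] wp_Assign
        using R2 bb_less num_less a(2,3)
        by (simp del: wp_Seq wp_Assign) (rule wp_mono[OF F[unfolded One_nat_def]], erule P_mono, simp)
    qed
  qed
  have "wp parameters P R M os"
    unfolding parameters_def wp_Seq[of sum_degrees]
  proof (rule wp_mono[OF sum_degrees_correct], elim conjE)
    fix t :: nat and R' M' :: "nat \<Rightarrow> nat" and os' :: "nat list"
    assume a: "t \<le> 30 * nverts G + 20" "M' = M" "os' = os" "R' 11 = nverts G + nedges G"
    have F: "wp (count_bits 12;; ?c3) (\<lambda>t'. P (t + 4 + t')) (R'(12 := 0, 15 := nverts G + nedges G)) M os"
      by (rule 3) (use a(1) in simp_all)
    show "wp (12 ::= K 0;; 15 ::= V 11;; count_bits 12;; ?c3) (\<lambda>t'. P (t + t')) R' M' os'"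
      unfolding wp_Seq[of "12 ::= _"] wp_Seq[of "15 ::= V 11"] wp_Assign
      using a(2-4) num_less
      by (simp del: wp_Seq wp_Assign) (rule wp_mono[OF F[unfolded One_nat_def]], erule P_mono, simp)
  qed
  then show ?thesis unfolding P_def .
qed

lemma layout_less: "2 ^ h + b < SB" "SB < CB" "CB < A" "A \<le> 2 ^ b"
  using layout by (simp_all add: SB_def)

text \<open>
  The \<open>b + 1\<close> cells behind the table serve as counters: first of the sizes of the tiers, then of their
  starts, and finally of the next position to be filled in each tier.
\<close>

definition mem_tiers :: "(nat \<Rightarrow> nat) \<Rightarrow> nat \<Rightarrow> nat" where
  "mem_tiers f a = (if a < 2 ^ h then popcount a else if a \<le> 2 ^ h + b then f (a - 2 ^ h) else 0)"

lemma mem_tiers_upd: "s \<le> b \<Longrightarrow> (mem_tiers f)(2 ^ h + s := x) = mem_tiers (f(s := x))"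
  by (auto simp: mem_tiers_def fun_eq_iff)

lemma mem_tiers_at: "s \<le> b \<Longrightarrow> mem_tiers f (2 ^ h + s) = f s"
  by (simp add: mem_tiers_def)

lemma popcount_table_correct:
  assumes R: "base_regs R"
  shows "wp popcount_table (\<lambda>t R' M' os'. t \<le> 30 * 2 ^ h + 20 \<and> M' = mem_tiers (\<lambda>_. 0) \<and> os' = os \<and>
    base_regs R') R (\<lambda>_. 0) os"
proof -
  let ?I = "\<lambda>\<phi> (R' :: nat \<Rightarrow> nat) (M' :: nat \<Rightarrow> nat) (os' :: nat list). M' = (\<lambda>a. if a < R' 10 then popcount a else 0) \<and> os' = os \<and> base_regs R' \<and>
     1 \<le> R' 10 \<and> R' 10 \<le> 2 ^ h \<and> 30 * (2 ^ h - R' 10) \<le> \<phi>"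
  let ?body = "Put (V 10) (Op Add (Mem (Op Div (V 10) (K 2))) (Op Mod (V 10) (K 2)));;
      10 ::= Op Add (V 10) (K 1)"
  have "wp (While (Lt (V 10) (V 25)) ?body)
    (\<lambda>t R' M' os'. \<exists>\<phi>'. ?I \<phi>' R' M' os' \<and> \<not> bev G R' M' (Lt (V 10) (V 25)) \<and>
      t + \<phi>' \<le> 30 * 2 ^ h + bsize (Lt (V 10) (V 25)) + 1) (R(10 := 1)) (\<lambda>_. 0) os"
  proof (rule wp_While[where I = ?I])
    fix \<phi> :: nat and R' M' :: "nat \<Rightarrow> nat" and os' :: "nat list"
    assume I: "?I \<phi> R' M' os'" and c: "bev G R' M' (Lt (V 10) (V 25))"
    define Q where "Q = (\<lambda>t R' M' os'. \<exists>\<phi>'. ?I \<phi>' R' M' os' \<and> t + bsize (Lt (V 10) (V 25)) + 1 + \<phi>' \<le> \<phi>)"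
    let ?x = "R' 10" and ?R = "R'(10 := Suc (R' 10))"
    let ?M = "M'(R' 10 := popcount (R' 10))"
    have R': "R' 25 = 2 ^ h" using I by (simp add: base_regs_def)
    have x: "?x < 2 ^ h" using c R' by simp
    have "?M = (\<lambda>a. if a < Suc (R' 10) then popcount a else 0)"
      using I by (auto simp: fun_eq_iff less_Suc_eq)
    then have "?I (30 * (2 ^ h - Suc ?x)) ?R ?M os"
      using I x by (simp add: base_regs_def)
    moreover have le: "30 * (2 ^ h - Suc ?x) + 30 \<le> \<phi>"
      using I Suc_diff_Suc[OF x] by linarith
    ultimately have Q: "Q t ?R ?M os" if "t \<le> 20" for t
      unfolding Q_def using that
      by (intro exI[of _ "30 * (2 ^ h - Suc ?x)"]) (rule conjI, assumption, simp)
    have "?x div 2 < ?x" using I by simp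
    then have M: "M' (?x div 2) = popcount (?x div 2)" using I by simp
    have pc: "popcount (?x div 2) + ?x mod 2 = popcount ?x"
      using popcount_rec[of ?x] by simp
    have "(2::nat) ^ h < 2 ^ b" "h < 2 ^ h" using pow_less[OF h(2)] by auto
    moreover have "popcount ?x \<le> h" by (rule popcount_le[OF x])
    moreover have "?x < A" "?x div 2 < A" using x layout_less \<open>?x div 2 < ?x\<close> by linarith+
    ultimately have bd: "popcount ?x < 2 ^ b" "?x < A" "?x div 2 < A" "Suc ?x < 2 ^ b"
      using x by linarith+
    have os: "os' = os" using I by blast
    have "wp ?body Q R' M' os'"
      unfolding os using bd num_less Q R' by (simp add: M pc)
    then show "wp ?body (\<lambda>t R' M' os'. \<exists>\<phi>'. ?I \<phi>' R' M' os' \<and> t + bsize (Lt (V 10) (V 25)) + 1 + \<phi>' \<le> \<phi>) R' M' os'"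
      unfolding Q_def .
  qed (use R in \<open>auto simp: base_regs_def\<close>)
  then have w: "wp (While (Lt (V 10) (V 25)) ?body)
    (\<lambda>t R' M' os'. t + 10 \<le> 30 * 2 ^ h + 20 \<and> M' = mem_tiers (\<lambda>_. 0) \<and> os' = os \<and> base_regs R')
    (R(10 := 1)) (\<lambda>_. 0) os"
    by (rule wp_mono) (auto simp: base_regs_def mem_tiers_def fun_eq_iff)
  show ?thesis
    unfolding popcount_table_def using num_less
    by simp (rule wp_mono[OF w[unfolded One_nat_def]], auto)
qed

lemma load_field_correct:
  assumes v: "R 10 \<in> verts G"
    and Q: "\<And>k. k \<le> 20 \<Longrightarrow> Q k (R(17 := idg (R 10) - 1, 18 := (idg (R 10) - 1) OR 1, 16 := 0)) M os"
  shows "wp load_field Q R M os"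
proof (cases "in_arr G (R 10) = []")
  case True
  have "R(17 := 0, 18 := Suc 0, 16 := 0) = R(17 := idg (R 10) - 1, 18 := (idg (R 10) - 1) OR 1, 16 := 0)"
    using True by (simp add: fun_eq_iff)
  then show ?thesis
    unfolding load_field_def using v Q[unfolded One_nat_def] num_less True by simp
next
  case False
  then have "Suc 0 \<le> idg (R 10)" by (simp add: Suc_le_eq)
  then show ?thesis
    unfolding load_field_def using v Q[unfolded One_nat_def] num_less False by simp
qed

text \<open>
  The part of tier \<open>s\<close> that has been treated when the fields of all vertices below \<open>v\<close> and the first \<open>t\<close>
  bits of the field of \<open>v\<close> are done.
\<close>

definition cset :: "nat \<Rightarrow> nat \<Rightarrow> nat \<Rightarrow> nat set" where
  "cset v t s = {u \<in> tier s. u < v \<or> (u = v \<and> s < t)}"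

lemma cset_finite [simp]: "finite (cset v t s)"
  by (rule finite_subset[of _ "tier s"]) (auto simp: cset_def)

lemma cset_Suc: "v \<in> tier t \<Longrightarrow> cset v (Suc t) s = (if s = t then insert v (cset v t s) else cset v t s)"
  by (auto simp: cset_def less_Suc_eq)

lemma cset_self: "v \<notin> cset v t t" "cset v t t = {u \<in> tier t. u < v}"
  by (auto simp: cset_def)

lemma cset_len: "cset v (len v) s = cset (Suc v) 0 s"
  by (auto simp: cset_def tier_def less_Suc_eq)

lemma cset_all: "cset (Suc (nverts G)) 0 s = tier s"
  by (auto simp: cset_def tier_def)

lemma cset_1: "cset (Suc 0) 0 s = {}"
  by (auto simp: cset_def tier_def)

text \<open>Counter \<open>s\<close> holds the size of tier \<open>s - 1\<close>. Owing to this
  shift, prefix sums computed in place leave \<open>tier_start s\<close> in counter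
  \<open>s\<close>.\<close>

definition counts :: "nat \<Rightarrow> nat \<Rightarrow> nat \<Rightarrow> nat" where
  "counts v t s = (if s = 0 then 0 else card (cset v t (s - 1)))"

lemma counts_Suc: "v \<in> tier t \<Longrightarrow> counts v (Suc t) = (counts v t)(Suc t := Suc (counts v t (Suc t)))"
  using cset_self(1)[of v t] by (auto simp: counts_def cset_Suc fun_eq_iff)

lemma counts_le: "counts v t s \<le> nverts G"
proof -
  have "card (cset v t (s - 1)) \<le> card (verts G)"
    by (rule card_mono) (auto simp: cset_def tier_def)
  then show ?thesis by (simp add: counts_def)
qed

lemma count_loop:
  assumes R: "base_regs R" "R 10 = v" "R 16 = 0" "R 18 = (idg v - 1) OR 1" and v: "v \<in> verts G"
  shows "wp (While (Lt (K 0) (V 18)) count_body) (\<lambda>t R' M' os'. t \<le> 30 * len v + 10 \<and>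
    M' = mem_tiers (counts (Suc v) 0) \<and> os' = os \<and> base_regs R' \<and> R' 10 = v) R (mem_tiers (counts v 0)) os"
proof -
  let ?I = "\<lambda>\<phi> (R' :: nat \<Rightarrow> nat) (M' :: nat \<Rightarrow> nat) (os' :: nat list). os' = os \<and> base_regs R' \<and> R' 10 = v \<and>
     (\<exists>t\<le>len v. R' 16 = t \<and> R' 18 = R 18 div 2 ^ t \<and> M' = mem_tiers (counts v t) \<and> 30 * (len v - t) \<le> \<phi>)"
  have len: "0 < R 18 div 2 ^ t \<longleftrightarrow> t < len v" for t
    using bitlen_less_iff[of t "R 18"] R(4) by (simp add: len_def)
  have "wp (While (Lt (K 0) (V 18)) count_body)
    (\<lambda>t R' M' os'. \<exists>\<phi>'. ?I \<phi>' R' M' os' \<and> \<not> bev G R' M' (Lt (K 0) (V 18)) \<and>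
      t + \<phi>' \<le> 30 * len v + bsize (Lt (K 0) (V 18)) + 1) R (mem_tiers (counts v 0)) os"
  proof (rule wp_While[where I = ?I])
    fix \<phi> :: nat and R' M' :: "nat \<Rightarrow> nat" and os' :: "nat list"
    assume "?I \<phi> R' M' os'" and c: "bev G R' M' (Lt (K 0) (V 18))"
    then obtain t where I: "os' = os" "base_regs R'" "R' 10 = v" "R' 16 = t" "R' 18 = R 18 div 2 ^ t"
      "M' = mem_tiers (counts v t)" "30 * (len v - t) \<le> \<phi>" "0 < R 18 div 2 ^ t"
      by auto
    have t: "t < len v" using I(8) len by blast
    then have vt: "v \<in> tier t" using v by (simp add: tier_def)
    have tb: "Suc t \<le> b" using t len_le_b[OF v] by linarith
    define Q where "Q = (\<lambda>t R' M' os'. \<exists>\<phi>'. ?I \<phi>' R' M' os' \<and> t + bsize (Lt (K 0) (V 18)) + 1 + \<phi>' \<le> \<phi>)"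
    let ?R = "R'(18 := R 18 div 2 ^ t div 2, 16 := Suc t)"
    let ?M = "(mem_tiers (counts v t))(2 ^ h + Suc t := Suc (counts v t (Suc t)))"
    have "R 18 div 2 ^ t div 2 = R 18 div 2 ^ Suc t"
      by (simp only: power_Suc2 div_mult2_eq)
    then have "?I (30 * (len v - Suc t)) ?R ?M os"
      using I(2,3) t mem_tiers_upd[OF tb] counts_Suc[OF vt] by (auto simp: base_regs_def)
    then have Q: "Q k ?R ?M os" if "k \<le> 25" for k
      unfolding Q_def using that I(7) t
      by (intro exI[of _ "30 * (len v - Suc t)"]) (rule conjI, assumption, simp)
    have Mt: "mem_tiers (counts v t) (2 ^ h + Suc t) = counts v t (Suc t)"
      by (rule mem_tiers_at[OF tb])
    have "2 ^ h + Suc t < A" using tb layout_less by linarith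
    moreover from this have "2 ^ h + Suc t < 2 ^ b" "Suc t < 2 ^ b" using layout_less by linarith+
    moreover have "Suc (counts v (Suc t) 0 + nverts G) \<le> 2 ^ b"
      using nverts_less by (simp add: counts_def)
    moreover have "Suc (counts v t (Suc t)) < 2 ^ b"
    proof -
      have "Suc (counts v t (Suc t)) = counts v (Suc t) (Suc t)"
        using counts_Suc[OF vt] by simp
      also have "\<dots> \<le> nverts G" by (rule counts_le)
      finally show ?thesis using nverts_less by linarith
    qed
    ultimately have "wp count_body Q R' M' os'"
      unfolding count_body_def using I num_less Q Mt by (simp add: base_regs_def)
    then show "wp count_body (\<lambda>t R' M' os'. \<exists>\<phi>'. ?I \<phi>' R' M' os' \<and> t + bsize (Lt (K 0) (V 18)) + 1 + \<phi>' \<le> \<phi>) R' M' os'"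
      unfolding Q_def .
  qed (use R in auto)
  then show ?thesis
  proof (rule wp_mono, elim exE conjE)
    fix t \<phi>' s :: nat and R' M' :: "nat \<Rightarrow> nat" and os' :: "nat list"
    assume a: "os' = os" "base_regs R'" "R' 10 = v" "\<not> bev G R' M' (Lt (K 0) (V 18))"
      "t + \<phi>' \<le> 30 * len v + bsize (Lt (K 0) (V 18)) + 1"
      "s \<le> len v" "R' 16 = s" "R' 18 = R 18 div 2 ^ s" "M' = mem_tiers (counts v s)"
    then have "s = len v" using len[of s] by auto
    then have "counts v s = counts (Suc v) 0"
      by (simp add: counts_def cset_len fun_eq_iff)
    then show "t \<le> 30 * len v + 10 \<and> M' = mem_tiers (counts (Suc v) 0) \<and> os' = os \<and> base_regs R' \<and> R' 10 = v"
      using a by simp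
  qed
qed

end

text \<open>The counter of the plane yields the next free position and is incremented. Bits of free
  positions are still 0, so xor sets them; the mark is set if further bits remain in the shifted
  copy in register 18.\<close>

definition fill_body :: com where
  "fill_body = (32 ::= Mem (Op Add (V 25) (V 16));;
     Put (Op Add (V 25) (V 16)) (Op Add (V 32) (K 1));;
     18 ::= Op Shr (V 18) (K 1);;
     35 ::= Op Add (V 21) (Op Div (V 32) (V 20));; 36 ::= Op Mod (V 32) (V 20);;
     If (Eq (Op Mod (V 17) (K 2)) (K 1))
       (Put (V 35) (Op Xor (Mem (V 35)) (Op Shl (K 1) (V 36)))) Skip;;
     If (Lt (K 0) (V 18))
       (Put (V 35) (Op Xor (Mem (V 35)) (Op Shl (K 1) (Op Add (V 20) (V 36))))) Skip;;
     17 ::= Op Shr (V 17) (K 1);; 16 ::= Op Add (V 16) (K 1))"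

definition fill_tiers :: com where
  "fill_tiers = (10 ::= K 0;; While (Lt (V 10) NV)
     (10 ::= Op Add (V 10) (K 1);; load_field;; While (Lt (K 0) (V 18)) fill_body))"

text \<open>Register 19 carries the absolute rank, which is stored at the start of every block of
  \<open>b\<close> cells. The marks are read before the relative rank is placed above them, when a
  plain shift by \<open>q\<close> isolates them.\<close>

definition rank_body :: com where
  "rank_body = (27 ::= Op Add (V 22) (Op Div (V 10) (V 12));; 35 ::= Op Add (V 21) (V 10);;
     If (Eq (Op Mod (V 10) (V 12)) (K 0)) (Put (V 27) (V 19)) Skip;;
     30 ::= Op Shr (Mem (V 35)) (V 20);;
     Put (V 35) (Op Add (Mem (V 35)) (Op Shl (Op Sub (V 19) (Mem (V 27))) (Op Add (V 20) (V 20))));;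
     succinct.popc;; 19 ::= Op Add (V 19) (V 31);; 10 ::= Op Add (V 10) (K 1))"

definition rank_cells :: com where
  "rank_cells = (10 ::= K 0;; 19 ::= K 0;; 26 ::= Op Add (Op Div (V 14) (V 20)) (K 1);;
     While (Lt (V 10) (V 26)) rank_body)"

context big_setup
begin

lemma tier_start_less: "tier_start s < 2 ^ b"
  using start_le_N N_less by (rule order.strict_trans1)

lemma count_tiers_correct:
  assumes R: "base_regs R"
  shows "wp count_tiers (\<lambda>t R' M' os'. t \<le> 100 * nverts G + 30 * N + 20 \<and>
    M' = mem_tiers (counts (Suc (nverts G)) 0) \<and> os' = os \<and> base_regs R') R (mem_tiers (\<lambda>_. 0)) os"
proof -
  let ?n = "nverts G"
  let ?body = "10 ::= Op Add (V 10) (K 1);; load_field;; While (Lt (K 0) (V 18)) count_body"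
  define f where "f k = (\<Sum>v\<in>{k<..?n}. 100 + 30 * len v)" for k
  let ?I = "\<lambda>\<phi> (R' :: nat \<Rightarrow> nat) (M' :: nat \<Rightarrow> nat) (os' :: nat list). os' = os \<and> base_regs R' \<and>
     (\<exists>k\<le>?n. R' 10 = k \<and> M' = mem_tiers (counts (Suc k) 0) \<and> f k \<le> \<phi>)"
  have c0: "counts (Suc 0) 0 = (\<lambda>_. 0)"
    by (simp add: counts_def cset_1 fun_eq_iff)
  have "wp (While (Lt (V 10) NV) ?body)
    (\<lambda>t R' M' os'. \<exists>\<phi>'. ?I \<phi>' R' M' os' \<and> \<not> bev G R' M' (Lt (V 10) NV) \<and>
      t + \<phi>' \<le> f 0 + bsize (Lt (V 10) NV) + 1) (R(10 := 0)) (mem_tiers (\<lambda>_. 0)) os"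
  proof (rule wp_While[where I = ?I])
    show "?I (f 0) (R(10 := 0)) (mem_tiers (\<lambda>_. 0)) os"
      using R c0 by (simp add: base_regs_def)
    fix \<phi> :: nat and R' M' :: "nat \<Rightarrow> nat" and os' :: "nat list"
    assume "?I \<phi> R' M' os'" and "bev G R' M' (Lt (V 10) NV)"
    then obtain k where I: "os' = os" "base_regs R'" "R' 10 = k" "k < ?n"
      "M' = mem_tiers (counts (Suc k) 0)" "f k \<le> \<phi>"
      by auto
    have v: "Suc k \<in> verts G" using I(4) by simp
    have "{k<..?n} = insert (Suc k) {Suc k<..?n}" using I(4) by auto
    then have f: "f k = 100 + 30 * len (Suc k) + f (Suc k)"
      by (simp add: f_def)
    define Q where "Q = (\<lambda>t R' M' os'. \<exists>\<phi>'. ?I \<phi>' R' M' os' \<and> t + bsize (Lt (V 10) NV) + 1 + \<phi>' \<le> \<phi>)"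
    have Q_mono: "Q l R' M' os' \<Longrightarrow> k \<le> l \<Longrightarrow> Q k R' M' os'" for k l R' M' os'
      unfolding Q_def by fastforce
    let ?x = "idg (Suc k) - 1"
    have loop: "wp (While (Lt (K 0) (V 18)) count_body) (\<lambda>t. Q (30 + l + t)) (R'(10 := Suc k, 17 := ?x, 18 := ?x OR 1, 16 := 0)) M' os"
      if "l \<le> 20" for l
      unfolding I(5)
    proof (rule wp_mono[OF count_loop[OF _ _ _ _ v]])
      fix t :: nat and R2 M2 :: "nat \<Rightarrow> nat" and os2 :: "nat list"
      assume a: "t \<le> 30 * len (Suc k) + 10 \<and> M2 = mem_tiers (counts (Suc (Suc k)) 0) \<and> os2 = os \<and>
        base_regs R2 \<and> R2 10 = Suc k"
      then have "?I (f (Suc k)) R2 M2 os2" using I(4) by auto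
      moreover have "30 + l + t + bsize (Lt (V 10) NV) + 1 + f (Suc k) \<le> \<phi>"
        using a that f I(6) by simp
      ultimately show "Q (30 + l + t) R2 M2 os2"
        unfolding Q_def by blast
    qed (use I(2) in \<open>simp_all add: base_regs_def\<close>)
    have F: "wp load_field (\<lambda>t. wp (While (Lt (K 0) (V 18)) count_body) (\<lambda>t'. Q (30 + t + t'))) (R'(10 := Suc k)) M' os"
      by (rule load_field_correct) (use v loop in simp_all)
    have "wp ?body Q R' M' os'"
      using I(1,3) num_less v nverts_less
      by simp (rule wp_mono[OF F], erule wp_mono, erule Q_mono, simp)
    then show "wp ?body (\<lambda>t R' M' os'. \<exists>\<phi>'. ?I \<phi>' R' M' os' \<and> t + bsize (Lt (V 10) NV) + 1 + \<phi>' \<le> \<phi>) R' M' os'"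
      unfolding Q_def .
  qed simp
  moreover have "f 0 = 100 * ?n + 30 * N"
  proof -
    have "{0<..?n} = verts G" by auto
    then show ?thesis
      unfolding f_def N_def by (simp only: sum.distrib flip: sum_distrib_left) simp
  qed
  ultimately have w: "wp (While (Lt (V 10) NV) ?body)
    (\<lambda>t R' M' os'. t + 10 \<le> 100 * ?n + 30 * N + 20 \<and> M' = mem_tiers (counts (Suc ?n) 0) \<and> os' = os \<and> base_regs R')
    (R(10 := 0)) (mem_tiers (\<lambda>_. 0)) os"
    by (elim wp_mono) auto
  show ?thesis
    unfolding count_tiers_def using num_less
    by (simp del: wp_Seq add: wp_Seq[of "10 ::= K 0"]) (rule wp_mono[OF w[unfolded One_nat_def]], auto)
qed

lemma sum_tiers_correct:
  assumes R: "base_regs R"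
  shows "wp sum_tiers (\<lambda>t R' M' os'. t \<le> 40 * b + 20 \<and> M' = mem_tiers tier_start \<and> os' = os \<and> base_regs R')
    R (mem_tiers (counts (Suc (nverts G)) 0)) os"
proof -
  let ?body = "Put (Op Add (V 25) (Op Add (V 16) (K 1)))
       (Op Add (Mem (Op Add (V 25) (Op Add (V 16) (K 1)))) (Mem (Op Add (V 25) (V 16))));;
      16 ::= Op Add (V 16) (K 1)"
  \<comment> \<open>Entries up to \<open>t\<close> are prefix sums already, the later ones still
    hold the size of the tier one below.\<close>
  define f where "f t s = (if s \<le> t then tier_start s else card (tier (s - 1)))" for t s
  let ?I = "\<lambda>\<phi> (R' :: nat \<Rightarrow> nat) (M' :: nat \<Rightarrow> nat) (os' :: nat list). os' = os \<and> base_regs R' \<and>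
     R' 16 \<le> b \<and> M' = mem_tiers (f (R' 16)) \<and> 40 * (b - R' 16) \<le> \<phi>"
  have f0: "counts (Suc (nverts G)) 0 = f 0"
    by (auto simp: counts_def cset_all fun_eq_iff f_def tier_start_def)
  have "wp (While (Lt (V 16) (V 12)) ?body)
    (\<lambda>t R' M' os'. \<exists>\<phi>'. ?I \<phi>' R' M' os' \<and> \<not> bev G R' M' (Lt (V 16) (V 12)) \<and>
      t + \<phi>' \<le> 40 * b + bsize (Lt (V 16) (V 12)) + 1) (R(16 := 0)) (mem_tiers (counts (Suc (nverts G)) 0)) os"
  proof (rule wp_While[where I = ?I])
    show "?I (40 * b) (R(16 := 0)) (mem_tiers (counts (Suc (nverts G)) 0)) os"
      using R f0 by (simp add: base_regs_def)
    fix \<phi> :: nat and R' M' :: "nat \<Rightarrow> nat" and os' :: "nat list"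
    assume I: "?I \<phi> R' M' os'" and c: "bev G R' M' (Lt (V 16) (V 12))"
    let ?t = "R' 16"
    have R': "R' 25 = 2 ^ h" "R' 12 = b" and os: "os' = os"
      and M': "M' = mem_tiers (f ?t)" using I by (simp_all add: base_regs_def)
    have t: "?t < b" using c R' by simp
    define Q where "Q = (\<lambda>t R' M' os'. \<exists>\<phi>'. ?I \<phi>' R' M' os' \<and> t + bsize (Lt (V 16) (V 12)) + 1 + \<phi>' \<le> \<phi>)"
    let ?R = "R'(16 := Suc ?t)" and ?M = "(mem_tiers (f ?t))(2 ^ h + Suc ?t := tier_start (Suc ?t))"
    have "?M = mem_tiers (f (Suc ?t))"
    proof -
      have "(f ?t)(Suc ?t := tier_start (Suc ?t)) = f (Suc ?t)"
        by (auto simp: f_def fun_eq_iff le_Suc_eq)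
      then show ?thesis using mem_tiers_upd[of "Suc ?t" "f ?t"] t by simp
    qed
    then have "?I (40 * (b - Suc ?t)) ?R ?M os"
      using I t by (simp add: base_regs_def)
    moreover have "40 * (b - Suc ?t) + 40 \<le> \<phi>"
      using I Suc_diff_Suc[OF t] by linarith
    ultimately have Q: "Q k ?R ?M os" if "k \<le> 30" for k
      unfolding Q_def using that
      by (intro exI[of _ "40 * (b - Suc ?t)"]) (rule conjI, assumption, simp)
    have at: "mem_tiers (f ?t) (2 ^ h + Suc ?t) + mem_tiers (f ?t) (2 ^ h + ?t) = tier_start (Suc ?t)"
    proof -
      have "mem_tiers (f ?t) (2 ^ h + Suc ?t) = card (tier ?t)" "mem_tiers (f ?t) (2 ^ h + ?t) = tier_start ?t"
        using mem_tiers_at[of "Suc ?t"] mem_tiers_at[of ?t] t by (simp_all add: f_def)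
      then show ?thesis by (simp add: tier_start_def)
    qed
    have "2 ^ h + Suc ?t < A" using t layout_less by linarith
    moreover from this have "2 ^ h + Suc ?t < 2 ^ b" "Suc ?t < 2 ^ b" "2 ^ h + ?t < 2 ^ b" "2 ^ h + ?t < A"
      using layout_less by linarith+
    ultimately have "wp ?body Q R' M' os'"
      unfolding os M' using R' num_less Q at tier_start_less[of "Suc ?t"] by simp
    then show "wp ?body (\<lambda>t R' M' os'. \<exists>\<phi>'. ?I \<phi>' R' M' os' \<and> t + bsize (Lt (V 16) (V 12)) + 1 + \<phi>' \<le> \<phi>) R' M' os'"
      unfolding Q_def .
  qed simp
  moreover have "mem_tiers (f b) = mem_tiers tier_start"
    by (auto simp: mem_tiers_def f_def fun_eq_iff)
  ultimately have w: "wp (While (Lt (V 16) (V 12)) ?body)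
    (\<lambda>t R' M' os'. t + 10 \<le> 40 * b + 20 \<and> M' = mem_tiers tier_start \<and> os' = os \<and> base_regs R')
    (R(16 := 0)) (mem_tiers (counts (Suc (nverts G)) 0)) os"
    by (elim wp_mono) (auto simp: base_regs_def)
  show ?thesis
    unfolding sum_tiers_def using num_less
    by (simp del: wp_Seq add: wp_Seq[of "16 ::= K 0"]) (rule wp_mono[OF w[unfolded One_nat_def]], auto)
qed

definition full_regs :: "(nat \<Rightarrow> nat) \<Rightarrow> bool" where
  "full_regs R \<longleftrightarrow> sregs R \<and> R 12 = b \<and> R 14 = N"

lemma full_regsD: "full_regs R \<Longrightarrow> R 20 = q \<and> R 21 = CB \<and> R 22 = SB \<and> R 23 = q * b \<and> R 24 = h \<and>
    R 25 = 2 ^ h \<and> R 12 = b \<and> R 14 = N"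
  by (simp add: full_regs_def sregs_def)

lemma full_regs_cong: "full_regs R \<Longrightarrow> (\<And>r. r \<in> {12, 14, 20, 21, 22, 23, 24, 25} \<Longrightarrow> R' r = R r) \<Longrightarrow> full_regs R'"
  by (simp add: full_regs_def sregs_def)

lemma addresses_correct:
  assumes R: "base_regs R"
  shows "wp addresses (\<lambda>t R' M' os'. t \<le> 50 \<and> M' = mem_tiers tier_start \<and> os' = os \<and> full_regs R')
    R (mem_tiers tier_start) os"
proof -
  have at: "mem_tiers tier_start (2 ^ h + b) = N"
    using mem_tiers_at[of b tier_start] start_N by simp
  have "2 ^ h + b < A" "2 ^ h + b < 2 ^ b" "SB < 2 ^ b" "CB < 2 ^ b"
    using layout_less by linarith+
  moreover have "N div (q * b) + 1 < 2 ^ b"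
    using calculation(4) by (simp add: CB_def)
  ultimately show ?thesis
    unfolding addresses_def full_regs_def sregs_def using R at num_less qb_less
    by (simp add: base_regs_def SB_def CB_def)
qed

text \<open>The counters contain the next position to be filled in each plane. The two bit
  conditions are equivalences over all positions, so data bit and mark of a position not yet treated
  are 0; the bound \<open>2 ^ (2 * q)\<close> says that the space for relative ranks is still
  empty.\<close>

definition filled :: "nat \<Rightarrow> nat \<Rightarrow> (nat \<Rightarrow> nat) \<Rightarrow> bool" where
  "filled v t M \<longleftrightarrow> (\<forall>a<2 ^ h. M a = popcount a) \<and>
     (\<forall>s\<le>b. M (2 ^ h + s) = tier_start s + card (cset v t s)) \<and>
     (\<forall>j. M (CB + j) < 2 ^ (2 * q)) \<and>
     (\<forall>p. bit (M (CB + p div q)) (p mod q) \<longleftrightarrow>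
        (\<exists>s. \<exists>u\<in>cset v t s. p = pos u s \<and> bit (idg u - 1) s)) \<and>
     (\<forall>p. bit (M (CB + p div q)) (q + p mod q) \<longleftrightarrow>
        (\<exists>s. \<exists>u\<in>cset v t s. p = pos u s \<and> Suc s < len u))"

lemma filled_start: "filled (Suc 0) 0 (mem_tiers tier_start)"
proof -
  have "mem_tiers tier_start (CB + j) = 0" for j
    using layout_less by (simp add: mem_tiers_def)
  then show ?thesis
    using mem_tiers_at by (simp add: filled_def cset_1) (simp add: mem_tiers_def)
qed

lemma filled_next: "filled v (len v) M \<longleftrightarrow> filled (Suc v) 0 M"
  by (simp add: filled_def cset_len)

text \<open>Describing \<open>val\<close> by the bits that are flipped lets one lemma serve all four
  combinations of data bit and mark in \<open>fill_loop\<close>.\<close>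

lemma filled_step:
  assumes f: "filled v t M" and v: "v \<in> verts G" "t < len v"
    and M2: "M2 = (M(2 ^ h + t := Suc (pos v t)))(CB + pos v t div q := val)"
    and val: "\<And>k. bit val k \<longleftrightarrow> (bit (M (CB + pos v t div q)) k \<noteq>
      ((bit (idg v - 1) t \<and> k = pos v t mod q) \<or> (Suc t < len v \<and> k = q + pos v t mod q)))"
      "val < 2 ^ (2 * q)"
  shows "filled v (Suc t) M2"
proof -
  let ?a = "CB + pos v t div q" and ?i = "pos v t mod q"
  have vt: "v \<in> tier t" using v by (simp add: tier_def)
  have i: "?i < q" using q by simp
  have tb: "t < b" using v len_le_b by fastforce
  have cs: "cset v (Suc t) s = (if s = t then insert v (cset v t s) else cset v t s)" for s
    by (rule cset_Suc[OF vt])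
  have new: "u \<in> cset v t s \<Longrightarrow> pos u s \<noteq> pos v t" for u s
    using pos_inj[OF _ vt, of u s] cset_self(1)[of v t] by (auto simp: cset_def)
  have split: "(\<exists>s. \<exists>u\<in>cset v (Suc t) s. P u s) \<longleftrightarrow> (\<exists>s. \<exists>u\<in>cset v t s. P u s) \<or> P v t" for P
    unfolding cs by (auto split: if_splits)
  have other: "p div q \<noteq> pos v t div q \<or> p mod q \<noteq> ?i" if "p \<noteq> pos v t" for p
    using that by (metis div_mult_mod_eq)
  have ptr: "tier_start t + card (cset v t t) = pos v t"
    by (simp add: pos_def cset_self(2))
  have lay: "2 ^ h + s < ?a" if "s \<le> b" for s
    using that layout_less by linarith
  have 1: "M2 a = popcount a" if "a < 2 ^ h" for a
    using f that lay[of 0] unfolding M2 filled_def by simp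
  have 2: "M2 (2 ^ h + s) = tier_start s + card (cset v (Suc t) s)" if "s \<le> b" for s
    using f that lay[OF that] ptr cset_self(1)[of v t] unfolding M2 filled_def cs by auto
  have 3: "M2 (CB + j) < 2 ^ (2 * q)" for j
    using f val(2) lay[of t] tb layout_less unfolding M2 filled_def by auto
  have cell: "M2 (CB + p div q) = (if p div q = pos v t div q then val else M (CB + p div q))" for p
    using tb layout_less unfolding M2 by auto
  have keep: "bit (M2 (CB + p div q)) k = bit (M (CB + p div q)) k"
    if p: "p \<noteq> pos v t" and k: "k = p mod q \<or> k = q + p mod q" for p k
  proof (cases "p div q = pos v t div q")
    case True
    then have "p mod q \<noteq> ?i" using other[OF p] by blast
    moreover have "p mod q < q" using q by simp
    ultimately have "k \<noteq> ?i \<and> k \<noteq> q + ?i" using k i by linarith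
    then show ?thesis by (simp only: cell True if_True val(1) simp_thms)
  next
    case False
    then show ?thesis by (simp only: cell if_False)
  qed
  have at: "bit (M2 (CB + pos v t div q)) k \<longleftrightarrow> (bit (M ?a) k \<noteq>
      ((bit (idg v - 1) t \<and> k = ?i) \<or> (Suc t < len v \<and> k = q + ?i)))" for k
    by (simp only: cell simp_thms if_True val(1))
  have 4: "bit (M2 (CB + p div q)) (p mod q) \<longleftrightarrow>
      (\<exists>s. \<exists>u\<in>cset v (Suc t) s. p = pos u s \<and> bit (idg u - 1) s)" for p
  proof -
    have old: "bit (M (CB + p div q)) (p mod q) \<longleftrightarrow> (\<exists>s. \<exists>u\<in>cset v t s. p = pos u s \<and> bit (idg u - 1) s)"
      using f unfolding filled_def by blast
    show ?thesis
    proof (cases "p = pos v t")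
      case True
      then have no: "\<not> bit (M ?a) ?i" using old new by metis
      have "bit (M2 (CB + pos v t div q)) ?i \<longleftrightarrow> bit (idg v - 1) t"
        unfolding at using no i by simp
      moreover have "\<not> (\<exists>s. \<exists>u\<in>cset v t s. p = pos u s \<and> bit (idg u - 1) s)"
        using True new by metis
      ultimately show ?thesis
        unfolding split using True by blast
    next
      case False
      then show ?thesis
        unfolding split using keep[of p "p mod q"] old by blast
    qed
  qed
  have 5: "bit (M2 (CB + p div q)) (q + p mod q) \<longleftrightarrow>
      (\<exists>s. \<exists>u\<in>cset v (Suc t) s. p = pos u s \<and> Suc s < len u)" for p
  proof -
    have old: "bit (M (CB + p div q)) (q + p mod q) \<longleftrightarrow> (\<exists>s. \<exists>u\<in>cset v t s. p = pos u s \<and> Suc s < len u)"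
      using f unfolding filled_def by blast
    show ?thesis
    proof (cases "p = pos v t")
      case True
      then have no: "\<not> bit (M ?a) (q + ?i)" using old new by metis
      have "bit (M2 (CB + pos v t div q)) (q + ?i) \<longleftrightarrow> Suc t < len v"
        unfolding at using no i by simp
      moreover have "\<not> (\<exists>s. \<exists>u\<in>cset v t s. p = pos u s \<and> Suc s < len u)"
        using True new by metis
      ultimately show ?thesis
        unfolding split using True by blast
    next
      case False
      then show ?thesis
        unfolding split using keep[of p "q + p mod q"] old by blast
    qed
  qed
  show ?thesis
    unfolding filled_def using 1 2 3 4 5 by blast
qed

lemma fill_loop:
  assumes R: "full_regs R" "R 10 = v" "R 16 = 0" "R 17 = idg v - 1" "R 18 = (idg v - 1) OR 1"
    and v: "v \<in> verts G" and f: "filled v 0 M"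
  shows "wp (While (Lt (K 0) (V 18)) fill_body) (\<lambda>t R' M' os'. t \<le> 100 * len v + 10 \<and>
    filled (Suc v) 0 M' \<and> os' = os \<and> full_regs R' \<and> R' 10 = v) R M os"
proof -
  let ?I = "\<lambda>\<phi> (R' :: nat \<Rightarrow> nat) (M' :: nat \<Rightarrow> nat) (os' :: nat list). os' = os \<and> full_regs R' \<and> R' 10 = v \<and>
     (\<exists>t\<le>len v. R' 16 = t \<and> R' 17 = (idg v - 1) div 2 ^ t \<and> R' 18 = R 18 div 2 ^ t \<and> filled v t M' \<and>
       100 * (len v - t) \<le> \<phi>)"
  have len: "0 < R 18 div 2 ^ t \<longleftrightarrow> t < len v" for t
    using bitlen_less_iff[of t "R 18"] R(5) by (simp add: len_def)
  have "wp (While (Lt (K 0) (V 18)) fill_body)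
    (\<lambda>t R' M' os'. \<exists>\<phi>'. ?I \<phi>' R' M' os' \<and> \<not> bev G R' M' (Lt (K 0) (V 18)) \<and>
      t + \<phi>' \<le> 100 * len v + bsize (Lt (K 0) (V 18)) + 1) R M os"
  proof (rule wp_While[where I = ?I])
    show "?I (100 * len v) R M os"
      using R f by auto
    fix \<phi> :: nat and R' M' :: "nat \<Rightarrow> nat" and os' :: "nat list"
    assume "?I \<phi> R' M' os'" and c: "bev G R' M' (Lt (K 0) (V 18))"
    then obtain t where I: "os' = os" "full_regs R'" "R' 10 = v" "R' 16 = t"
      "R' 17 = (idg v - 1) div 2 ^ t" "R' 18 = R 18 div 2 ^ t" "filled v t M'"
      "100 * (len v - t) \<le> \<phi>" "0 < R 18 div 2 ^ t"
      by auto
    have t: "t < len v" using I(9) len by blast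
    have vt: "v \<in> tier t" using v t by (simp add: tier_def)
    have tb: "t < b" using t len_le_b[OF v] by linarith
    define p where "p = pos v t"
    have p: "p < N" using pos_less_start[OF vt] start_le[of "Suc t"] by (simp add: p_def)
    let ?a = "CB + p div q" and ?i = "p mod q"
    have i: "?i < q" using q by simp
    note off = offset_less[OF i]
    define d where "d \<longleftrightarrow> bit (idg v - 1) t"
    define e where "e \<longleftrightarrow> Suc t < len v"
    define Q where "Q = (\<lambda>t R' M' os'. \<exists>\<phi>'. ?I \<phi>' R' M' os' \<and> t + bsize (Lt (K 0) (V 18)) + 1 + \<phi>' \<le> \<phi>)"
    have div2: "x div 2 ^ t div 2 = x div 2 ^ Suc t" for x :: nat
      by (simp only: power_Suc2 div_mult2_eq)
    let ?R = "R'(32 := p, 18 := R 18 div 2 ^ t div 2, 35 := ?a, 36 := ?i, 17 := (idg v - Suc 0) div 2 ^ t div 2, 16 := Suc t)"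
    have full: "full_regs ?R"
      by (rule full_regs_cong[OF I(2)]) auto
    have Q: "Q k ?R M2 os" if k: "k \<le> 80" and M2: "filled v (Suc t) M2" for k M2
    proof -
      have "?I (100 * (len v - Suc t)) ?R M2 os"
        using full I(3) t M2 by (auto simp: div2)
      then show ?thesis
        unfolding Q_def using k I(8) t
        by (intro exI[of _ "100 * (len v - Suc t)"]) (rule conjI, assumption, simp)
    qed
    have pdiv: "p div q \<le> N div q" using p by (intro div_le_mono) simp
    have lay: "?a < A" "?a < 2 ^ b" "2 ^ h + t < A" "2 ^ h + t < 2 ^ b" "2 ^ h + t \<noteq> ?a" "?a \<noteq> 2 ^ h + t"
      "Suc p < 2 ^ b" "Suc t < 2 ^ b"
      using layout_less layout(3,4) pdiv p N_less tb num_less(4) by linarith+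
    have Mp: "M' (2 ^ h + t) = p"
      using I(7) tb unfolding filled_def p_def pos_def by (simp add: cset_self(2))
    have Ma: "M' ?a < 2 ^ (2 * q)"
      using I(7) unfolding filled_def by blast
    have pw: "2 ^ ?i < (2::nat) ^ (2 * q)" "2 ^ (q + ?i) < (2::nat) ^ (2 * q)"
      using i by (auto intro: power_strict_increasing)
    have mod17: "(idg v - Suc 0) div 2 ^ t mod 2 = of_bool d"
      using mod_two_bit[of "idg v - 1" t] by (simp add: d_def)
    have pos18: "0 < R 18 div 2 ^ t div 2 \<longleftrightarrow> e"
      using len[of "Suc t"] by (simp only: div2 e_def)
    have step: "filled v (Suc t) M2" if "M2 = (M'(2 ^ h + t := Suc p))(?a := val)"
      "\<And>k. bit val k \<longleftrightarrow> (bit (M' ?a) k \<noteq> ((d \<and> k = ?i) \<or> (e \<and> k = q + ?i)))" "val < 2 ^ (2 * q)" for M2 val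
      by (rule filled_step[OF I(7) v t that[unfolded p_def d_def e_def]])
    have iq: "?i \<noteq> q + ?i" "k = ?i \<Longrightarrow> k \<noteq> q + ?i" for k
      using q by auto
    have "wp fill_body Q R' M' os'"
    proof (cases d; cases e)
      assume de: d e
      have "filled v (Suc t) (M'(2 ^ h + t := Suc p, ?a := (M' ?a XOR 2 ^ ?i) XOR 2 ^ (q + ?i)))"
        by (rule step[OF refl]) (use de iq pw Ma in \<open>auto simp: bit_xor_pow intro!: xor_less_pow\<close>)
      then show ?thesis
        unfolding fill_body_def
        using full_regsD[OF I(2)] I(1,4,5,6) num_less off lay Mp mod17 pos18 de Q by simp
    next
      assume de: d "\<not> e"
      have "filled v (Suc t) (M'(2 ^ h + t := Suc p, ?a := (M' ?a XOR 2 ^ ?i)))"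
        by (rule step[OF refl]) (use de iq pw Ma in \<open>auto simp: bit_xor_pow intro!: xor_less_pow\<close>)
      then show ?thesis
        unfolding fill_body_def
        using full_regsD[OF I(2)] I(1,4,5,6) num_less off lay Mp mod17 pos18 de Q by simp
    next
      assume de: "\<not> d" e
      have "filled v (Suc t) (M'(2 ^ h + t := Suc p, ?a := (M' ?a XOR 2 ^ (q + ?i))))"
        by (rule step[OF refl]) (use de iq pw Ma in \<open>auto simp: bit_xor_pow intro!: xor_less_pow\<close>)
      then show ?thesis
        unfolding fill_body_def
        using full_regsD[OF I(2)] I(1,4,5,6) num_less off lay Mp mod17 pos18 de Q by simp
    next
      assume de: "\<not> d" "\<not> e"
      \<comment> \<open>If neither bit is set, the program does not write the cell at all; a trivial
        update provides the form that \<open>step\<close> expects.\<close>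
      have "M'(2 ^ h + t := Suc p) = (M'(2 ^ h + t := Suc p))(?a := M' ?a)"
        using lay by (auto simp: fun_eq_iff)
      then have "filled v (Suc t) (M'(2 ^ h + t := Suc p))"
        by (rule step) (use de Ma in auto)
      then show ?thesis
        unfolding fill_body_def
        using full_regsD[OF I(2)] I(1,4,5,6) num_less off lay Mp mod17 pos18 de Q by simp
    qed
    then show "wp fill_body (\<lambda>t R' M' os'. \<exists>\<phi>'. ?I \<phi>' R' M' os' \<and> t + bsize (Lt (K 0) (V 18)) + 1 + \<phi>' \<le> \<phi>) R' M' os'"
      unfolding Q_def .
  qed simp
  then show ?thesis
  proof (rule wp_mono, elim exE conjE)
    fix t \<phi>' s :: nat and R' M' :: "nat \<Rightarrow> nat" and os' :: "nat list"
    assume a: "os' = os" "full_regs R'" "R' 10 = v" "\<not> bev G R' M' (Lt (K 0) (V 18))"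
      "t + \<phi>' \<le> 100 * len v + bsize (Lt (K 0) (V 18)) + 1"
      "s \<le> len v" "R' 16 = s" "R' 18 = R 18 div 2 ^ s" "filled v s M'"
    then have "s = len v" using len[of s] by auto
    then show "t \<le> 100 * len v + 10 \<and> filled (Suc v) 0 M' \<and> os' = os \<and> full_regs R' \<and> R' 10 = v"
      using a filled_next by simp
  qed
qed

lemma fill_tiers_correct:
  assumes R: "full_regs R"
  shows "wp fill_tiers (\<lambda>t R' M' os'. t \<le> 100 * nverts G + 100 * N + 20 \<and>
    filled (Suc (nverts G)) 0 M' \<and> os' = os \<and> full_regs R') R (mem_tiers tier_start) os"
proof -
  let ?n = "nverts G"
  let ?body = "10 ::= Op Add (V 10) (K 1);; load_field;; While (Lt (K 0) (V 18)) fill_body"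
  define f where "f k = (\<Sum>v\<in>{k<..?n}. 100 + 100 * len v)" for k
  let ?I = "\<lambda>\<phi> (R' :: nat \<Rightarrow> nat) (M' :: nat \<Rightarrow> nat) (os' :: nat list). os' = os \<and> full_regs R' \<and>
     (\<exists>k\<le>?n. R' 10 = k \<and> filled (Suc k) 0 M' \<and> f k \<le> \<phi>)"
  have "wp (While (Lt (V 10) NV) ?body)
    (\<lambda>t R' M' os'. \<exists>\<phi>'. ?I \<phi>' R' M' os' \<and> \<not> bev G R' M' (Lt (V 10) NV) \<and>
      t + \<phi>' \<le> f 0 + bsize (Lt (V 10) NV) + 1) (R(10 := 0)) (mem_tiers tier_start) os"
  proof (rule wp_While[where I = ?I])
    have "full_regs (R(10 := 0))"
      by (rule full_regs_cong[OF R]) auto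
    then show "?I (f 0) (R(10 := 0)) (mem_tiers tier_start) os"
      using filled_start by simp
    fix \<phi> :: nat and R' M' :: "nat \<Rightarrow> nat" and os' :: "nat list"
    assume "?I \<phi> R' M' os'" and "bev G R' M' (Lt (V 10) NV)"
    then obtain k where I: "os' = os" "full_regs R'" "R' 10 = k" "k < ?n" "filled (Suc k) 0 M'" "f k \<le> \<phi>"
      by auto
    have v: "Suc k \<in> verts G" using I(4) by simp
    have "{k<..?n} = insert (Suc k) {Suc k<..?n}" using I(4) by auto
    then have f: "f k = 100 + 100 * len (Suc k) + f (Suc k)"
      by (simp add: f_def)
    define Q where "Q = (\<lambda>t R' M' os'. \<exists>\<phi>'. ?I \<phi>' R' M' os' \<and> t + bsize (Lt (V 10) NV) + 1 + \<phi>' \<le> \<phi>)"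
    have Q_mono: "Q l R' M' os' \<Longrightarrow> k \<le> l \<Longrightarrow> Q k R' M' os'" for k l R' M' os'
      unfolding Q_def by fastforce
    let ?x = "idg (Suc k) - 1"
    let ?R = "R'(10 := Suc k, 17 := ?x, 18 := ?x OR 1, 16 := 0)"
    have full: "full_regs ?R"
      by (rule full_regs_cong[OF I(2)]) auto
    have loop: "wp (While (Lt (K 0) (V 18)) fill_body) (\<lambda>t. Q (30 + l + t)) ?R M' os"
      if "l \<le> 20" for l
    proof (rule wp_mono[OF fill_loop[OF full _ _ _ _ v I(5)]])
      fix t :: nat and R2 M2 :: "nat \<Rightarrow> nat" and os2 :: "nat list"
      assume a: "t \<le> 100 * len (Suc k) + 10 \<and> filled (Suc (Suc k)) 0 M2 \<and> os2 = os \<and>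
        full_regs R2 \<and> R2 10 = Suc k"
      then have "?I (f (Suc k)) R2 M2 os2" using I(4) by auto
      moreover have "30 + l + t + bsize (Lt (V 10) NV) + 1 + f (Suc k) \<le> \<phi>"
        using a that f I(6) by simp
      ultimately show "Q (30 + l + t) R2 M2 os2"
        unfolding Q_def by blast
    qed simp_all
    have F: "wp load_field (\<lambda>t. wp (While (Lt (K 0) (V 18)) fill_body) (\<lambda>t'. Q (30 + t + t'))) (R'(10 := Suc k)) M' os"
      by (rule load_field_correct) (use v loop in simp_all)
    have "wp ?body Q R' M' os'"
      using I(1,3) num_less v nverts_less
      by simp (rule wp_mono[OF F], erule wp_mono, erule Q_mono, simp)
    then show "wp ?body (\<lambda>t R' M' os'. \<exists>\<phi>'. ?I \<phi>' R' M' os' \<and> t + bsize (Lt (V 10) NV) + 1 + \<phi>' \<le> \<phi>) R' M' os'"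
      unfolding Q_def .
  qed simp
  moreover have "f 0 = 100 * ?n + 100 * N"
  proof -
    have "{0<..?n} = verts G" by auto
    then show ?thesis
      unfolding f_def N_def by (simp only: sum.distrib flip: sum_distrib_left) simp
  qed
  ultimately have w: "wp (While (Lt (V 10) NV) ?body)
    (\<lambda>t R' M' os'. t + 10 \<le> 100 * ?n + 100 * N + 20 \<and> filled (Suc ?n) 0 M' \<and> os' = os \<and> full_regs R')
    (R(10 := 0)) (mem_tiers tier_start) os"
    by (elim wp_mono) auto
  show ?thesis
    unfolding fill_tiers_def using num_less
    by (simp del: wp_Seq add: wp_Seq[of "10 ::= K 0"]) (rule wp_mono[OF w[unfolded One_nat_def]], auto)
qed

end

definition setup_fields :: com where
  "setup_fields = (parameters;; popcount_table;; count_tiers;; sum_tiers;; addresses;; fill_tiers;; rank_cells)"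

section \<open>Fields in whole cells for small inputs\<close>

definition dec_word :: com where
  "dec_word = If (Eq (Op Add (Mem (V 3)) (K 1)) (InDeg (V 3))) (5 ::= K 1)
     (Put (V 3) (Op Add (Mem (V 3)) (K 1));; 5 ::= K 0)"

definition xchg_word :: com where
  "xchg_word = (5 ::= Op Sub (Op Sub (InDeg (V 3)) (K 1)) (Mem (V 3));;
     Put (V 3) (Op Sub (Op Sub (InDeg (V 3)) (K 1)) (V 4)))"

context machine
begin

lemma wp_Seq_time:
  assumes "wp c (\<lambda>t R' M' os'. t \<le> T \<and> os' = os \<and> P R' M') R M os"
    and "\<And>R' M'. P R' M' \<Longrightarrow> wp d (\<lambda>t R' M' os'. t \<le> T' \<and> os' = os \<and> Q R' M') R' M' os"
  shows "wp (c ;; d) (\<lambda>t R' M' os'. t \<le> T + T' \<and> os' = os \<and> Q R' M') R M os"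
  unfolding wp_Seq
proof (rule wp_mono[OF assms(1)], elim conjE)
  fix t :: nat and R' M' :: "nat \<Rightarrow> nat" and os' :: "nat list"
  assume "t \<le> T" "os' = os" "P R' M'"
  then show "wp d (\<lambda>t' R' M' os'. t + t' \<le> T + T' \<and> os' = os \<and> Q R' M') R' M' os'"
    using assms(2)[of R' M'] by (auto elim!: wp_mono)
qed

text \<open>Fields are stored in complemented form, so that zeroed memory already represents the
  initial counters \<open>idg v - 1\<close>. Neither initialization nor constants other than 0 and 1
  are required, which suits very short words.\<close>

definition word_rep :: "(nat \<Rightarrow> nat) \<Rightarrow> (nat \<Rightarrow> nat) \<Rightarrow> (nat \<Rightarrow> nat) \<Rightarrow> bool" where
  "word_rep c R M \<longleftrightarrow> (\<forall>v\<in>verts G. 0 < idg v \<longrightarrow> c v < idg v \<and> M v = idg v - 1 - c v)"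

lemma dfs_word:
  assumes "acyclic (edges G)" "nverts G < A"
  shows "dfs G w b A dec_word xchg_word word_rep (\<lambda>_ _. 50) 50"
proof (unfold_locales)
  show "acyclic (edges G)" by fact
  show "word_rep c R' M" if "word_rep c R M" for c R R' M
    using that by (simp add: word_rep_def)
  have one: "Suc 0 < 2 ^ b" using size_less nverts_pos by linarith
  show "wp dec_word (\<lambda>t R' M' os'. t \<le> 50 \<and> os' = os \<and> (\<forall>r<10. r \<noteq> 5 \<longrightarrow> R' r = R r) \<and>
      (if c (R 3) = 0 then R' 5 = 1 \<and> (\<exists>y. word_rep (c(R 3 := y)) R' M')
       else R' 5 = 0 \<and> word_rep (c(R 3 := c (R 3) - 1)) R' M')) R M os"
    if r: "word_rep c R M" and v: "R 3 \<in> verts G" "0 < idg (R 3)" for c R M os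
  proof -
    have c: "c (R 3) < idg (R 3)" "M (R 3) = idg (R 3) - 1 - c (R 3)"
      using r v by (auto simp: word_rep_def)
    have le: "idg (R 3) < 2 ^ b" "R 3 < A"
      using in_arr_props(4)[OF v(1)] nverts_less v(1) assms(2) by auto
    show ?thesis
    proof (cases "c (R 3) = 0")
      case True
      then have "Suc (M (R 3)) = idg (R 3)" using c by simp
      moreover have "word_rep (c(R 3 := 0)) (R(5 := Suc 0)) M"
        using r True by (auto simp: word_rep_def)
      ultimately show ?thesis
        unfolding dec_word_def using le v(1) one True by auto
    next
      case False
      then have M: "Suc (M (R 3)) = idg (R 3) - 1 - (c (R 3) - 1)" "Suc (M (R 3)) \<noteq> idg (R 3)" using c by simp_all
      then have "word_rep (c(R 3 := c (R 3) - 1)) (R(5 := 0)) (M(R 3 := Suc (M (R 3))))"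
        using r c by (auto simp: word_rep_def)
      moreover have "Suc (M (R 3)) < 2 ^ b" using M(1) le by linarith
      ultimately show ?thesis
        unfolding dec_word_def using le v(1) one False M(2) by auto
    qed
  qed
  show "wp xchg_word (\<lambda>t R' M' os'. t \<le> 50 * idg (R 3) \<and> os' = os \<and> (\<forall>r<10. r \<noteq> 5 \<longrightarrow> R' r = R r) \<and>
      R' 5 = c (R 3) \<and> word_rep (c(R 3 := R 4)) R' M') R M os"
    if r: "word_rep c R M" and v: "R 3 \<in> verts G" "R 4 < idg (R 3)" for c R M os
  proof -
    have "0 < idg (R 3)" using v(2) by linarith
    then have c: "c (R 3) < idg (R 3)" "M (R 3) = idg (R 3) - Suc (c (R 3))"
      using r v(1) by (simp_all add: word_rep_def)
    have le: "R 3 < A"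
      using v(1) assms(2) by auto
    have "word_rep (c(R 3 := R 4)) (R(5 := c (R 3))) (M(R 3 := idg (R 3) - Suc 0 - R 4))"
      using r v by (auto simp: word_rep_def)
    moreover have "idg (R 3) - Suc 0 - M (R 3) = c (R 3)" "M (R 3) \<le> idg (R 3) - Suc 0"
      "R 4 \<le> idg (R 3) - Suc 0" "Suc 0 \<le> idg (R 3)" "idg (R 3) - Suc (M (R 3)) = c (R 3)"
      using c v by linarith+
    ultimately show ?thesis
      unfolding xchg_word_def using le v(1) one by auto
  qed
qed simp

end

context big_setup
begin

section \<open>Computation of the ranks\<close>

lemma rank_diff: "rank (p + k) \<le> rank p + k"
proof -
  have "card {i. i < k \<and> mark (p + i)} \<le> card {..<k}"
    by (rule card_mono) auto
  then show ?thesis by (simp add: rank_add)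
qed

lemma rank_le_N: "rank p \<le> N"
proof -
  have "k < N" if "mark k" for k
  proof -
    from that obtain t v where "v \<in> tier t" "k = pos v t"
      unfolding mark_def using tier_Suc_subset by blast
    then show ?thesis
      using pos_less_start[of v t] start_le[of "Suc t"] by linarith
  qed
  then have "card {k. k < p \<and> mark k} \<le> card {..<N}"
    by (intro card_mono) auto
  then show ?thesis by (simp add: rank_def)
qed

text \<open>\<open>M0\<close> is the memory before the pass over the cells, of which
  \<open>j\<close> have been treated. The low \<open>2 * q\<close> bits of a cell never change, and
  a block rank is in place as soon as its block has been entered.\<close>

definition ranked :: "(nat \<Rightarrow> nat) \<Rightarrow> nat \<Rightarrow> (nat \<Rightarrow> nat) \<Rightarrow> bool" where
  "ranked M0 j M \<longleftrightarrow> (\<forall>a<SB. M a = M0 a) \<and> (\<forall>i. M (CB + i) mod 2 ^ (2 * q) = M0 (CB + i)) \<and>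
     (\<forall>i\<ge>j. M (CB + i) = M0 (CB + i)) \<and>
     (\<forall>i<j. M (CB + i) div 2 ^ (2 * q) + M (SB + i div b) = rank (i * q)) \<and>
     (\<forall>k. k * b < j \<longrightarrow> M (SB + k) = rank (k * b * q))"

text \<open>The point is that a relative rank fits into the \<open>rr\<close> bits above marks and
  data: it counts marks in \<open>j mod b\<close> cells of \<open>q\<close> positions each, at most
  \<open>b * b < 2 ^ rr\<close>. \<open>M1\<close> merges the cases with and without a new
  block.\<close>

lemma ranked_step:
  assumes r: "ranked M0 j M" and j: "j \<le> N div q" and small: "\<And>i. M0 (CB + i) < 2 ^ (2 * q)"
    and M1: "M1 = (if j mod b = 0 then M(SB + j div b := rank (j * q)) else M)"
    and M2: "M2 = M1(CB + j := M0 (CB + j) + (rank (j * q) - M1 (SB + j div b)) * 2 ^ (2 * q))"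
  shows "ranked M0 (Suc j) M2" "M1 (CB + j) = M0 (CB + j)" "M1 (SB + j div b) \<le> rank (j * q)"
    "M0 (CB + j) + (rank (j * q) - M1 (SB + j div b)) * 2 ^ (2 * q) < 2 ^ b"
    "(rank (j * q) - M1 (SB + j div b)) * 2 ^ (2 * q) < 2 ^ b"
proof -
  let ?J = "j div b"
  let ?s = "SB + ?J"
  have jdiv: "k div b \<le> N div (q * b)" if "k \<le> N div q" for k
    using that by (simp add: div_mult2_eq div_le_mono)
  have sep: "SB + k div b < CB + i" if "k \<le> N div q" for k i
    using jdiv[OF that] layout(2) by linarith
  have j_eq: "j = ?J * b + j mod b" by simp
  have s: "M1 ?s = rank (?J * b * q)"
  proof (cases "j mod b = 0")
    case True
    then have "?J * b = j" using j_eq by linarith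
    then show ?thesis using True M1 by simp
  next
    case False
    then have "?J * b < j" using j_eq by linarith
    then show ?thesis using False M1 r by (simp add: ranked_def)
  qed
  show le: "M1 ?s \<le> rank (j * q)"
    unfolding s by (intro rank_mono mult_right_mono) auto
  show Mj: "M1 (CB + j) = M0 (CB + j)"
    using r sep[OF j, of j] unfolding M1 ranked_def by auto
  let ?c = "rank (j * q) - M1 ?s"
  have "j * q = ?J * b * q + j mod b * q"
    by (metis add_mult_distrib j_eq)
  then have "rank (j * q) \<le> M1 ?s + j mod b * q"
    unfolding s using rank_diff by metis
  moreover have "j mod b * q \<le> b * b"
    using b_ge two_q by (intro mult_mono) auto
  ultimately have c: "?c < 2 ^ rr"
    using rr_less by linarith
  have "M0 (CB + j) + ?c * 2 ^ (2 * q) < (?c + 1) * 2 ^ (2 * q)"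
    using small[of j] by simp
  also have "\<dots> \<le> 2 ^ rr * 2 ^ (2 * q)"
    using c by (intro mult_right_mono) auto
  also have "\<dots> \<le> 2 ^ b"
    using two_q by (simp add: power_add[symmetric])
  finally show less: "M0 (CB + j) + ?c * 2 ^ (2 * q) < 2 ^ b" .
  then show "?c * 2 ^ (2 * q) < 2 ^ b" by linarith
  have low: "M2 a = M a" if "a < SB" for a
    using that layout_less(2) unfolding M2 M1 by auto
  have cell: "M2 (CB + i) = (if i = j then M0 (CB + j) + ?c * 2 ^ (2 * q) else M (CB + i))" for i
    using sep[OF j, of i] unfolding M2 M1 by auto
  have sup: "M2 (SB + k) = (if k = ?J then rank (?J * b * q) else M (SB + k))" if "k * b < Suc j" for k
  proof -
    have "k \<le> j div b"
      using that b_ge by (simp add: less_eq_div_iff_mult_less_eq)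
    then have "SB + k < CB + j" using jdiv[OF j] layout(2) by linarith
    then have "M2 (SB + k) = M1 (SB + k)" unfolding M2 by simp
    then show ?thesis using s unfolding M1 by auto
  qed
  show "ranked M0 (Suc j) M2"
    unfolding ranked_def
  proof (intro conjI allI impI)
    show "M2 a = M0 a" if "a < SB" for a
      using low[OF that] r that by (simp add: ranked_def)
    show "M2 (CB + i) mod 2 ^ (2 * q) = M0 (CB + i)" for i
      using cell[of i] r small[of i] by (auto simp: ranked_def)
    show "M2 (CB + i) = M0 (CB + i)" if "Suc j \<le> i" for i
      using cell[of i] that r by (simp add: ranked_def)
    show "M2 (SB + k) = rank (k * b * q)" if "k * b < Suc j" for k
    proof (cases "k = ?J")
      case False
      then have "k * b \<noteq> j" using b_ge by auto
      then have "k * b < j" using that by simp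
      then show ?thesis using sup[OF that] False r by (simp add: ranked_def)
    qed (use sup[OF that] in simp)
    show "M2 (CB + i) div 2 ^ (2 * q) + M2 (SB + i div b) = rank (i * q)" if "i < Suc j" for i
    proof (cases "i = j")
      case True
      have "(M0 (CB + j) + ?c * 2 ^ (2 * q)) div 2 ^ (2 * q) = ?c"
        using small[of j] by simp
      moreover have "M2 (SB + j div b) = M1 ?s"
        using sup[of ?J] s j_eq by simp
      ultimately show ?thesis
        using True cell[of j] le by simp
    next
      case False
      then have i: "i < j" using that by simp
      have k: "i div b * b \<le> i" by simp
      have "M2 (SB + i div b) = M (SB + i div b)"
      proof (cases "i div b = ?J")
        case True
        then have "?J * b < j" using k i by simp
        then have "M (SB + ?J) = rank (?J * b * q)" using r by (simp add: ranked_def)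
        then show ?thesis using sup[of "i div b"] True k i by simp
      next
        case False
        then show ?thesis using sup[of "i div b"] k i by simp
      qed
      then show ?thesis
        using cell[of i] False r i by (simp add: ranked_def)
    qed
  qed
qed

lemma filled_marks:
  assumes "filled (Suc (nverts G)) 0 M"
  shows "bit (M (CB + p div q)) (q + p mod q) \<longleftrightarrow> mark p"
    "v \<in> verts G \<Longrightarrow> t < len v \<Longrightarrow> bit (M (CB + pos v t div q)) (pos v t mod q) = bit (idg v - 1) t"
proof -
  show "bit (M (CB + p div q)) (q + p mod q) \<longleftrightarrow> mark p"
  proof -
    have "tier (Suc s) = {u \<in> tier s. Suc s < len u}" for s
      by (auto simp: tier_def)
    then have "mark p \<longleftrightarrow> (\<exists>s. \<exists>u\<in>tier s. p = pos u s \<and> Suc s < len u)"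
      unfolding mark_def by blast
    then show ?thesis
      using assms unfolding filled_def cset_all by blast
  qed
  assume v: "v \<in> verts G" "t < len v"
  then have vt: "v \<in> tier t" by (simp add: tier_def)
  have "bit (M (CB + pos v t div q)) (pos v t mod q) \<longleftrightarrow>
      (\<exists>s. \<exists>u\<in>tier s. pos v t = pos u s \<and> bit (idg u - 1) s)"
    using assms unfolding filled_def cset_all by blast
  also have "\<dots> \<longleftrightarrow> bit (idg v - 1) t"
    using pos_inj[OF vt] vt by blast
  finally show "bit (M (CB + pos v t div q)) (pos v t mod q) = bit (idg v - 1) t" .
qed

lemma rank_cells_correct:
  assumes R: "full_regs R" and f: "filled (Suc (nverts G)) 0 M"
  shows "wp rank_cells (\<lambda>t R' M' os'. t \<le> 300 * (N div q + 1) + 50 \<and> os' = os \<and>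
    rep (\<lambda>v. idg v - 1) R' M') R M os"
proof -
  let ?m = "Suc (N div q)"
  let ?I = "\<lambda>\<phi> (R' :: nat \<Rightarrow> nat) (M' :: nat \<Rightarrow> nat) (os' :: nat list). os' = os \<and> full_regs R' \<and> R' 26 = ?m \<and>
     R' 10 \<le> ?m \<and> R' 19 = rank (R' 10 * q) \<and> ranked M (R' 10) M' \<and> 300 * (?m - R' 10) \<le> \<phi>"
  have small: "M (CB + i) < 2 ^ (2 * q)" for i
    using f by (simp add: filled_def)
  have table: "\<forall>x<2 ^ h. M x = popcount x"
    using f by (simp add: filled_def)
  have rank0: "rank 0 = 0" by (simp add: rank_def)
  have mless: "?m < 2 ^ b" "N div q < ?m"
    using layout_less layout(3) by (linarith, simp)
  have "wp (While (Lt (V 10) (V 26)) rank_body)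
    (\<lambda>t R' M' os'. \<exists>\<phi>'. ?I \<phi>' R' M' os' \<and> \<not> bev G R' M' (Lt (V 10) (V 26)) \<and>
      t + \<phi>' \<le> 300 * ?m + bsize (Lt (V 10) (V 26)) + 1) (R(10 := 0, 19 := 0, 26 := ?m)) M os"
  proof (rule wp_While[where I = ?I])
    have "full_regs (R(10 := 0, 19 := 0, 26 := ?m))"
      by (rule full_regs_cong[OF R]) auto
    moreover have "ranked M 0 M"
      using small by (simp add: ranked_def)
    ultimately show "?I (300 * ?m) (R(10 := 0, 19 := 0, 26 := ?m)) M os"
      using rank0 by simp
    fix \<phi> :: nat and R' M' :: "nat \<Rightarrow> nat" and os' :: "nat list"
    assume I0: "?I \<phi> R' M' os'" and c: "bev G R' M' (Lt (V 10) (V 26))"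
    define j where "j = R' 10"
    have I: "os' = os" "full_regs R'" "R' 26 = ?m" "R' 10 = j" "R' 19 = rank (j * q)" "ranked M j M'"
      "300 * (?m - j) \<le> \<phi>"
      using I0 by (simp_all add: j_def)
    have j: "j \<le> N div q" using c I by simp
    define Q where "Q = (\<lambda>t R' M' os'. \<exists>\<phi>'. ?I \<phi>' R' M' os' \<and> t + bsize (Lt (V 10) (V 26)) + 1 + \<phi>' \<le> \<phi>)"
    have Q_mono: "Q l R' M' os' \<Longrightarrow> k \<le> l \<Longrightarrow> Q k R' M' os'" for k l R' M' os'
      unfolding Q_def by fastforce
    define M1 where "M1 = (if j mod b = 0 then M'(SB + j div b := rank (j * q)) else M')"
    define val where "val = M (CB + j) + (rank (j * q) - M1 (SB + j div b)) * 2 ^ (2 * q)"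
    define M2 where "M2 = M1(CB + j := val)"
    note st = ranked_step[OF I(6) j small M1_def M2_def[unfolded val_def]]
    have rk: "ranked M (Suc j) M2"
      using st(1) unfolding M2_def val_def .
    let ?x = "M (CB + j) div 2 ^ q"
    have xq: "?x < 2 ^ q"
      using small[of j] by (simp add: div_less_iff_less_mult power_add[symmetric] mult_2)
    \<comment> \<open>Carries the running rank in register 19 from the start of one cell to the
      start of the next.\<close>
    have "rank (j * q + q) = rank (j * q) + popcount ?x"
    proof -
      have "bit ?x i \<longleftrightarrow> mark (j * q + i)" if i: "i < q" for i
      proof -
        have "bit ?x i = bit (M (CB + j)) (q + i)"
          by (simp add: drop_bit_eq_div[symmetric] bit_drop_bit_eq)
        moreover have "(j * q + i) div q = j" "(j * q + i) mod q = i"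
          using i by simp_all
        ultimately show ?thesis
          using filled_marks(1)[OF f, of "j * q + i"] by metis
      qed
      then have "{i. i < q \<and> bit ?x i} = {i. i < q \<and> mark (j * q + i)}" by blast
      then show ?thesis
        using popcount_card[OF xq] rank_add[of "j * q" q] by simp
    qed
    then have next_rank: "rank (j * q) + popcount ?x = rank (Suc j * q)"
      by (simp add: add.commute)
    have jdiv: "j div b \<le> N div (q * b)"
      using j by (simp add: div_mult2_eq div_le_mono)
    have "SB + j div b < CB" using jdiv layout(2) by linarith
    then have lay: "SB + j div b < A" "SB + j div b < 2 ^ b" "CB + j < A" "CB + j < 2 ^ b" "Suc j < 2 ^ b"
      "q + q < 2 ^ b" "CB + j \<noteq> SB + j div b" "SB + j div b \<noteq> CB + j"
      using layout(3,4) j layout_less mless num_less(4) two_q by linarith+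
    let ?R = "R'(27 := SB + j div b, 35 := CB + j, 30 := ?x)"
    have full: "full_regs ?R"
      by (rule full_regs_cong[OF I(2)]) auto
    have "M2 x = popcount x" if "x < 2 ^ h" for x
    proof -
      have "x < SB" using that layout(1) by linarith
      then show ?thesis
        using rk table that by (simp add: ranked_def)
    qed
    then have "wp popc (\<lambda>t R2 M2' os'. t \<le> 150 \<and> M2' = M2 \<and> os' = os \<and>
        R2 = ?R(30 := 0, 31 := popcount (?R 30))) ?R M2 os"
      using full xq by (intro popc_correct) (simp_all add: full_regs_def)
    then have F: "wp popc (\<lambda>t. wp (19 ::= Op Add (V 19) (V 31);; 10 ::= Op Add (V 10) (K 1)) (\<lambda>t'. Q (80 + t + t'))) ?R M2 os"
    proof (rule wp_mono, elim conjE)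
      fix t :: nat and R2 M2' :: "nat \<Rightarrow> nat" and os2 :: "nat list"
      assume a: "t \<le> 150" "M2' = M2" "os2 = os" "R2 = ?R(30 := 0, 31 := popcount (?R 30))"
      let ?R3 = "R2(19 := rank (Suc j * q), 10 := Suc j)"
      have full2: "full_regs ?R3"
        by (rule full_regs_cong[OF full]) (auto simp: a(4))
      have R2: "R2 19 = rank (j * q)" "R2 31 = popcount ?x" "R2 10 = j" "R2 26 = ?m"
        using I by (simp_all add: a(4))
      have "?I (300 * (?m - Suc j)) ?R3 M2 os"
        using full2 R2 j rk by simp
      moreover have "300 * (?m - Suc j) + 300 \<le> \<phi>"
        using I(7) j by (simp add: Suc_diff_le)
      ultimately have Q3: "Q k ?R3 M2 os" if "k \<le> 270" for k
        unfolding Q_def using that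
        by (intro exI[of _ "300 * (?m - Suc j)"]) (rule conjI, assumption, simp)
      have "rank (Suc j * q) < 2 ^ b" using rank_le_N N_less by (rule order.strict_trans1)
      then have "rank (j * q) + popcount ?x < 2 ^ b" unfolding next_rank .
      then show "wp (19 ::= Op Add (V 19) (V 31);; 10 ::= Op Add (V 10) (K 1)) (\<lambda>t'. Q (80 + t + t')) R2 M2' os2"
        using R2 a(1-3) num_less lay Q3[unfolded next_rank[symmetric]] by simp
    qed
    have b0: "0 < b" using b_ge by simp
    have "wp rank_body Q R' M' os'"
    proof (cases "j mod b = 0")
      case True
      then have M1: "M1 = M'(SB + j div b := rank (j * q))" by (simp add: M1_def)
      have Mj: "M' (CB + j) = M (CB + j)" using st(2) lay unfolding M1 by simp
      have M2: "M2 = M'(SB + j div b := rank (j * q), CB + j := M (CB + j))"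
        unfolding M2_def val_def M1 by simp
      show ?thesis
        unfolding rank_body_def I(1)
        using full_regsD[OF I(2)] I(4,5) num_less lay True small[of j] Mj st(3-5)[unfolded M1]
        by (simp add: mult_2) (rule wp_mono[OF F[unfolded One_nat_def M2]], erule wp_mono, erule Q_mono, simp)
    next
      case False
      then have M1: "M1 = M'" by (simp add: M1_def)
      have Mj: "M' (CB + j) = M (CB + j)" using st(2) unfolding M1 .
      have M2: "M2 = M'(CB + j := M (CB + j) + (rank (j * q) - M' (SB + j div b)) * 2 ^ (2 * q))"
        unfolding M2_def val_def M1 by simp
      show ?thesis
        unfolding rank_body_def I(1)
        using full_regsD[OF I(2)] I(4,5) num_less lay False Mj st(3-5)[unfolded M1 mult_2]
        by (simp add: mult_2) (rule wp_mono[OF F[unfolded One_nat_def M2 mult_2]], erule wp_mono, erule Q_mono, simp)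
    qed
    then show "wp rank_body (\<lambda>t R' M' os'. \<exists>\<phi>'. ?I \<phi>' R' M' os' \<and> t + bsize (Lt (V 10) (V 26)) + 1 + \<phi>' \<le> \<phi>) R' M' os'"
      unfolding Q_def .
  qed simp
  then have w: "wp (While (Lt (V 10) (V 26)) rank_body)
    (\<lambda>t R' M' os'. t + 20 \<le> 300 * (N div q + 1) + 50 \<and> os' = os \<and> rep (\<lambda>v. idg v - 1) R' M')
    (R(10 := 0, 19 := 0, 26 := ?m)) M os"
  proof (rule wp_mono, elim exE conjE)
    fix t \<phi>' :: nat and R' M' :: "nat \<Rightarrow> nat" and os' :: "nat list"
    assume a: "os' = os" "full_regs R'" "R' 26 = ?m" "R' 10 \<le> ?m" "ranked M (R' 10) M'"
      "\<not> bev G R' M' (Lt (V 10) (V 26))" "t + \<phi>' \<le> 300 * ?m + bsize (Lt (V 10) (V 26)) + 1"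
    then have "R' 10 = ?m" by simp
    then have r: "ranked M ?m M'" using a(5) by simp
    \<comment> \<open>The pass only adds multiples of \<open>2 ^ (2 * q)\<close> to the cells, so
      marks and data bits are inherited from \<open>M\<close>.\<close>
    have same: "bit (M' (CB + i)) k = bit (M (CB + i)) k" if "k < 2 * q" for i k
    proof -
      have "take_bit (2 * q) (M' (CB + i)) = M (CB + i)"
        using r by (simp add: ranked_def take_bit_eq_mod)
      then show ?thesis using that by (metis bit_take_bit_iff)
    qed
    have pq: "p mod q < q" for p using q by simp
    have "dir M'"
      unfolding dir_def
    proof (intro conjI allI impI)
      show "M' x = popcount x" if "x < 2 ^ h" for x
        using r table that layout(1) by (simp add: ranked_def)
      show "bit (M' (CB + p div q)) (q + p mod q) = mark p" for p
        using same[of "q + p mod q"] pq[of p] filled_marks(1)[OF f, of p] by simp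
      show "M' (CB + j) div 2 ^ (2 * q) + M' (SB + j div b) = rank (j * q)" if "j \<le> N div q" for j
        using r that by (simp add: ranked_def)
    qed
    moreover have "bit (M' (CB + pos v t div q)) (pos v t mod q) = bit (idg v - 1) t"
      if "v \<in> verts G" "t < len v" for v t
      using same[of "pos v t mod q"] pq[of "pos v t"] filled_marks(2)[OF f that] by simp
    moreover have "idg v - 1 < 2 ^ len v" for v
      using idg_len[of v] by (cases "idg v") auto
    ultimately have "rep (\<lambda>v. idg v - 1) R' M'"
      using a(2) by (simp add: rep_def full_regs_def)
    then show "t + 20 \<le> 300 * (N div q + 1) + 50 \<and> os' = os \<and> rep (\<lambda>v. idg v - 1) R' M'"
      using a by simp
  qed
  show ?thesis
    unfolding rank_cells_def using full_regsD[OF R] num_less mless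
    by (simp del: wp_Seq add: wp_Seq[of "10 ::= K 0"] wp_Seq[of "19 ::= K 0"] wp_Seq[of "26 ::= _"])
      (rule wp_mono[OF w[unfolded One_nat_def]], auto)
qed

theorem setup_fields_correct:
  "wp setup_fields (\<lambda>t R' M' os'. t \<le> 3000 * (nverts G + nedges G) \<and> os' = os \<and>
    rep (\<lambda>v. idg v - 1) R' M') R (\<lambda>_. 0) os"
proof -
  let ?n = "nverts G"
  have "wp setup_fields (\<lambda>t R' M' os'. t \<le> (30 * ?n + 40 * b + 200) + ((30 * 2 ^ h + 20) +
      ((100 * ?n + 30 * N + 20) + ((40 * b + 20) + (50 + ((100 * ?n + 100 * N + 20) +
      (300 * (N div q + 1) + 50)))))) \<and> os' = os \<and> rep (\<lambda>v. idg v - 1) R' M') R (\<lambda>_. 0) os"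
    unfolding setup_fields_def
  proof (rule wp_Seq_time[where P = "\<lambda>R M. base_regs R \<and> M = (\<lambda>_. 0)"])
    show "wp parameters (\<lambda>t R' M' os'. t \<le> 30 * ?n + 40 * b + 200 \<and> os' = os \<and> base_regs R' \<and> M' = (\<lambda>_. 0)) R (\<lambda>_. 0) os"
      using parameters_correct by (rule wp_mono) auto
    fix R M assume a: "base_regs R \<and> M = (\<lambda>_::nat. 0::nat)"
    show "wp (popcount_table;; count_tiers;; sum_tiers;; addresses;; fill_tiers;; rank_cells)
      (\<lambda>t R' M' os'. t \<le> (30 * 2 ^ h + 20) +
      ((100 * ?n + 30 * N + 20) + ((40 * b + 20) + (50 + ((100 * ?n + 100 * N + 20) +
      (300 * (N div q + 1) + 50))))) \<and> os' = os \<and> rep (\<lambda>v. idg v - 1) R' M') R M os"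
    proof (rule wp_Seq_time[where P = "\<lambda>R M. base_regs R \<and> M = mem_tiers (\<lambda>_. 0)"])
      show "wp popcount_table (\<lambda>t R' M' os'. t \<le> 30 * 2 ^ h + 20 \<and> os' = os \<and> base_regs R' \<and>
          M' = mem_tiers (\<lambda>_. 0)) R M os"
        using wp_mono[OF popcount_table_correct] a by auto
      fix R M assume a: "base_regs R \<and> M = mem_tiers (\<lambda>_. 0)"
      show "wp (count_tiers;; sum_tiers;; addresses;; fill_tiers;; rank_cells)
        (\<lambda>t R' M' os'. t \<le> (100 * ?n + 30 * N + 20) + ((40 * b + 20) + (50 + ((100 * ?n + 100 * N + 20) +
        (300 * (N div q + 1) + 50)))) \<and> os' = os \<and> rep (\<lambda>v. idg v - 1) R' M') R M os"
      proof (rule wp_Seq_time[where P = "\<lambda>R M. base_regs R \<and> M = mem_tiers (counts (Suc ?n) 0)"])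
        show "wp count_tiers (\<lambda>t R' M' os'. t \<le> 100 * ?n + 30 * N + 20 \<and> os' = os \<and> base_regs R' \<and>
            M' = mem_tiers (counts (Suc ?n) 0)) R M os"
          using wp_mono[OF count_tiers_correct] a by auto
        fix R M assume a: "base_regs R \<and> M = mem_tiers (counts (Suc ?n) 0)"
        show "wp (sum_tiers;; addresses;; fill_tiers;; rank_cells)
          (\<lambda>t R' M' os'. t \<le> (40 * b + 20) + (50 + ((100 * ?n + 100 * N + 20) +
          (300 * (N div q + 1) + 50))) \<and> os' = os \<and> rep (\<lambda>v. idg v - 1) R' M') R M os"
        proof (rule wp_Seq_time[where P = "\<lambda>R M. base_regs R \<and> M = mem_tiers tier_start"])
          show "wp sum_tiers (\<lambda>t R' M' os'. t \<le> 40 * b + 20 \<and> os' = os \<and> base_regs R' \<and>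
              M' = mem_tiers tier_start) R M os"
            using wp_mono[OF sum_tiers_correct] a by auto
          fix R M assume a: "base_regs R \<and> M = mem_tiers tier_start"
          show "wp (addresses;; fill_tiers;; rank_cells)
            (\<lambda>t R' M' os'. t \<le> 50 + ((100 * ?n + 100 * N + 20) + (300 * (N div q + 1) + 50)) \<and>
            os' = os \<and> rep (\<lambda>v. idg v - 1) R' M') R M os"
          proof (rule wp_Seq_time[where P = "\<lambda>R M. full_regs R \<and> M = mem_tiers tier_start"])
            show "wp addresses (\<lambda>t R' M' os'. t \<le> 50 \<and> os' = os \<and> full_regs R' \<and>
                M' = mem_tiers tier_start) R M os"
              using wp_mono[OF addresses_correct] a by auto
            fix R M assume a: "full_regs R \<and> M = mem_tiers tier_start"
            show "wp (fill_tiers;; rank_cells)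
              (\<lambda>t R' M' os'. t \<le> (100 * ?n + 100 * N + 20) + (300 * (N div q + 1) + 50) \<and>
              os' = os \<and> rep (\<lambda>v. idg v - 1) R' M') R M os"
            proof (rule wp_Seq_time[where P = "\<lambda>R M. full_regs R \<and> filled (Suc ?n) 0 M"])
              show "wp fill_tiers (\<lambda>t R' M' os'. t \<le> 100 * ?n + 100 * N + 20 \<and> os' = os \<and> full_regs R' \<and>
                  filled (Suc ?n) 0 M') R M os"
                using wp_mono[OF fill_tiers_correct] a by auto
            qed (use rank_cells_correct in blast)
          qed
        qed
      qed
    qed
  qed
  moreover have "30 * ?n + 40 * b + 200 + (30 * 2 ^ h + 20 + (100 * ?n + 30 * N + 20 + (40 * b + 20 +
      (50 + (100 * ?n + 100 * N + 20 + (300 * (N div q + 1) + 50)))))) \<le> 3000 * (?n + nedges G)"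
  proof -
    \<comment> \<open>Here \<open>k\<close>, \<open>H\<close>, \<open>d\<close> and \<open>s\<close>
      stand for \<open>N\<close>, \<open>2 ^ h\<close>, \<open>N div q\<close> and
      \<open>2 ^ (b - 1)\<close>; like \<open>b\<close>, all of them are bounded by a multiple of
      \<open>n + m\<close>.\<close>
    have arith: "30 * n + 40 * b + 200 + (30 * H + 20 + (100 * n + 30 * k + 20 + (40 * b + 20 +
        (50 + (100 * n + 100 * k + 20 + (300 * (d + 1) + 50)))))) \<le> 3000 * (n + m)"
      if "k \<le> n + m" "8 * H \<le> n + m" "d * 24 \<le> k" "8 * b \<le> s" "s \<le> n + m" "64 \<le> b"
      for n m k H d b s :: nat
      using that unfolding distrib_left by linarith
    show ?thesis
      by (rule arith[OF N_le pow_h(1) N_div(1) b_small size_ge b_ge])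
  qed
  ultimately show ?thesis
    by (elim wp_mono) auto
qed

end

section \<open>The program and its resource bounds\<close>

fun halvings :: "nat \<Rightarrow> expr \<Rightarrow> expr" where
  "halvings 0 e = e"
| "halvings (Suc k) e = Op Shr (halvings k e) (K 1)"

lemma ev_halvings: "ev G R M (halvings k e) = ev G R M e div 2 ^ k"
  by (induction k) (simp_all add: div_mult2_eq[symmetric] mult.commute)

lemma safe_halvings: "1 < (2::nat) ^ b \<Longrightarrow> safe G b A R M e \<Longrightarrow> safe G b A R M (halvings k e)"
  by (induction k) simp_all

lemma esize_halvings: "esize (halvings k e) = esize e + 2 * k"
  by (induction k) simp_all

text \<open>
  The case distinction uses only values up to \<open>n\<close>: for tiny \<open>n\<close> a word may be too short for any
  other constant. Each halving is a shift by one position, so that \<open>63\<close> is never written down.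
\<close>

definition topsort :: com where
  "topsort = If (Eq (halvings 63 NV) (K 0))
     (dfs.dfs_prog dec_word xchg_word)
     (setup_fields;; dfs.dfs_prog succinct.dec_field succinct.xchg_field)"

definition topsort_program :: program where
  "topsort_program = ccom 0 topsort"

lemma wp_program:
  assumes "machine G w b"
    and "machine.wp G b A topsort (\<lambda>t R' M' os'. t \<le> 20000 * (nverts G + nedges G) \<and> topological_sorting G os')
      (\<lambda>_. 0) (\<lambda>_. 0) []"
  shows "computes_in_time topsort_program w G (topological_sorting G) (20000 * real (nverts G + nedges G))"
    and "real ((num_regs topsort_program + A) * b) \<le> S \<Longrightarrow> runs_in_space topsort_program w G S"
proof -
  interpret machine G w b A by fact
  obtain t R M os where *: "run G b A topsort (\<lambda>_. 0) (\<lambda>_. 0) [] t R M os"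
    "t \<le> 20000 * (nverts G + nedges G)" "topological_sorting G os"
    using assms(2) unfolding wp_def by blast
  have "real t \<le> real (20000 * (nverts G + nedges G))"
    using *(2) by (simp only: of_nat_le_iff)
  then have "real t \<le> 20000 * real (nverts G + nedges G)"
    by simp
  then show "computes_in_time topsort_program w G (topological_sorting G) (20000 * real (nverts G + nedges G))"
    unfolding topsort_program_def using run_program(1)[OF *(1)] *(3) by blast
  show "runs_in_space topsort_program w G S" if "real ((num_regs topsort_program + A) * b) \<le> S"
    using run_program(2)[OF *(1)] that unfolding topsort_program_def by blast
qed

lemma machine_bitlen:
  assumes "valid_input G" "word_length_ok w G"
  shows "machine G w (bitlen (nverts G + nedges G))"
  using assms less_bitlen bitlen_le by (simp add: machine_def word_length_ok_def)

lemma topsort_small: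
  assumes G: "valid_input G" "acyclic (edges G)" "word_length_ok w G" and n: "nverts G < 2 ^ 63"
  defines "b \<equiv> bitlen (nverts G + nedges G)"
  shows "computes_in_time topsort_program w G (topological_sorting G) (20000 * real (nverts G + nedges G))"
    and "real ((num_regs topsort_program + (nverts G + 1)) * b) \<le> S \<Longrightarrow> runs_in_space topsort_program w G S"
proof -
  have m: "machine G w b" unfolding b_def by (rule machine_bitlen[OF G(1,3)])
  interpret machine G w b "nverts G + 1" by fact
  interpret dfs G w b "nverts G + 1" dec_word xchg_word word_rep "\<lambda>_ _. 50" 50
    by (rule dfs_word[OF G(2)]) simp
  have "word_rep (\<lambda>v. idg v - 1) (\<lambda>_. 0) (\<lambda>_. 0)"
    by (simp add: word_rep_def)
  note d = dfs_correct[OF this]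
  have "wp (dfs_prog) (\<lambda>t R' M' os'. bsize (Eq (halvings 63 NV) (K 0)) + t \<le> 20000 * (nverts G + nedges G) \<and>
      topological_sorting G os') (\<lambda>_. 0) (\<lambda>_. 0) []"
    by (rule wp_mono[OF d]) (use nverts_pos in \<open>auto simp: esize_halvings\<close>)
  then have "wp topsort (\<lambda>t R' M' os'. t \<le> 20000 * (nverts G + nedges G) \<and>
      topological_sorting G os') (\<lambda>_. 0) (\<lambda>_. 0) []"
    unfolding topsort_def wp_If using n one_less
    by (simp add: ev_halvings safe_halvings del: bsize.simps)
  note wp_program[OF m this]
  then show "computes_in_time topsort_program w G (topological_sorting G) (20000 * real (nverts G + nedges G))"
    and "real ((num_regs topsort_program + (nverts G + 1)) * b) \<le> S \<Longrightarrow> runs_in_space topsort_program w G S"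
    by blast+
qed

lemma big_machine_bitlen:
  assumes "valid_input G" "word_length_ok w G" "2 ^ 63 \<le> nverts G"
  shows "big_machine G w (bitlen (nverts G + nedges G))"
proof -
  have "0 < (nverts G + nedges G) div 2 ^ 63"
    using assms(3) by (simp add: div_greater_zero_iff)
  then have "63 < bitlen (nverts G + nedges G)"
    using bitlen_less_iff by blast
  then show ?thesis
    using machine_bitlen[OF assms(1,2)] by (simp add: big_machine_def big_machine_axioms_def)
qed

lemma topsort_big:
  assumes G: "valid_input G" "acyclic (edges G)" "word_length_ok w G" and n: "2 ^ 63 \<le> nverts G"
  defines "b \<equiv> bitlen (nverts G + nedges G)"
  shows "computes_in_time topsort_program w G (topological_sorting G) (20000 * real (nverts G + nedges G))"
    and "real ((num_regs topsort_program + big_machine.cells G b) * b) \<le> S \<Longrightarrow> runs_in_space topsort_program w G S"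
proof -
  have bm: "big_machine G w b" unfolding b_def by (rule big_machine_bitlen[OF G(1,3) n])
  then have m: "machine G w b" by (simp add: big_machine_def)
  interpret big_setup G w b "big_machine.cells G b"
    by (intro big_setup.intro big_setup_axioms.intro bm refl)
  interpret dfs G w b "big_machine.cells G b" dec_field xchg_field rep "\<lambda>v x. 300 * dec_runs v x + 50" 1000
    by (rule dfs_succinct[OF G(2)])
  let ?W = "nverts G + nedges G"
  have W: "1 \<le> ?W" using nverts_pos by linarith
  have n0: "nverts G div 2 ^ 63 \<noteq> 0" using n by (simp add: div_eq_0_iff)
  have "wp (setup_fields;; dfs_prog) (\<lambda>t R' M' os'. bsize (Eq (halvings 63 NV) (K 0)) + t + 1 \<le> 20000 * ?W \<and>
      topological_sorting G os') (\<lambda>_. 0) (\<lambda>_. 0) []"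
    unfolding wp_Seq
  proof (rule wp_mono[OF setup_fields_correct], elim conjE)
    fix t :: nat and R' M' :: "nat \<Rightarrow> nat" and os' :: "nat list"
    assume a: "t \<le> 3000 * ?W" "os' = []" "rep (\<lambda>v. idg v - 1) R' M'"
    note d = dfs_correct[OF a(3)]
    show "wp dfs_prog (\<lambda>t' R' M' os'. bsize (Eq (halvings 63 NV) (K 0)) + (t + t') + 1 \<le> 20000 * ?W \<and>
        topological_sorting G os') R' M' os'"
      unfolding a(2)
    proof (rule wp_mono[OF d])
      fix t' R' M' os'
      assume "t' \<le> (7 * 1000 + 500) * ?W \<and> topological_sorting G os'"
      then show "bsize (Eq (halvings 63 NV) (K 0)) + (t + t') + 1 \<le> 20000 * ?W \<and> topological_sorting G os'"
        using a(1) W by (simp add: esize_halvings)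
    qed simp_all
  qed
  then have "wp topsort (\<lambda>t R' M' os'. t \<le> 20000 * ?W \<and>
      topological_sorting G os') (\<lambda>_. 0) (\<lambda>_. 0) []"
    unfolding topsort_def wp_If using n one_less n0
    by (simp add: ev_halvings safe_halvings del: bsize.simps wp_Seq)
  note wp_program[OF m this]
  then show "computes_in_time topsort_program w G (topological_sorting G) (20000 * real (nverts G + nedges G))"
    and "real ((num_regs topsort_program + big_machine.cells G b) * b) \<le> S \<Longrightarrow> runs_in_space topsort_program w G S"
    by blast+
qed

section \<open>Comparison of the three space bounds\<close>

lemma log_2_4: "log 2 (4::real) = 2"
proof -
  have "log 2 ((2::real) powr 2) = 2" by (subst log_powr_cancel) auto
  then show ?thesis by simp
qed

context machine
begin

lemma L0_in_eq: "L0_in G = (\<Sum>v\<in>verts G. if 2 \<le> idg v then \<lceil>log 2 (real (idg v))\<rceil> else 0)"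
proof -
  have "L0_in G = (\<Sum>v\<in>{v \<in> verts G. 2 \<le> idg v}. \<lceil>log 2 (real (idg v))\<rceil>)"
    unfolding L0_in_def by (intro sum.cong) (auto simp: idg_indegree simp del: atLeastAtMost_iff)
  then show ?thesis by (simp only: sum.inter_filter finite_atLeastAtMost)
qed

lemma L0_in_nonneg: "0 \<le> L0_in G"
proof -
  have "0 \<le> \<lceil>log 2 (real d)\<rceil>" if "2 \<le> d" for d :: nat
    using ceiling_mono[of 0 "log 2 (real d)"] that by simp
  then show ?thesis
    unfolding L0_in_eq by (intro sum_nonneg) simp
qed

text \<open>If \<open>k\<close> is the rounded logarithm, then \<open>2 ^ (k - 1) < d\<close>, and
  \<open>3 * k\<close> grows slower than \<open>2 ^ k\<close>. Equality holds at
  \<open>d = 3\<close>; this worst case is the origin of the factor 4/3 in bound (b).\<close>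

lemma ceiling_log_le:
  fixes d :: nat
  assumes "2 \<le> d"
  shows "3 * \<lceil>log 2 (real d)\<rceil> \<le> 2 * int d"
proof -
  define k where "k = nat \<lceil>log 2 (real d)\<rceil>"
  have pos: "0 < log 2 (real d)" using assms by simp
  then have k: "\<lceil>log 2 (real d)\<rceil> = int k" "1 \<le> k"
    unfolding k_def by (auto simp: le_nat_iff)
  have "real k - 1 < log 2 (real d)"
    using k(1) ceiling_correct[of "log 2 (real d)"] by simp
  then have "2 powr (real k - 1) < real d"
    using assms by (simp add: less_log_iff)
  moreover have "2 powr (real k - 1) = real (2 ^ (k - 1))"
    using k(2) by (simp add: powr_realpow[symmetric] of_nat_diff)
  ultimately have d: "2 ^ (k - 1) < d"
    by (simp only: of_nat_less_iff)
  \<comment> \<open>The summand 2 stems from \<open>2 ^ (k - 1) + 1 \<le> d\<close>. The inequality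
    is tight at \<open>j = 1\<close>, and since the right side grows by only 2 from 0 to 1, the step
    from 0 is checked separately.\<close>
  have "3 * (j + 1) \<le> 2 * 2 ^ j + 2" for j :: nat
  proof (induction j)
    case (Suc j)
    then show ?case by (cases "j = 0") (auto simp: Suc_le_eq intro: order.strict_trans1 dest: gr0_implies_Suc)
  qed simp
  from this[of "k - 1"] have "3 * k \<le> 2 * d" using d k(2) by simp
  then show ?thesis unfolding k(1) by linarith
qed

lemma L0_in_edges: "3 * L0_in G \<le> 2 * int (nedges G)"
proof -
  have "3 * L0_in G \<le> (\<Sum>v\<in>verts G. 2 * int (idg v))"
    unfolding L0_in_eq sum_distrib_left by (intro sum_mono) (simp add: ceiling_log_le)
  also have "\<dots> = 2 * int (\<Sum>v\<in>verts G. idg v)"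
    by (simp add: sum_distrib_left)
  finally show ?thesis unfolding sum_idg .
qed

text \<open>Jensen's inequality for the logarithm, from the tangent at the mean \<open>a\<close>:
  the correction terms \<open>y v / a - 1\<close> sum to 0.\<close>

lemma sum_log_le:
  fixes y :: "nat \<Rightarrow> real"
  assumes y: "\<And>v. v \<in> S \<Longrightarrow> 0 < y v" and S: "finite S" "S \<noteq> {}"
  shows "(\<Sum>v\<in>S. log 2 (y v)) \<le> card S * log 2 ((\<Sum>v\<in>S. y v) / card S)"
proof -
  let ?c = "real (card S)"
  define a where "a = (\<Sum>v\<in>S. y v) / ?c"
  have c: "0 < ?c" using S by (simp add: card_gt_0_iff)
  then have a: "0 < a"
    unfolding a_def using y S by (intro divide_pos_pos sum_pos) auto
  have "ln (y v) \<le> ln a + (y v / a - 1)" if "v \<in> S" for v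
    using ln_le_minus_one[of "y v / a"] y[OF that] a by (simp add: ln_div)
  then have "(\<Sum>v\<in>S. ln (y v)) \<le> (\<Sum>v\<in>S. ln a + (y v / a - 1))"
    by (intro sum_mono)
  also have "\<dots> = ?c * ln a + ((\<Sum>v\<in>S. y v) / a - ?c)"
    by (simp add: sum.distrib sum_subtractf sum_divide_distrib)
  also have "(\<Sum>v\<in>S. y v) / a = ?c"
    using a c by (simp add: a_def field_simps)
  finally have "(\<Sum>v\<in>S. ln (y v)) / ln 2 \<le> ?c * ln a / ln 2"
    by (intro divide_right_mono) auto
  then show ?thesis
    unfolding log_def a_def by (simp add: sum_divide_distrib)
qed

text \<open>Origin of the argument \<open>2 + 4 * d\<close>: for \<open>d \<ge> 2\<close>, one plus
  the rounded logarithm is at most \<open>log d + 2 = log (4 * d)\<close>, and for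
  \<open>d \<le> 1\<close> the constant 2 supplies the single bit. Averaging the argument over the
  vertices by \<open>sum_log_le\<close> gives \<open>2 + 4 * m / n\<close>.\<close>

lemma L0_in_log:
  "real (nverts G) + real_of_int (L0_in G) \<le>
    real (nverts G) * log 2 (2 + 4 * real (nedges G) / real (nverts G))"
proof -
  let ?n = "real (nverts G)"
  have n: "0 < ?n" using nverts_pos by simp
  have "?n + real_of_int (L0_in G) =
      (\<Sum>v\<in>verts G. 1 + real_of_int (if 2 \<le> idg v then \<lceil>log 2 (real (idg v))\<rceil> else 0))"
    unfolding L0_in_eq by (simp add: sum.distrib)
  also have "\<dots> \<le> (\<Sum>v\<in>verts G. log 2 (2 + 4 * real (idg v)))"
  proof (intro sum_mono)
    fix v
    show "1 + real_of_int (if 2 \<le> idg v then \<lceil>log 2 (real (idg v))\<rceil> else 0) \<le> log 2 (2 + 4 * real (idg v))"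
    proof (cases "2 \<le> idg v")
      case True
      have "real_of_int \<lceil>log 2 (real (idg v))\<rceil> \<le> log 2 (real (idg v)) + 1"
        by linarith
      then have "1 + real_of_int \<lceil>log 2 (real (idg v))\<rceil> \<le> log 2 (real (idg v)) + log 2 4"
        unfolding log_2_4 by linarith
      also have "\<dots> = log 2 (real (idg v) * 4)"
        using True by (subst log_mult) auto
      also have "\<dots> \<le> log 2 (2 + 4 * real (idg v))"
        using True by (subst log_le_cancel_iff) auto
      finally show ?thesis using True by simp
    next
      case False
      have "log 2 2 \<le> log 2 (2 + 4 * real (idg v))"
        by (subst log_le_cancel_iff) auto
      then show ?thesis using False by simp
    qed
  qed
  also have "\<dots> \<le> card (verts G) * log 2 ((\<Sum>v\<in>verts G. 2 + 4 * real (idg v)) / card (verts G))"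
    using nverts_pos by (intro sum_log_le) (auto simp: add_pos_nonneg)
  also have "(\<Sum>v\<in>verts G. 2 + 4 * real (idg v)) = 2 * ?n + 4 * real (nedges G)"
  proof -
    have "(\<Sum>v\<in>verts G. real (idg v)) = real (nedges G)"
      unfolding sum_idg[symmetric] by simp
    then show ?thesis
      by (simp only: sum.distrib flip: sum_distrib_left) simp
  qed
  also have "(2 * ?n + 4 * real (nedges G)) / card (verts G) = 2 + 4 * real (nedges G) / ?n"
    using n by (simp add: field_simps)
  finally show ?thesis by simp
qed

lemma nedges_le: "nedges G \<le> nverts G * nverts G"
proof -
  have "nedges G \<le> card (verts G \<times> verts G)"
    using valid unfolding valid_input_def by (intro card_mono) auto
  then show ?thesis by simp
qed

end

context big_machine
begin

section \<open>Space of the succinct representation\<close>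

lemma N_le_L0: "real N \<le> real (nverts G) + real_of_int (L0_in G)"
proof -
  have "real N = (\<Sum>v\<in>verts G. real (len v))"
    by (simp add: N_def)
  also have "\<dots> \<le> (\<Sum>v\<in>verts G. 1 + real_of_int (if 2 \<le> idg v then \<lceil>log 2 (real (idg v))\<rceil> else 0))"
  proof (intro sum_mono)
    fix v
    show "real (len v) \<le> 1 + real_of_int (if 2 \<le> idg v then \<lceil>log 2 (real (idg v))\<rceil> else 0)"
    proof (cases "2 \<le> idg v")
      case True
      have "(idg v - 1) OR 1 \<le> idg v"
        using or_one_le(1)[of "idg v - 1"] True by linarith
      then have "2 ^ (len v - 1) \<le> idg v"
        unfolding len_def using bitlen_ge[OF or_one_pos[of "idg v - 1"]] by linarith
      then have "real (2 ^ (len v - 1)) \<le> real (idg v)"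
        by (simp only: of_nat_le_iff)
      then have "2 powr real (len v - 1) \<le> real (idg v)"
        by (simp add: powr_realpow)
      then have "real (len v - 1) \<le> log 2 (real (idg v))"
        using True by (subst le_log_iff) auto
      then have "real (len v) - 1 \<le> real_of_int \<lceil>log 2 (real (idg v))\<rceil>"
        using len_pos'[of v] by (simp add: of_nat_diff) linarith
      then show ?thesis using True by simp
    next
      case False
      then have "len v \<le> 1" using len_idg[of v] by (cases "idg v = 0") auto
      then show ?thesis using False by simp
    qed
  qed
  also have "\<dots> = real (nverts G) + real_of_int (L0_in G)"
    unfolding L0_in_eq by (simp add: sum.distrib)
  finally show ?thesis .
qed

text \<open>\<open>2 ^ b\<close> is at most twice \<open>n + m\<close>, and
  \<open>m \<le> n * n\<close>, so \<open>2 ^ b\<close> is at most the square of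
  \<open>2 * n\<close>. This makes lower-order parts of the memory comparable with
  \<open>n\<close>.\<close>

lemma pow_half: "2 ^ (b div 2) \<le> 2 * nverts G"
proof -
  have "(2 ^ (b div 2))\<^sup>2 \<le> (2::nat) ^ b"
    unfolding power_mult[symmetric] by (intro power_increasing) auto
  also have "\<dots> \<le> 2 * (nverts G + nverts G * nverts G)"
    using size_ge nedges_le two_pow unfolding distrib_left by linarith
  also have "\<dots> \<le> (2 * nverts G)\<^sup>2"
    using nverts_pos by (simp add: power2_eq_square)
  finally show ?thesis
    by (rule power2_le_imp_le) simp
qed

lemma cells_space:
  "real ((r + cells) * b) \<le> 2 * (real (nverts G) + real_of_int (L0_in G)) *
    (1 + (15 + real r) * (log 2 (real b) / real b))"
proof -
  define S where "S = real (nverts G) + real_of_int (L0_in G)"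
  define l where "l = log 2 (real b)"
  have b: "64 \<le> real b" using b_ge by simp
  have N: "real N \<le> S" unfolding S_def by (rule N_le_L0)
  have nS: "real (nverts G) \<le> S" unfolding S_def using L0_in_nonneg by simp
  have S0: "0 \<le> S" using nS by linarith
  have l1: "1 \<le> l"
    unfolding l_def using b by (subst le_log_iff) auto
  have q0: "0 < real q" and q4: "real b \<le> 4 * real q"
  proof -
    show "0 < real q" using q_ge by simp
    have "b \<le> 4 * q" using q_ge' q_ge b_ge by linarith
    then show "real b \<le> 4 * real q" by linarith
  qed
  have rrl: "real rr \<le> 2 * l + 1"
  proof -
    have "0 < b * b" using b_ge by simp
    then have "2 ^ (rr - 1) \<le> b * b" unfolding rr_def by (rule bitlen_ge)
    then have "real (2 ^ (rr - 1)) \<le> real (b * b)" by (simp only: of_nat_le_iff)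
    then have "2 powr real (rr - 1) \<le> real b * real b" by (simp add: powr_realpow)
    then have "real (rr - 1) \<le> log 2 (real b * real b)"
      using b by (subst le_log_iff) auto
    also have "\<dots> = 2 * l" using b by (simp add: log_mult l_def)
    finally show ?thesis using rr_pos by (simp add: of_nat_diff)
  qed
  \<comment> \<open>The number of bits paid per position. It is close to 2 because
    \<open>2 * q\<close> differs from \<open>b\<close> only by \<open>rr\<close>, which is
    \<open>O(log b)\<close>, and rounding.\<close>
  have quot: "real b / real q \<le> 2 + 16 * l / real b"
  proof -
    have "b \<le> 2 * q + 1 + rr" unfolding q_def by linarith
    then have "real b \<le> 2 * real q + (2 * l + 2)" using rrl by linarith
    then have "real b / real q \<le> (2 * real q + (2 * l + 2)) / real q"
      using q0 by (intro divide_right_mono) auto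
    also have "\<dots> = 2 + (2 * l + 2) / real q" using q0 by (simp add: field_simps)
    also have "(2 * l + 2) / real q \<le> (4 * l) / (real b / 4)"
      using q0 q4 l1 b by (intro frac_le) auto
    finally show ?thesis by simp
  qed
  have t1: "real (N div q) * real b \<le> S * (2 + 16 * l / real b)"
  proof -
    have "real (N div q) * real q \<le> real N"
      using div_times_less_eq_dividend[of N q] by (metis of_nat_le_iff of_nat_mult)
    then have "real (N div q) \<le> real N / real q" using q0 by (simp add: pos_le_divide_eq)
    then have "real (N div q) * real b \<le> real N / real q * real b"
      by (intro mult_right_mono) auto
    also have "\<dots> = real N * (real b / real q)" by simp
    also have "\<dots> \<le> S * (2 + 16 * l / real b)"
      using N quot S0 l1 by (intro mult_mono) auto
    finally show ?thesis .
  qed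
  \<comment> \<open>A single block rank for every \<open>b\<close> cells costs only a fraction of
    order \<open>1 / b\<close> of the main term.\<close>
  have t2: "real (N div (q * b)) * real b \<le> S * (4 / real b)"
  proof -
    have "N div (q * b) * b * q \<le> N"
      using div_times_less_eq_dividend[of N "q * b"] by (simp add: mult_ac)
    then have "real (N div (q * b)) * real b * real q \<le> real N"
      by (metis of_nat_le_iff of_nat_mult)
    then have "real (N div (q * b)) * real b \<le> real N / real q"
      using q0 by (simp add: pos_le_divide_eq)
    also have "\<dots> \<le> S / (real b / 4)"
      using N S0 q0 q4 b by (intro frac_le) auto
    finally show ?thesis by simp
  qed
  have sq: "b * b < 2 ^ (b div 4)" by (rule square_less_pow[OF b_ge])
  \<comment> \<open>The popcount table: \<open>b * b\<close> and \<open>2 ^ h\<close> fit into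
    \<open>b div 4\<close> and \<open>b div 8\<close> bits, and together they stay below
    \<open>2 ^ (b div 2)\<close>.\<close>
  have t3: "2 ^ h * real b \<le> S * (2 / real b)"
  proof -
    have "b * b * 2 ^ h \<le> 2 ^ (b div 4) * 2 ^ h"
      using sq by (intro mult_right_mono) auto
    also have "\<dots> = (2::nat) ^ (b div 4 + h)" by (simp add: power_add)
    also have "\<dots> \<le> 2 ^ (b div 2)"
      unfolding h_def by (intro power_increasing) auto
    finally have "b * b * 2 ^ h \<le> 2 * nverts G" using pow_half by linarith
    then have "real (b * b * 2 ^ h) \<le> real (2 * nverts G)" by (simp only: of_nat_le_iff)
    then have "2 ^ h * real b * real b \<le> 2 * S" using nS by (simp add: mult_ac)
    then show ?thesis using b by (simp add: field_simps)
  qed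
  \<comment> \<open>The \<open>b + 1\<close> counters, two cells due to rounding, and the
    \<open>r\<close> registers.\<close>
  have t4: "real (b + 3 + r) * real b \<le> S * ((8 + 2 * real r) / real b)"
  proof -
    have "b * b * b \<le> b * b * (b * b)" using b_ge by simp
    also have "\<dots> \<le> 2 ^ (b div 4) * 2 ^ (b div 4)"
      using sq by (intro mult_mono) auto
    also have "\<dots> = (2::nat) ^ (b div 4 + b div 4)" by (simp add: power_add)
    also have "\<dots> \<le> 2 ^ (b div 2)" by (intro power_increasing) auto
    finally have "b * b * b \<le> 2 * nverts G" using pow_half by linarith
    then have "real (b * b * b) \<le> real (2 * nverts G)" by (simp only: of_nat_le_iff)
    then have bbb: "real b * real b * real b \<le> 2 * S" using nS by simp
    have "real (b + 3 + r) \<le> (4 + real r) * real b"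
    proof -
      have "real r * 1 \<le> real r * real b" using b by (intro mult_left_mono) auto
      then show ?thesis using b by (simp add: algebra_simps)
    qed
    then have "real (b + 3 + r) * real b \<le> (4 + real r) * real b * real b"
      by (intro mult_right_mono) auto
    then have "real (b + 3 + r) * real b * real b \<le> (4 + real r) * (real b * real b * real b)"
      using mult_right_mono[of "real (b + 3 + r) * real b" "(4 + real r) * real b * real b" "real b"]
      by (simp add: mult_ac)
    also have "\<dots> \<le> (4 + real r) * (2 * S)"
      using bbb by (intro mult_left_mono) auto
    finally have "real (b + 3 + r) * real b * real b \<le> S * (8 + 2 * real r)"
      by (simp add: algebra_simps)
    then show ?thesis using b by (simp add: pos_le_divide_eq)
  qed
  have "r + cells = 2 ^ h + N div (q * b) + N div q + (b + 3 + r)"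
    by (simp add: cells_def CB_def SB_def)
  then have "real ((r + cells) * b) =
      2 ^ h * real b + real (N div (q * b)) * real b + real (N div q) * real b + real (b + 3 + r) * real b"
    by (simp only: of_nat_mult of_nat_add of_nat_power of_nat_numeral distrib_right)
  also have "\<dots> \<le> S * (2 / real b) + S * (4 / real b) + S * (2 + 16 * l / real b) + S * ((8 + 2 * real r) / real b)"
    using t1 t2 t3 t4 by linarith
  \<comment> \<open>Half of the collected numerators \<open>2 + 4 + 16 * l + (8 + 2 * r)\<close>;
    the summand 2 of the main term gives the leading 1.\<close>
  also have "\<dots> = 2 * S * (1 + (8 * l + 7 + real r) / real b)"
    using b by (simp add: field_simps)
  also have "\<dots> \<le> 2 * S * (1 + (15 + real r) * l / real b)"
  proof -
    have "(7 + real r) * 1 \<le> (7 + real r) * l" using l1 by (intro mult_left_mono) auto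
    then have "8 * l + 7 + real r \<le> (15 + real r) * l" by (simp add: algebra_simps)
    then have "(8 * l + 7 + real r) / real b \<le> (15 + real r) * l / real b"
      using b by (intro divide_right_mono) auto
    then show ?thesis using S0 by (intro mult_left_mono) auto
  qed
  finally show ?thesis unfolding S_def l_def by simp
qed

text \<open>From \<open>n < 2 ^ b\<close> and \<open>2 ^ (b - 1) \<le> 2 * n * n\<close> it follows
  that \<open>b\<close> lies between \<open>log n\<close> and \<open>3 * log n\<close>; the factor
  \<open>log 3 < 2\<close> is absorbed because \<open>log log n \<ge> 1\<close>.\<close>

lemma log_b_le:
  assumes n: "2 ^ 63 \<le> nverts G"
  shows "log 2 (real b) / real b \<le> 3 * (log 2 (log 2 (real (nverts G))) / log 2 (real (nverts G)))"
proof -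
  define l where "l = log 2 (real (nverts G))"
  have n': "2 ^ 63 \<le> real (nverts G)" using n by (metis of_nat_le_iff of_nat_numeral of_nat_power)
  have l63: "63 \<le> l"
    unfolding l_def using n' by (subst le_log_iff) (auto simp: powr_numeral)
  have "real (nverts G) < real (2 ^ b)" using nverts_less by (simp only: of_nat_less_iff)
  then have "real (nverts G) < 2 powr real b" by (simp add: powr_realpow)
  then have lb: "l \<le> real b"
    unfolding l_def using n' by (intro less_imp_le) (subst log_less_iff, auto)
  have "2 ^ (b - 1) \<le> 2 * (nverts G * nverts G)"
  proof -
    have "nverts G * 1 \<le> nverts G * nverts G" using nverts_pos by (intro mult_left_mono) auto
    then show ?thesis using size_ge nedges_le by linarith
  qed
  then have "real (2 ^ (b - 1)) \<le> real (2 * (nverts G * nverts G))" by (simp only: of_nat_le_iff)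
  then have "2 powr real (b - 1) \<le> 2 * (real (nverts G) * real (nverts G))" by (simp add: powr_realpow)
  then have "real (b - 1) \<le> log 2 (2 * (real (nverts G) * real (nverts G)))"
    using n' by (subst le_log_iff) auto
  also have "\<dots> = 1 + 2 * l"
    using n' by (simp add: log_mult l_def)
  finally have bl: "real b \<le> 3 * l" using l63 b_ge by (simp add: of_nat_diff)
  have ll: "1 \<le> log 2 l" using l63 by (subst le_log_iff) auto
  have "log 2 (real b) \<le> log 2 (3 * l)"
    using bl lb l63 by (subst log_le_cancel_iff) auto
  also have "\<dots> = log 2 3 + log 2 l" using l63 by (simp add: log_mult)
  also have "log 2 3 \<le> log 2 (4::real)" by (subst log_le_cancel_iff) auto
  also note log_2_4
  finally have "log 2 (real b) \<le> 3 * log 2 l" using ll by simp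
  then have "log 2 (real b) / real b \<le> 3 * log 2 l / l"
    using lb l63 ll by (intro frac_le) auto
  then show ?thesis unfolding l_def by simp
qed

end

theorem theorem4p7:
  shows "\<exists>(P :: program) (C :: real) (\<epsilon>a :: nat \<Rightarrow> real) (\<epsilon>b :: nat \<Rightarrow> real) (\<epsilon>c :: nat \<Rightarrow> real).
    \<epsilon>a \<in> O(\<lambda>n. log 2 (log 2 (real n)) / log 2 (real n)) \<and>
    \<epsilon>b \<in> O(\<lambda>n. log 2 (log 2 (real n)) / log 2 (real n)) \<and>
    \<epsilon>c \<in> O(\<lambda>n. log 2 (log 2 (real n)) / log 2 (real n)) \<and>
    (\<forall>G w n m. valid_input G \<longrightarrow> acyclic (edges G) \<longrightarrow> word_length_ok w G \<longrightarrow>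
       n = nverts G \<longrightarrow> m = nedges G \<longrightarrow>
       computes_in_time P w G (topological_sorting G) (C * real (n + m)) \<and>
       runs_in_space P w G ((2 * real n + 2 * real_of_int (L0_in G)) * (1 + \<epsilon>a n)) \<and>
       runs_in_space P w G ((2 * real n + 4 / 3 * real m) * (1 + \<epsilon>b n)) \<and>
       runs_in_space P w G (2 * real n * log 2 (2 + 4 * real m / real n) * (1 + \<epsilon>c n)))"
proof -
  define r where "r = num_regs topsort_program"
  \<comment> \<open>For \<open>n < 2 ^ 63\<close>, \<open>m \<le> n * n\<close> gives
    \<open>n + m < 2 ^ 127\<close>; thus 127 bits suffice for each of the \<open>r\<close> registers
    and of the \<open>n + 1 \<le> 2 ^ 63\<close> cells.\<close>
  define c1 where "c1 = real ((r + 2 ^ 63) * 127)"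
  \<comment> \<open>The factor \<open>15 + r\<close> comes from \<open>cells_space\<close>, the 3
    from \<open>log_b_le\<close>.\<close>
  define c2 where "c2 = 3 * (15 + real r)"
  define g where "g = (\<lambda>n. log 2 (log 2 (real n)) / log 2 (real n))"
  \<comment> \<open>Membership in \<open>O(g)\<close> concerns large \<open>n\<close> only. Below
    \<open>2 ^ 63\<close> the constant exceeds the whole space need, and the degenerate values of
    \<open>g\<close> at small arguments are avoided.\<close>
  define \<epsilon> where "\<epsilon> = (\<lambda>n. if n < 2 ^ 63 then c1 else c2 * g n)"
  have c: "0 \<le> c1" "0 \<le> c2" by (simp_all add: c1_def c2_def)
  have g: "0 \<le> g n" if "2 ^ 63 \<le> n" for n
  proof -
    have "(2::real) ^ 63 \<le> real n" using that by (metis of_nat_le_iff of_nat_numeral of_nat_power)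
    then have "63 \<le> log 2 (real n)" by (subst le_log_iff) (auto simp: powr_numeral)
    then show ?thesis unfolding g_def by (intro divide_nonneg_nonneg) auto
  qed
  have \<epsilon>0: "0 \<le> \<epsilon> n" for n
    using c g[of n] by (auto simp: \<epsilon>_def not_less)
  have O: "\<epsilon> \<in> O(g)"
  proof (rule bigoI[of _ c2])
    show "\<forall>\<^sub>F n in at_top. norm (\<epsilon> n) \<le> c2 * norm (g n)"
      using eventually_ge_at_top[of "2 ^ 63 :: nat"]
      by eventually_elim (use c g in \<open>auto simp: \<epsilon>_def\<close>)
  qed
  have main: "computes_in_time topsort_program w G (topological_sorting G) (20000 * real (n + m)) \<and>
       runs_in_space topsort_program w G ((2 * real n + 2 * real_of_int (L0_in G)) * (1 + \<epsilon> n)) \<and>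
       runs_in_space topsort_program w G ((2 * real n + 4 / 3 * real m) * (1 + \<epsilon> n)) \<and>
       runs_in_space topsort_program w G (2 * real n * log 2 (2 + 4 * real m / real n) * (1 + \<epsilon> n))"
    if G: "valid_input G" "acyclic (edges G)" "word_length_ok w G" and nm: "n = nverts G" "m = nedges G"
    for G w n m
  proof -
    interpret machine G w "bitlen (nverts G + nedges G)"
      by (rule machine_bitlen[OF G(1,3)])
    let ?S = "(2 * real n + 2 * real_of_int (L0_in G)) * (1 + \<epsilon> n)"
    have main: "computes_in_time topsort_program w G (topological_sorting G) (20000 * real (n + m)) \<and>
        (\<forall>S\<ge>?S. runs_in_space topsort_program w G S)"
    proof (cases "n < 2 ^ 63")
      case True
      let ?b = "bitlen (nverts G + nedges G)"
      have n: "nverts G < 2 ^ 63" using True nm by simp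
      have "?b \<le> 127"
      proof (rule bitlen_le)
        have "nverts G * nverts G \<le> 2 ^ 63 * 2 ^ 63"
          using n by (intro mult_mono) auto
        then show "nverts G + nedges G < 2 ^ 127" using nedges_le n by simp
      qed
      then have "(r + (nverts G + 1)) * ?b \<le> (r + 2 ^ 63) * 127"
        using n by (intro mult_mono) auto
      then have "real ((r + (nverts G + 1)) * ?b) \<le> c1"
        unfolding c1_def by (simp only: of_nat_le_iff)
      also have "c1 \<le> ?S"
      proof -
        have "1 * (1 + c1) \<le> (2 * real n + 2 * real_of_int (L0_in G)) * (1 + c1)"
          using nverts_pos L0_in_nonneg c nm by (intro mult_right_mono) auto
        then show ?thesis using True by (simp add: \<epsilon>_def)
      qed
      finally show ?thesis
        using topsort_small[OF G n] nm unfolding r_def by auto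
    next
      case False
      then have n: "2 ^ 63 \<le> nverts G" using nm by simp
      interpret big_machine G w "bitlen (nverts G + nedges G)"
        by (rule big_machine_bitlen[OF G(1,3) n])
      let ?b = "bitlen (nverts G + nedges G)"
      have "real ((r + cells) * ?b) \<le> 2 * (real n + real_of_int (L0_in G)) *
          (1 + (15 + real r) * (log 2 (real ?b) / real ?b))"
        using cells_space[of r] nm by simp
      also have "\<dots> \<le> 2 * (real n + real_of_int (L0_in G)) * (1 + \<epsilon> n)"
      proof (intro mult_left_mono add_left_mono)
        have "(15 + real r) * (log 2 (real ?b) / real ?b) \<le> (15 + real r) * (3 * g n)"
          unfolding g_def nm(1) by (intro mult_left_mono log_b_le[OF n]) auto
        moreover have "\<epsilon> n = (15 + real r) * (3 * g n)"
          using False by (simp add: \<epsilon>_def c2_def)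
        ultimately show "(15 + real r) * (log 2 (real ?b) / real ?b) \<le> \<epsilon> n"
          by (simp only:)
        show "0 \<le> 2 * (real n + real_of_int (L0_in G))"
          using L0_in_nonneg by simp
      qed
      finally have "real ((r + cells) * ?b) \<le> ?S" by (simp add: algebra_simps)
      then show ?thesis
        using topsort_big[OF G n] nm unfolding r_def by auto
    qed
    have "2 * real n + 2 * real_of_int (L0_in G) \<le> 2 * real n + 4 / 3 * real m"
    proof -
      have "real_of_int (3 * L0_in G) \<le> real_of_int (2 * int (nedges G))"
        using L0_in_edges by (simp only: of_int_le_iff)
      then show ?thesis using nm by simp
    qed
    then have b: "?S \<le> (2 * real n + 4 / 3 * real m) * (1 + \<epsilon> n)"
      using \<epsilon>0[of n] by (intro mult_right_mono) auto
    have "2 * real n + 2 * real_of_int (L0_in G) \<le> 2 * real n * log 2 (2 + 4 * real m / real n)"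
      using L0_in_log nm by simp
    then have c: "?S \<le> 2 * real n * log 2 (2 + 4 * real m / real n) * (1 + \<epsilon> n)"
      using \<epsilon>0[of n] by (intro mult_right_mono) auto
    show ?thesis using main b c by blast
  qed
  show ?thesis
    using O main unfolding g_def by blast
qed

end
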